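(* Let $P$ be a finitely generated symmetric operad over a field $\Bbbk$ of characteristic zero which is shuffle regular with a finite Gröbner basis. Then its exponential generating series $E_P(z)=\sum_{n\ge1}\frac{\dim P(n)}{n!}z^n$ is differential algebraic, i.e. there exist $n\ge 0$ and a non-constant polynomial $\theta$ in $n+2$ variables with rational coefficients such that $\theta\bigl(z,E_P(z),E_P'(z),\dots,E_P^{(n)}(z)\bigr)=0$.
   Context: $\Bbbk$ is a field of characteristic zero. Let $\Upsilon=\bigsqcup_{n\ge1}\Upsilon_n$ be a set of operations ($\Upsilon_n$ the $n$-ary ones). A shuffle monomial of arity $n$ is a planar rooted tree with $n$ leaves, each vertex having at least one input, each vertex with $k$ inputs labeled by an element of $\Upsilon_k$, and the leaves labeled bijectively by $1,\dots,n$ such that at every vertex the minimal leaf labels reachable through its inputs increase from left to right. The shuffle monomials form a linear basis of the free shuffle operad $\mathcal F(\Upsilon)$; its (shuffle) compositions are given by grafting one shuffle monomial into a leaf of another, with any relabeling of the leaves that keeps the relative order of the leaves of the grafted tree and the relative order of the leaves of the lower tree (a grafted tree being represented by its minimal leaf) and yields a shuffle monomial. A connected subtree $u$ of a shuffle monomial $v$ becomes a shuffle tree by assigning to each of its inputs the minimum of the leaves of $v$ reached through it; $v$ is divisible by $w$ if some such $u$ is isomorphic to $w$ as a labeled tree by an isomorphism preserving the order of the leaves. A symmetric operad $P$ is considered as a shuffle operad (forget the symmetric group actions, keep the shuffle compositions; dimensions of components are unchanged), and is presented as $\mathcal F(\Upsilon)/C$, where $\Upsilon$ is a linear basis of the generating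 symmetric collection and $C$ is an ideal. An admissible order is a total well-order on the shuffle monomials of each arity compatible with shuffle compositions; the leading monomial of a nonzero element is its largest monomial. A Gröbner basis of $C$ is a subset $G\subset C$ such that the leading monomial of every nonzero element of $C$ is divisible by the leading monomial of an element of $G$; it is reduced if its elements have leading coefficient $1$ and no monomial occurring in an element of $G$ is divisible by the leading monomial of another element of $G$. The planar skeleton of a shuffle monomial is the planar vertex-labeled tree obtained by erasing the labels of the leaves. A set $M$ of shuffle monomials is shuffle regular if for each $m\in M$ all shuffle monomials with the same planar skeleton as $m$ belong to $M$. The operad $P$ is shuffle regular with a finite Gröbner basis if, for a finite $\Upsilon$ and some admissible order, $C$ has a finite reduced Gröbner basis whose set of leading monomials is shuffle regular. All components $P(n)$ are finite-dimensional, so that $E_P$ is defined. *)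

theory Defs
  imports
    "HOL-Library.Poly_Mapping"
    "HOL-Combinatorics.Permutations"
    "HOL-Computational_Algebra.Formal_Power_Series"
begin

section \<open>Symmetric collections and symmetric operads\<close>

text \<open>
  The components of a collection are subspaces of one ambient vector space
  (for instance of their direct sum). Only the components of arity \<open>n \<ge> 1\<close> are part of
  the structure; component \<open>0\<close> is never used.

  Permutations of \<open>{1..n}\<close> act from the left by renaming inputs: in
  \<open>relabel V n \<sigma> x\<close> the input \<open>i\<close> of \<open>x\<close> has been renamed to \<open>\<sigma> i\<close>. The right action
  usual for operads is \<open>x \<sigma> = relabel V n (inv \<sigma>) x\<close>.
\<close>

record ('k, 'p) collection =
  smult :: "'k \<Rightarrow> 'p \<Rightarrow> 'p"
  component :: "nat \<Rightarrow> 'p set"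
  relabel :: "nat \<Rightarrow> (nat \<Rightarrow> nat) \<Rightarrow> 'p \<Rightarrow> 'p"

locale symmetric_collection =
  fixes V :: "('k::field_char_0, 'p::ab_group_add, 'm) collection_scheme"
  assumes vector_space: "vector_space (smult V)"
    and subspace: "n \<ge> 1 \<Longrightarrow> module.subspace (smult V) (component V n)"
    and relabel_closed:
      "\<lbrakk>n \<ge> 1; \<sigma> permutes {1..n}; x \<in> component V n\<rbrakk> \<Longrightarrow> relabel V n \<sigma> x \<in> component V n"
    and relabel_add:
      "\<lbrakk>n \<ge> 1; \<sigma> permutes {1..n}; x \<in> component V n; y \<in> component V n\<rbrakk>
        \<Longrightarrow> relabel V n \<sigma> (x + y) = relabel V n \<sigma> x + relabel V n \<sigma> y"
    and relabel_smult:
      "\<lbrakk>n \<ge> 1; \<sigma> permutes {1..n}; x \<in> component V n\<rbrakk>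
        \<Longrightarrow> relabel V n \<sigma> (smult V c x) = smult V c (relabel V n \<sigma> x)"
    and relabel_id: "\<lbrakk>n \<ge> 1; x \<in> component V n\<rbrakk> \<Longrightarrow> relabel V n id x = x"
    and relabel_comp:
      "\<lbrakk>n \<ge> 1; \<sigma> permutes {1..n}; \<tau> permutes {1..n}; x \<in> component V n\<rbrakk>
        \<Longrightarrow> relabel V n (\<sigma> \<circ> \<tau>) x = relabel V n \<sigma> (relabel V n \<tau> x)"

text \<open>
  \<open>pcomp P m i n x y\<close> is the partial composition of \<open>x \<in> P(m)\<close> and \<open>y \<in> P(n)\<close> that
  inserts \<open>y\<close> into the input \<open>i\<close> of \<open>x\<close>. Its inputs are numbered as usual: the input \<open>k < i\<close>
  of \<open>x\<close> keeps its number, the input \<open>j\<close> of \<open>y\<close> gets the number \<open>i - 1 + j\<close>, and the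
  input \<open>k > i\<close> of \<open>x\<close> gets the number \<open>k + n - 1\<close>.
\<close>

record ('k, 'p) operad = "('k, 'p) collection" +
  unit :: 'p
  pcomp :: "nat \<Rightarrow> nat \<Rightarrow> nat \<Rightarrow> 'p \<Rightarrow> 'p \<Rightarrow> 'p"

text \<open>
  The permutation of \<open>{1..m+n-1}\<close> that renames the inputs of a composite at \<open>i\<close> when the
  inputs of the outer operation are renamed by \<open>\<sigma>\<close> and those of the inner one by \<open>\<tau>\<close>
  (the composite then being taken at \<open>\<sigma> i\<close>).
\<close>

definition outer_pos :: "nat \<Rightarrow> nat \<Rightarrow> nat \<Rightarrow> nat" where
  "outer_pos n i k = (if k < i then k else k + n - 1)"

definition block_perm :: "nat \<Rightarrow> nat \<Rightarrow> nat \<Rightarrow> (nat \<Rightarrow> nat) \<Rightarrow> (nat \<Rightarrow> nat) \<Rightarrow> nat \<Rightarrow> nat" where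
  "block_perm m i n \<sigma> \<tau> p =
    (if p < i then outer_pos n (\<sigma> i) (\<sigma> p)
     else if p < i + n then \<sigma> i - 1 + \<tau> (p - i + 1)
     else if p < m + n then outer_pos n (\<sigma> i) (\<sigma> (p - n + 1))
     else p)"

locale symmetric_operad = symmetric_collection P
  for P :: "('k::field_char_0, 'p::ab_group_add) operad" +
  assumes unit_closed: "unit P \<in> component P 1"
    and pcomp_closed:
      "\<lbrakk>n \<ge> 1; i \<in> {1..m}; x \<in> component P m; y \<in> component P n\<rbrakk>
        \<Longrightarrow> pcomp P m i n x y \<in> component P (m + n - 1)"
    and pcomp_add_left:
      "\<lbrakk>n \<ge> 1; i \<in> {1..m}; x \<in> component P m; x' \<in> component P m; y \<in> component P n\<rbrakk>
        \<Longrightarrow> pcomp P m i n (x + x') y = pcomp P m i n x y + pcomp P m i n x' y"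
    and pcomp_add_right:
      "\<lbrakk>n \<ge> 1; i \<in> {1..m}; x \<in> component P m; y \<in> component P n; y' \<in> component P n\<rbrakk>
        \<Longrightarrow> pcomp P m i n x (y + y') = pcomp P m i n x y + pcomp P m i n x y'"
    and pcomp_smult_left:
      "\<lbrakk>n \<ge> 1; i \<in> {1..m}; x \<in> component P m; y \<in> component P n\<rbrakk>
        \<Longrightarrow> pcomp P m i n (smult P c x) y = smult P c (pcomp P m i n x y)"
    and pcomp_smult_right:
      "\<lbrakk>n \<ge> 1; i \<in> {1..m}; x \<in> component P m; y \<in> component P n\<rbrakk>
        \<Longrightarrow> pcomp P m i n x (smult P c y) = smult P c (pcomp P m i n x y)"
    and unit_left: "\<lbrakk>n \<ge> 1; x \<in> component P n\<rbrakk> \<Longrightarrow> pcomp P 1 1 n (unit P) x = x"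
    and unit_right: "\<lbrakk>i \<in> {1..m}; x \<in> component P m\<rbrakk> \<Longrightarrow> pcomp P m i 1 x (unit P) = x"
    and assoc_sequential:
      "\<lbrakk>l \<ge> 1; i \<in> {1..m}; j \<in> {1..n};
        x \<in> component P m; y \<in> component P n; z \<in> component P l\<rbrakk>
        \<Longrightarrow> pcomp P (m + n - 1) (i - 1 + j) l (pcomp P m i n x y) z =
            pcomp P m i (n + l - 1) x (pcomp P n j l y z)"
    and assoc_parallel:
      "\<lbrakk>n \<ge> 1; l \<ge> 1; i \<in> {1..m}; k \<in> {1..m}; i < k;
        x \<in> component P m; y \<in> component P n; z \<in> component P l\<rbrakk>
        \<Longrightarrow> pcomp P (m + n - 1) (k + n - 1) l (pcomp P m i n x y) z =
            pcomp P (m + l - 1) i n (pcomp P m k l x z) y"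
    and equivariant:
      "\<lbrakk>n \<ge> 1; i \<in> {1..m}; \<sigma> permutes {1..m}; \<tau> permutes {1..n};
        x \<in> component P m; y \<in> component P n\<rbrakk>
        \<Longrightarrow> pcomp P m (\<sigma> i) n (relabel P m \<sigma> x) (relabel P n \<tau> y) =
            relabel P (m + n - 1) (block_perm m i n \<sigma> \<tau>) (pcomp P m i n x y)"

definition suboperad ::
  "('k::field_char_0, 'p::ab_group_add) operad \<Rightarrow> (nat \<Rightarrow> 'p set) \<Rightarrow> bool" where
  "suboperad P Q \<longleftrightarrow>
     (\<forall>n\<ge>1. Q n \<subseteq> component P n \<and> module.subspace (smult P) (Q n)) \<and>
     (\<forall>n\<ge>1. \<forall>\<sigma>. \<forall>x\<in>Q n. \<sigma> permutes {1..n} \<longrightarrow> relabel P n \<sigma> x \<in> Q n) \<and>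
     unit P \<in> Q 1 \<and>
     (\<forall>m\<ge>1. \<forall>n\<ge>1. \<forall>i\<in>{1..m}. \<forall>x\<in>Q m. \<forall>y\<in>Q n. pcomp P m i n x y \<in> Q (m + n - 1))"

definition finitely_generated :: "('k::field_char_0, 'p::ab_group_add) operad \<Rightarrow> bool" where
  "finitely_generated P \<longleftrightarrow>
     (\<exists>S. finite S \<and> (\<forall>(n, x)\<in>S. n \<ge> 1 \<and> x \<in> component P n) \<and>
       (\<forall>Q. suboperad P Q \<and> (\<forall>(n, x)\<in>S. x \<in> Q n) \<longrightarrow> (\<forall>n\<ge>1. Q n = component P n)))"

definition finite_dimensional_components ::
  "('k::field_char_0, 'p::ab_group_add) operad \<Rightarrow> bool" where
  "finite_dimensional_components P \<longleftrightarrow>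
     (\<forall>n\<ge>1. \<exists>B. finite B \<and> component P n = module.span (smult P) B)"

section \<open>Shuffle compositions in a symmetric operad\<close>

text \<open>
  A shuffle composition of operations of arities \<open>m\<close> and \<open>n\<close> is determined by the set \<open>J\<close>
  of the \<open>n\<close> labels that the inputs of the grafted operation receive. Since the grafted
  operation is represented among the inputs of the lower one by \<open>Min J\<close>, and all labels
  below \<open>Min J\<close> belong to the lower operation, it is grafted into the input \<open>Min J\<close>.
\<close>

definition shuffle_sets :: "nat \<Rightarrow> nat \<Rightarrow> nat set set" where
  "shuffle_sets m n = {J. J \<subseteq> {1..m + n - 1} \<and> card J = n}"

text \<open>The \<open>k\<close>-th smallest element of a finite set, counting from \<open>1\<close>.\<close>

definition nth_smallest :: "nat set \<Rightarrow> nat \<Rightarrow> nat" where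
  "nth_smallest A k = sorted_list_of_set A ! (k - 1)"

text \<open>
  The labels of the inputs of the composite at \<open>Min J\<close>, in the numbering of \<open>pcomp\<close>.
\<close>

definition shuffle_perm :: "nat \<Rightarrow> nat \<Rightarrow> nat set \<Rightarrow> nat \<Rightarrow> nat" where
  "shuffle_perm m n J p =
    (if p < Min J then p
     else if p < Min J + n then nth_smallest J (p - Min J + 1)
     else if p < m + n then nth_smallest ({1..m + n - 1} - J) (p - n)
     else p)"

definition shuffle_pcomp ::
  "('k::field_char_0, 'p::ab_group_add) operad \<Rightarrow> nat \<Rightarrow> nat \<Rightarrow> nat set \<Rightarrow> 'p \<Rightarrow> 'p \<Rightarrow> 'p" where
  "shuffle_pcomp P m n J x y =
     relabel P (m + n - 1) (shuffle_perm m n J) (pcomp P m (Min J) n x y)"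

section \<open>Shuffle monomials\<close>

datatype ('u, 'l) ltree = Leaf 'l | Vertex 'u "('u, 'l) ltree list"

fun leaves :: "('u, 'l) ltree \<Rightarrow> 'l list" where
  "leaves (Leaf l) = [l]"
| "leaves (Vertex u ts) = concat (map leaves ts)"

definition min_leaf :: "('u, nat) ltree \<Rightarrow> nat" where
  "min_leaf t = Min (set (leaves t))"

text \<open>
  \<open>U k\<close> is the set of operations of arity \<open>k\<close>. The trivial tree without vertices is allowed;
  it is the unit.
\<close>

fun shuffle_tree :: "(nat \<Rightarrow> 'u set) \<Rightarrow> ('u, nat) ltree \<Rightarrow> bool" where
  "shuffle_tree U (Leaf l) \<longleftrightarrow> True"
| "shuffle_tree U (Vertex u ts) \<longleftrightarrow>
     ts \<noteq> [] \<and> u \<in> U (length ts) \<and> sorted_wrt (<) (map min_leaf ts) \<and>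
     (\<forall>t\<in>set ts. shuffle_tree U t)"

definition shuffle_monomials :: "(nat \<Rightarrow> 'u set) \<Rightarrow> nat \<Rightarrow> ('u, nat) ltree set" where
  "shuffle_monomials U n =
     {t. shuffle_tree U t \<and> distinct (leaves t) \<and> set (leaves t) = {1..n}}"

definition corolla :: "nat \<Rightarrow> 'u \<Rightarrow> ('u, nat) ltree" where
  "corolla n u = Vertex u (map Leaf [1..<n + 1])"

fun subst_leaves :: "('l \<Rightarrow> ('u, 'l') ltree) \<Rightarrow> ('u, 'l) ltree \<Rightarrow> ('u, 'l') ltree" where
  "subst_leaves f (Leaf l) = f l"
| "subst_leaves f (Vertex u ts) = Vertex u (map (subst_leaves f) ts)"

text \<open>
  Shuffle composition of monomials: the leaves of \<open>t\<close> are relabeled by \<open>J\<close>, those of \<open>s\<close> by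
  the remaining labels together with \<open>Min J\<close>, both keeping their order, and \<open>t\<close> is grafted
  into the leaf of \<open>s\<close> labeled by \<open>Min J\<close>.
\<close>

definition shuffle_graft ::
  "nat set \<Rightarrow> ('u, nat) ltree \<Rightarrow> ('u, nat) ltree \<Rightarrow> ('u, nat) ltree" where
  "shuffle_graft J s t =
    (let m = length (leaves s); n = length (leaves t);
         A = insert (Min J) ({1..m + n - 1} - J)
     in subst_leaves
          (\<lambda>l. if l = Min J then map_ltree id (nth_smallest J) t else Leaf l)
          (map_ltree id (nth_smallest A) s))"

section \<open>The free shuffle operad\<close>

text \<open>Elements are finitely supported linear combinations of shuffle monomials.\<close>

definition free_component ::
  "(nat \<Rightarrow> 'u set) \<Rightarrow> nat \<Rightarrow> (('u, nat) ltree \<Rightarrow>\<^sub>0 'k::field_char_0) set" where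
  "free_component U n = {f. Poly_Mapping.keys f \<subseteq> shuffle_monomials U n}"

definition free_smult ::
  "'k::field_char_0 \<Rightarrow> (('u, nat) ltree \<Rightarrow>\<^sub>0 'k) \<Rightarrow> (('u, nat) ltree \<Rightarrow>\<^sub>0 'k)" where
  "free_smult c f = Poly_Mapping.map ((*) c) f"

definition monomial :: "('u, nat) ltree \<Rightarrow> (('u, nat) ltree \<Rightarrow>\<^sub>0 'k::field_char_0)" where
  "monomial t = Poly_Mapping.single t 1"

definition free_comp ::
  "nat set \<Rightarrow> (('u, nat) ltree \<Rightarrow>\<^sub>0 'k::field_char_0) \<Rightarrow> (('u, nat) ltree \<Rightarrow>\<^sub>0 'k)
    \<Rightarrow> (('u, nat) ltree \<Rightarrow>\<^sub>0 'k)" where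
  "free_comp J f g =
     (\<Sum>s\<in>Poly_Mapping.keys f. \<Sum>t\<in>Poly_Mapping.keys g.
        Poly_Mapping.single (shuffle_graft J s t)
          (Poly_Mapping.lookup f s * Poly_Mapping.lookup g t))"

section \<open>Presentations\<close>

text \<open>A surjective morphism of shuffle operads from the free shuffle operad to \<open>P\<close>.\<close>

definition shuffle_epimorphism ::
  "('k::field_char_0, 'p::ab_group_add) operad \<Rightarrow> (nat \<Rightarrow> 'u set)
    \<Rightarrow> ((('u, nat) ltree \<Rightarrow>\<^sub>0 'k) \<Rightarrow> 'p) \<Rightarrow> bool" where
  "shuffle_epimorphism P U \<phi> \<longleftrightarrow>
     (\<forall>n\<ge>1. \<phi> ` free_component U n = component P n) \<and>
     (\<forall>n\<ge>1. \<forall>f\<in>free_component U n. \<forall>g\<in>free_component U n. \<phi> (f + g) = \<phi> f + \<phi> g) \<and>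
     (\<forall>n\<ge>1. \<forall>f\<in>free_component U n. \<forall>c. \<phi> (free_smult c f) = smult P c (\<phi> f)) \<and>
     \<phi> (monomial (Leaf 1)) = unit P \<and>
     (\<forall>m\<ge>1. \<forall>n\<ge>1. \<forall>J\<in>shuffle_sets m n.
        \<forall>f\<in>free_component U m. \<forall>g\<in>free_component U n.
          \<phi> (free_comp J f g) = shuffle_pcomp P m n J (\<phi> f) (\<phi> g))"

definition collection_morphism ::
  "('k::field_char_0, 'v::ab_group_add) collection \<Rightarrow> ('k, 'p::ab_group_add) operad
    \<Rightarrow> (nat \<Rightarrow> 'v \<Rightarrow> 'p) \<Rightarrow> bool" where
  "collection_morphism V P \<iota> \<longleftrightarrow>
     (\<forall>n\<ge>1. \<forall>x\<in>component V n.
        \<iota> n x \<in> component P n \<and>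
        (\<forall>y\<in>component V n. \<iota> n (x + y) = \<iota> n x + \<iota> n y) \<and>
        (\<forall>c. \<iota> n (smult V c x) = smult P c (\<iota> n x)) \<and>
        (\<forall>\<sigma>. \<sigma> permutes {1..n} \<longrightarrow> \<iota> n (relabel V n \<sigma> x) = relabel P n \<sigma> (\<iota> n x)))"

definition collection_basis ::
  "('k::field_char_0, 'v::ab_group_add) collection \<Rightarrow> (nat \<Rightarrow> 'v set) \<Rightarrow> bool" where
  "collection_basis V U \<longleftrightarrow>
     (\<forall>n\<ge>1. \<not> module.dependent (smult V) (U n) \<and>
             module.span (smult V) (U n) = component V n)"

text \<open>
  \<open>P\<close>, regarded as a shuffle operad, is the quotient of the free shuffle operad on \<open>U\<close> by the
  ideal \<open>C\<close>, where \<open>U\<close> is a linear basis of the symmetric collection \<open>V\<close> generating \<open>P\<close>.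
  The map from \<open>V\<close> to \<open>P\<close> is equivariant but need not be injective.
\<close>

definition presentation ::
  "('k::field_char_0, 'p::ab_group_add) operad \<Rightarrow> ('k, 'v::ab_group_add) collection
    \<Rightarrow> (nat \<Rightarrow> 'v set) \<Rightarrow> (nat \<Rightarrow> (('v, nat) ltree \<Rightarrow>\<^sub>0 'k) set) \<Rightarrow> bool" where
  "presentation P V U C \<longleftrightarrow>
     symmetric_collection V \<and> collection_basis V U \<and>
     (\<exists>\<iota> \<phi>. collection_morphism V P \<iota> \<and> shuffle_epimorphism P U \<phi> \<and>
        (\<forall>n\<ge>1. \<forall>u\<in>U n. \<phi> (monomial (corolla n u)) = \<iota> n u) \<and>
        (\<forall>n\<ge>1. C n = {f \<in> free_component U n. \<phi> f = 0}))"

section \<open>Groebner bases\<close>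

definition admissible_order ::
  "(nat \<Rightarrow> 'u set) \<Rightarrow> (('u, nat) ltree \<Rightarrow> ('u, nat) ltree \<Rightarrow> bool) \<Rightarrow> bool" where
  "admissible_order U le \<longleftrightarrow>
     (\<forall>n\<ge>1. well_order_on (shuffle_monomials U n)
        {(s, t). s \<in> shuffle_monomials U n \<and> t \<in> shuffle_monomials U n \<and> le s t}) \<and>
     (\<forall>m\<ge>1. \<forall>n\<ge>1. \<forall>J\<in>shuffle_sets m n.
        \<forall>s\<in>shuffle_monomials U m. \<forall>s'\<in>shuffle_monomials U m.
        \<forall>t\<in>shuffle_monomials U n. \<forall>t'\<in>shuffle_monomials U n.
          le s s' \<and> le t t' \<longrightarrow> le (shuffle_graft J s t) (shuffle_graft J s' t'))"

definition leading_monomial ::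
  "(('u, nat) ltree \<Rightarrow> ('u, nat) ltree \<Rightarrow> bool)
    \<Rightarrow> (('u, nat) ltree \<Rightarrow>\<^sub>0 'k::field_char_0) \<Rightarrow> ('u, nat) ltree" where
  "leading_monomial le f =
     (THE t. t \<in> Poly_Mapping.keys f \<and> (\<forall>s\<in>Poly_Mapping.keys f. le s t))"

text \<open>
  \<open>upper_subtree t s\<close>: \<open>s\<close> consists of everything above some edge or vertex of \<open>t\<close>.
  \<open>pruning t u\<close>: \<open>u\<close> arises from \<open>t\<close> by cutting off subtrees, each being replaced by a leaf
  carrying the minimum of the removed leaves. A connected subtree has a lowest vertex (or is
  a single edge) and hence is a pruning of an upper subtree.
\<close>

inductive upper_subtree :: "('u, nat) ltree \<Rightarrow> ('u, nat) ltree \<Rightarrow> bool" where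
  "upper_subtree t t"
| "t \<in> set ts \<Longrightarrow> upper_subtree t s \<Longrightarrow> upper_subtree (Vertex u ts) s"

inductive pruning :: "('u, nat) ltree \<Rightarrow> ('u, nat) ltree \<Rightarrow> bool" where
  "pruning t (Leaf (min_leaf t))"
| "list_all2 pruning ts us \<Longrightarrow> pruning (Vertex u ts) (Vertex u us)"

definition connected_subtree :: "('u, nat) ltree \<Rightarrow> ('u, nat) ltree \<Rightarrow> bool" where
  "connected_subtree v u \<longleftrightarrow> (\<exists>s. upper_subtree v s \<and> pruning s u)"

definition divisible :: "('u, nat) ltree \<Rightarrow> ('u, nat) ltree \<Rightarrow> bool" where
  "divisible v w \<longleftrightarrow>
     (\<exists>u f. connected_subtree v u \<and> strict_mono_on (set (leaves u)) f \<and> map_ltree id f u = w)"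

text \<open>
  \<open>C n\<close> is the arity \<open>n\<close> component of the ideal; the elements of \<open>G\<close> are homogeneous in arity.
\<close>

definition groebner_basis ::
  "(('u, nat) ltree \<Rightarrow> ('u, nat) ltree \<Rightarrow> bool)
    \<Rightarrow> (nat \<Rightarrow> (('u, nat) ltree \<Rightarrow>\<^sub>0 'k::field_char_0) set)
    \<Rightarrow> (('u, nat) ltree \<Rightarrow>\<^sub>0 'k) set \<Rightarrow> bool" where
  "groebner_basis le C G \<longleftrightarrow>
     G \<subseteq> (\<Union>n\<in>{1..}. C n) \<and>
     (\<forall>n\<ge>1. \<forall>f\<in>C n. f \<noteq> 0 \<longrightarrow>
        (\<exists>g\<in>G. g \<noteq> 0 \<and> divisible (leading_monomial le f) (leading_monomial le g)))"

definition reduced_groebner_basis ::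
  "(('u, nat) ltree \<Rightarrow> ('u, nat) ltree \<Rightarrow> bool)
    \<Rightarrow> (nat \<Rightarrow> (('u, nat) ltree \<Rightarrow>\<^sub>0 'k::field_char_0) set)
    \<Rightarrow> (('u, nat) ltree \<Rightarrow>\<^sub>0 'k) set \<Rightarrow> bool" where
  "reduced_groebner_basis le C G \<longleftrightarrow>
     groebner_basis le C G \<and>
     (\<forall>g\<in>G. g \<noteq> 0 \<and> Poly_Mapping.lookup g (leading_monomial le g) = 1) \<and>
     (\<forall>g\<in>G. \<forall>h\<in>G. g \<noteq> h \<longrightarrow>
        (\<forall>t\<in>Poly_Mapping.keys g. \<not> divisible t (leading_monomial le h)))"

section \<open>Shuffle regularity\<close>

definition planar_skeleton :: "('u, nat) ltree \<Rightarrow> ('u, Product_Type.unit) ltree" where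
  "planar_skeleton t = map_ltree id (\<lambda>_. ()) t"

definition shuffle_regular :: "(nat \<Rightarrow> 'u set) \<Rightarrow> ('u, nat) ltree set \<Rightarrow> bool" where
  "shuffle_regular U M \<longleftrightarrow>
     (\<forall>t\<in>M. \<forall>n\<ge>1. \<forall>s\<in>shuffle_monomials U n.
        planar_skeleton s = planar_skeleton t \<longrightarrow> s \<in> M)"

definition shuffle_regular_finite_groebner_basis ::
  "(nat \<Rightarrow> 'u set) \<Rightarrow> (nat \<Rightarrow> (('u, nat) ltree \<Rightarrow>\<^sub>0 'k::field_char_0) set) \<Rightarrow> bool" where
  "shuffle_regular_finite_groebner_basis U C \<longleftrightarrow>
     finite {(n, u). n \<ge> 1 \<and> u \<in> U n} \<and>
     (\<exists>le G. admissible_order U le \<and> reduced_groebner_basis le C G \<and> finite G \<and>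
        shuffle_regular U (leading_monomial le ` G))"

section \<open>Generating series and differential algebraicity\<close>

definition exponential_generating_series ::
  "('k::field_char_0, 'p::ab_group_add) operad \<Rightarrow> rat fps" where
  "exponential_generating_series P =
     Abs_fps (\<lambda>n. if n = 0 then 0
                  else of_nat (vector_space.dim (smult P) (component P n)) / fact n)"

text \<open>
  Polynomials in the variables \<open>0, 1, 2, \<dots>\<close> with rational coefficients: finitely supported maps
  from exponent vectors to coefficients.
\<close>

type_synonym rat_mpoly = "(nat \<Rightarrow>\<^sub>0 nat) \<Rightarrow>\<^sub>0 rat"

definition mpoly_vars :: "rat_mpoly \<Rightarrow> nat set" where
  "mpoly_vars \<theta> = (\<Union>a\<in>Poly_Mapping.keys \<theta>. Poly_Mapping.keys a)"

definition mpoly_eval :: "rat_mpoly \<Rightarrow> (nat \<Rightarrow> rat fps) \<Rightarrow> rat fps" where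
  "mpoly_eval \<theta> x =
     (\<Sum>a\<in>Poly_Mapping.keys \<theta>.
        fps_const (Poly_Mapping.lookup \<theta> a) *
        (\<Prod>i\<in>Poly_Mapping.keys a. x i ^ Poly_Mapping.lookup a i))"

text \<open>Variable \<open>0\<close> stands for \<open>z\<close> and variable \<open>i + 1\<close> for the \<open>i\<close>-th derivative.\<close>

definition differential_algebraic :: "rat fps \<Rightarrow> bool" where
  "differential_algebraic E \<longleftrightarrow>
     (\<exists>(n::nat) \<theta>. mpoly_vars \<theta> \<subseteq> {..<n + 2} \<and> mpoly_vars \<theta> \<noteq> {} \<and>
        mpoly_eval \<theta> (\<lambda>i. if i = 0 then fps_X else (fps_deriv ^^ (i - 1)) E) = 0)"

end

theory Submission
  imports Defs
begin

text \<open>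
  By the Groebner basis property, \<open>dim P(n)\<close> is the number of shuffle monomials of arity \<open>n\<close>
  that are not divisible by any leading monomial. Shuffle regularity makes this a condition on
  planar skeletons: the tree avoids finitely many planar patterns, which a finite bottom-up tree
  automaton recognizes. The generating series \<open>f\<^sub>q\<close> of the trees in state \<open>q\<close> and \<open>h\<^sub>w\<close> of the
  forests with state sequence \<open>w\<close> and increasing minimal labels satisfy
  \<open>h\<^sub>q\<^sub>w' = f\<^sub>q' h\<^sub>w\<close>, and \<open>f\<^sub>q\<close> is the sum of the \<open>h\<^sub>w\<close> over all transitions into \<open>q\<close>, plus \<open>z\<close> for
  the state of a leaf. Differentiating gives a linear system for the \<open>f\<^sub>q'\<close> over the algebra
  generated by the \<open>h\<^sub>w\<close>. It can be solved after inverting elements with nonzero constant term,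
  since \<open>P(1)\<close> is finite-dimensional and so chains of unary vertices are bounded. Hence the
  series lies in a finitely generated algebra closed under differentiation.
\<close>

section \<open>Labels, leaves and standardization\<close>

text \<open>A subtree inherits its labels from the surrounding tree, whereas the ideal lives on the
  labels \<open>{1..n}\<close>; ranking the labels mediates between the two, and a divisor is
  completed to the whole tree one cut edge at a time, so that each step is a single shuffle
  composition.

  Regularity is what makes counting possible: avoidance then ignores the leaf labels, so the number
  of trees over a label set depends only on its size. The labels still order the subtrees at a
  vertex by their minima; the first subtree must contain the smallest label, and this boxed product
  is why derivatives enter.

  The system for the derivatives has the form v = d + A v, and 1 - A has to be inverted over power
  series. The constant term of A comes only from unary vertices, where the forest beside the first
  subtree is empty. Recording the length of the unary chain in the state excludes cycles of unary
  transitions, so elimination divides only by units.\<close>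

definition rank_in :: "nat set \<Rightarrow> nat \<Rightarrow> nat" where
  "rank_in A l = card {a \<in> A. a \<le> l}"

text \<open>Ranks start at 1, as does \<open>nth_smallest\<close>; the two are mutually inverse
  order isomorphisms between a finite label set and \<open>{1..card A}\<close>.\<close>

lemma nth_smallest_rank_in:
  assumes "finite A" "l \<in> A"
  shows "nth_smallest A (rank_in A l) = l"
proof -
  let ?xs = "sorted_list_of_set A"
  have set: "set ?xs = A" and dist: "distinct ?xs" and so: "sorted_wrt (<) ?xs"
    using assms(1) by auto
  obtain i where i: "i < length ?xs" "?xs ! i = l"
    using assms(2) set by (metis in_set_conv_nth)
  \<comment> \<open>The sorted list increases strictly, so the elements up to the entry at index
    \<open>i\<close> are the entries \<open>0..i\<close>; their number \<open>i + 1\<close> matches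
    the shift by one in \<open>nth_smallest\<close>.\<close>
  have "{a \<in> A. a \<le> l} = (!) ?xs ` {..i}"
  proof
    show "(!) ?xs ` {..i} \<subseteq> {a \<in> A. a \<le> l}"
    proof safe
      fix j assume "j \<le> i"
      then show "?xs ! j \<in> A" using i(1) set by (metis le_less_trans nth_mem)
      show "?xs ! j \<le> l"
        using i \<open>j \<le> i\<close> sorted_wrt_nth_less[OF so, of j i] by (cases "j = i") auto
    qed
    show "{a \<in> A. a \<le> l} \<subseteq> (!) ?xs ` {..i}"
    proof safe
      fix a assume a: "a \<in> A" "a \<le> l"
      then obtain j where j: "j < length ?xs" "?xs ! j = a"
        using set by (metis in_set_conv_nth)
      have "j \<le> i"
      proof (rule ccontr)
        assume "\<not> j \<le> i"
        then have "l < a" using so i j by (metis not_le sorted_wrt_nth_less)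
        then show False using a by simp
      qed
      then show "a \<in> (!) ?xs ` {..i}" using j by auto
    qed
  qed
  moreover have "inj_on ((!) ?xs) {..i}"
    using dist i(1) by (intro inj_on_nth) auto
  ultimately have "rank_in A l = i + 1"
    unfolding rank_in_def by (simp add: card_image)
  then show ?thesis using i(2) by (simp add: nth_smallest_def)
qed

lemma rank_in_strict_mono:
  assumes "finite A" shows "strict_mono_on A (rank_in A)"
proof (rule strict_mono_onI)
  fix r s assume "r \<in> A" "s \<in> A" "r < s"
  then have "{a \<in> A. a \<le> r} \<subset> {a \<in> A. a \<le> s}" by force
  then show "rank_in A r < rank_in A s"
    unfolding rank_in_def using assms by (intro psubset_card_mono) auto
qed

lemma rank_in_bij:
  assumes "finite A" shows "bij_betw (rank_in A) A {1..card A}"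
proof -
  have inj: "inj_on (rank_in A) A"
    by (rule strict_mono_on_imp_inj_on[OF rank_in_strict_mono[OF assms]])
  have "rank_in A ` A \<subseteq> {1..card A}"
  proof safe
    fix l assume "l \<in> A"
    then have "card {a \<in> A. a \<le> l} > 0" using assms by (auto simp: card_gt_0_iff)
    moreover have "card {a \<in> A. a \<le> l} \<le> card A" using assms by (intro card_mono) auto
    ultimately show "rank_in A l \<in> {1..card A}" by (simp add: rank_in_def)
  qed
  moreover have "card (rank_in A ` A) = card {1..card A}" using inj by (simp add: card_image)
  ultimately have "rank_in A ` A = {1..card A}" by (intro card_subset_eq) auto
  then show ?thesis using inj by (simp add: bij_betw_def)
qed

lemma rank_in_nth_smallest:
  assumes "finite A" "k \<in> {1..card A}"
  shows "nth_smallest A k \<in> A" "rank_in A (nth_smallest A k) = k"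
proof -
  obtain l where "l \<in> A" "rank_in A l = k"
    using rank_in_bij[OF assms(1)] assms(2) by (metis bij_betw_def imageE)
  then show "nth_smallest A k \<in> A" "rank_in A (nth_smallest A k) = k"
    using nth_smallest_rank_in[OF assms(1)] by auto
qed

lemma nth_smallest_strict_mono:
  assumes "finite A" shows "strict_mono_on {1..card A} (nth_smallest A)"
proof (rule strict_mono_onI)
  fix r s assume rs: "r \<in> {1..card A}" "s \<in> {1..card A}" "r < s"
  show "nth_smallest A r < nth_smallest A s"
  proof (rule ccontr)
    assume "\<not> nth_smallest A r < nth_smallest A s"
    then have "rank_in A (nth_smallest A s) \<le> rank_in A (nth_smallest A r)"
      using assms by (auto simp: rank_in_def intro!: card_mono)
    then show False using rs rank_in_nth_smallest(2)[OF assms] by simp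
  qed
qed

lemma nth_smallest_image:
  assumes "finite A" shows "nth_smallest A ` {1..card A} = A"
proof
  show "nth_smallest A ` {1..card A} \<subseteq> A" using rank_in_nth_smallest[OF assms] by auto
  show "A \<subseteq> nth_smallest A ` {1..card A}"
  proof
    fix l assume "l \<in> A"
    then have "l = nth_smallest A (rank_in A l)" "rank_in A l \<in> {1..card A}"
      using nth_smallest_rank_in[OF assms] bij_betwE[OF rank_in_bij[OF assms]] by auto
    then show "l \<in> nth_smallest A ` {1..card A}" by blast
  qed
qed

text \<open>Ranks depend only on relative order. Hence order-preserving relabelings are invisible to
  \<open>standardize\<close>.\<close>

lemma rank_in_image:
  assumes "strict_mono_on A f" "l \<in> A"
  shows "rank_in (f ` A) (f l) = rank_in A l"
proof -
  have "f a \<le> f l \<longleftrightarrow> a \<le> l" if "a \<in> A" for a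
    using strict_mono_onD[OF assms(1), of a l] strict_mono_onD[OF assms(1), of l a] that assms(2)
    by (cases a l rule: linorder_cases) auto
  then have "{b \<in> f ` A. b \<le> f l} = f ` {a \<in> A. a \<le> l}"
    by blast
  moreover have "inj_on f {a \<in> A. a \<le> l}"
    using strict_mono_on_imp_inj_on[OF assms(1)] by (auto intro: inj_on_subset)
  ultimately show ?thesis by (simp add: rank_in_def card_image)
qed

lemma rank_in_interval:
  assumes "l \<in> {1..n}" shows "rank_in {1..n} l = l"
proof -
  have "{a \<in> {1..n}. a \<le> l} = {1..l}" using assms by auto
  then show ?thesis by (simp add: rank_in_def)
qed

lemma nth_smallest_strict_mono_image:
  assumes "finite A" "strict_mono_on A f" "l \<in> A"
  shows "nth_smallest (f ` A) (rank_in A l) = f l"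
  using nth_smallest_rank_in[of "f ` A" "f l"] rank_in_image[OF assms(2,3)] assms(1,3) by simp

lemma Min_strict_mono_image:
  fixes f :: "nat \<Rightarrow> nat"
  assumes "finite A" "A \<noteq> {}" "strict_mono_on A f"
  shows "Min (f ` A) = f (Min A)"
proof (rule Min_eqI)
  show "finite (f ` A)" using assms by simp
  show "f (Min A) \<in> f ` A" using assms by simp
  fix y assume "y \<in> f ` A"
  then obtain a where "a \<in> A" "y = f a" by auto
  then show "f (Min A) \<le> y" using assms strict_mono_on_leD[OF assms(3), of "Min A" a] by simp
qed

section \<open>Leaves, relabeling and substitution\<close>

lemma leaves_map_ltree [simp]: "leaves (map_ltree g f t) = map f (leaves t)"
proof (induction t)
  case (Vertex u ts)
  then show ?case by (induction ts) auto
qed simp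

lemma leaves_subst_leaves: "leaves (subst_leaves f t) = concat (map (\<lambda>l. leaves (f l)) (leaves t))"
proof (induction t)
  case (Vertex u ts)
  then show ?case by (induction ts) auto
qed simp

lemma set_leaves_subst_leaves [simp]:
  "set (leaves (subst_leaves f t)) = (\<Union>l\<in>set (leaves t). set (leaves (f l)))"
  by (simp add: leaves_subst_leaves)

text \<open>Relabelings, grafts and restored subtrees all become substitutions, so that identities
  between them reduce to \<open>subst_leaves_subst\<close> and a comparison at the leaves.\<close>

lemma map_ltree_eq_subst: "map_ltree id f t = subst_leaves (\<lambda>l. Leaf (f l)) t"
  by (induction t) auto

lemma subst_leaves_subst:
  "subst_leaves g (subst_leaves f t) = subst_leaves (\<lambda>l. subst_leaves g (f l)) t"
  by (induction t) auto

lemma subst_leaves_cong: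
  "(\<And>l. l \<in> set (leaves t) \<Longrightarrow> f l = g l) \<Longrightarrow> subst_leaves f t = subst_leaves g t"
  by (induction t) auto

lemma subst_leaves_Leaf: "(\<And>l. l \<in> set (leaves t) \<Longrightarrow> f l = Leaf l) \<Longrightarrow> subst_leaves f t = t"
  by (induction t) (auto intro!: map_idI)

lemma shuffle_tree_leaves_nonempty: "shuffle_tree U t \<Longrightarrow> leaves t \<noteq> []"
proof (induction t)
  case (Vertex u ts)
  then show ?case by (cases ts) auto
qed simp

lemma min_leaf_in: "leaves t \<noteq> [] \<Longrightarrow> min_leaf t \<in> set (leaves t)"
  unfolding min_leaf_def by (intro Min_in) auto

lemma min_leaf_Leaf [simp]: "min_leaf (Leaf l) = l"
  by (simp add: min_leaf_def)

lemma min_leaf_map: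
  assumes "leaves t \<noteq> []" "strict_mono_on (set (leaves t)) f"
  shows "min_leaf (map_ltree id f t) = f (min_leaf t)"
  unfolding min_leaf_def using assms by (simp add: Min_strict_mono_image)

lemma min_leaf_Vertex:
  assumes "ts \<noteq> []" "\<And>t. t \<in> set ts \<Longrightarrow> leaves t \<noteq> []"
  shows "min_leaf (Vertex u ts) = Min (min_leaf ` set ts)"
proof -
  have "set (leaves (Vertex u ts)) = (\<Union>t\<in>set ts. set (leaves t))" by auto
  then have "min_leaf (Vertex u ts) = Min (\<Union>t\<in>set ts. set (leaves t))" by (simp add: min_leaf_def)
  also have "\<dots> = Min (min_leaf ` set ts)"
  proof (rule Min_eqI)
    show "finite (\<Union>t\<in>set ts. set (leaves t))" by simp
    have "Min (min_leaf ` set ts) \<in> min_leaf ` set ts" using assms by (intro Min_in) auto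
    then show "Min (min_leaf ` set ts) \<in> (\<Union>t\<in>set ts. set (leaves t))"
      using assms min_leaf_in by fastforce
    fix y assume "y \<in> (\<Union>t\<in>set ts. set (leaves t))"
    then obtain t where "t \<in> set ts" "y \<in> set (leaves t)" by auto
    then have "min_leaf t \<le> y" by (simp add: min_leaf_def)
    moreover have "Min (min_leaf ` set ts) \<le> min_leaf t" using \<open>t \<in> set ts\<close> by auto
    ultimately show "Min (min_leaf ` set ts) \<le> y" by simp
  qed
  finally show ?thesis .
qed

text \<open>The shuffle condition at a vertex sees each input only through its minimal leaf, and
  these minima survive when a leaf \<open>l\<close> grows into a tree with minimum
  \<open>l\<close>.\<close>

lemma shuffle_tree_subst:
  assumes "shuffle_tree U t"
    and "\<And>l. l \<in> set (leaves t) \<Longrightarrow> shuffle_tree U (f l) \<and> min_leaf (f l) = l"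
  shows "shuffle_tree U (subst_leaves f t) \<and> min_leaf (subst_leaves f t) = min_leaf t"
  using assms
proof (induction t)
  case (Vertex u ts)
  have IH: "shuffle_tree U (subst_leaves f t)" "min_leaf (subst_leaves f t) = min_leaf t"
    if "t \<in> set ts" for t
    using Vertex.IH[OF that] Vertex.prems that by auto
  have m: "map (\<lambda>x. min_leaf (subst_leaves f x)) ts = map min_leaf ts" using IH by auto
  have st: "shuffle_tree U (subst_leaves f (Vertex u ts))"
    using Vertex.prems(1) IH by (auto simp: m comp_def)
  have ne: "ts \<noteq> []" using Vertex.prems(1) by simp
  have "min_leaf (subst_leaves f (Vertex u ts)) = Min (min_leaf ` set (map (subst_leaves f) ts))"
    unfolding subst_leaves.simps
    by (rule min_leaf_Vertex) (use ne IH shuffle_tree_leaves_nonempty in auto)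
  also have "min_leaf ` set (map (subst_leaves f) ts) = min_leaf ` set ts"
    using IH by (auto simp: image_image)
  also have "Min (min_leaf ` set ts) = min_leaf (Vertex u ts)"
    by (rule min_leaf_Vertex[symmetric])
      (use ne Vertex.prems(1) shuffle_tree_leaves_nonempty in auto)
  finally show ?case using st by simp
qed auto

lemma shuffle_tree_map:
  assumes "shuffle_tree U t" "strict_mono_on (set (leaves t)) f"
  shows "shuffle_tree U (map_ltree id f t)"
  using assms
proof (induction t)
  case (Vertex u ts)
  have mono: "strict_mono_on (set (leaves t)) f" if "t \<in> set ts" for t
    using Vertex.prems(2) that by (auto simp: strict_mono_on_def)
  have ne: "leaves t \<noteq> []" if "t \<in> set ts" for t
    using Vertex.prems(1) that shuffle_tree_leaves_nonempty by auto
  have m: "map min_leaf (map (map_ltree id f) ts) = map f (map min_leaf ts)"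
    using min_leaf_map[OF ne mono] by auto
  have in_leaves: "min_leaf t \<in> set (leaves (Vertex u ts))" if "t \<in> set ts" for t
    using min_leaf_in[OF ne[OF that]] that by auto
  have "sorted_wrt (\<lambda>x y. f x < f y) (map min_leaf ts)"
  proof (rule sorted_wrt_mono_rel)
    show "sorted_wrt (<) (map min_leaf ts)" using Vertex.prems(1) by simp
    fix x y assume xy: "x \<in> set (map min_leaf ts)" "y \<in> set (map min_leaf ts)" "x < y"
    show "f x < f y"
      by (rule strict_mono_onD[OF Vertex.prems(2)]) (use xy in_leaves in auto)
  qed
  then have "sorted_wrt (<) (map f (map min_leaf ts))"
    by (simp only: sorted_wrt_map)
  then have "sorted_wrt (<) (map min_leaf (map (map_ltree id f) ts))"
    by (simp only: m)
  then show ?case using Vertex mono by (auto simp: id_def comp_def)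
qed simp

text \<open>The canonical representative of a tree up to order-preserving relabeling; it carries
  subtrees, whose labels are inherited from a larger tree, into the free operad.\<close>

definition standardize :: "('u, nat) ltree \<Rightarrow> ('u, nat) ltree" where
  "standardize t = map_ltree id (rank_in (set (leaves t))) t"

lemma standardize_map:
  assumes "strict_mono_on (set (leaves t)) f"
  shows "standardize (map_ltree id f t) = standardize t"
  unfolding standardize_def leaves_map_ltree set_map map_ltree_eq_subst subst_leaves_subst
  using rank_in_image[OF assms]
  by (intro subst_leaves_cong) (simp add: UNION_singleton_eq_range)

lemma standardize_shuffle_monomial:
  assumes "shuffle_tree U t" "distinct (leaves t)"
  shows "standardize t \<in> shuffle_monomials U (length (leaves t))"
proof -
  have f: "finite (set (leaves t))" by simp
  have inj: "inj_on (rank_in (set (leaves t))) (set (leaves t))"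
    using rank_in_bij[OF f] by (simp add: bij_betw_def)
  have "rank_in (set (leaves t)) ` set (leaves t) = {1..length (leaves t)}"
    using rank_in_bij[OF f] assms(2) by (simp add: bij_betw_def distinct_card)
  then show ?thesis
    unfolding shuffle_monomials_def standardize_def
    using assms shuffle_tree_map[OF assms(1) rank_in_strict_mono[OF f]] inj
    by (auto simp: distinct_map)
qed

lemma standardize_id:
  assumes "t \<in> shuffle_monomials U n" shows "standardize t = t"
  using assms unfolding standardize_def shuffle_monomials_def map_ltree_eq_subst
  by (intro subst_leaves_Leaf) (simp add: rank_in_interval del: One_nat_def)

lemma length_leaves_shuffle_monomial:
  assumes "t \<in> shuffle_monomials U n" shows "length (leaves t) = n"
  using assms by (auto simp: shuffle_monomials_def dest: distinct_card)

section \<open>Grafting of trees\<close>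

text \<open>Grafting without the renumbering built into \<open>shuffle_graft\<close>: both trees
  already carry their final labels.\<close>

definition graft_at :: "'l \<Rightarrow> ('u, 'l) ltree \<Rightarrow> ('u, 'l) ltree \<Rightarrow> ('u, 'l) ltree" where
  "graft_at l0 r = subst_leaves (\<lambda>l. if l = l0 then r else Leaf l)"

lemma graft_at_simps [simp]:
  "graft_at l0 r (Leaf l) = (if l = l0 then r else Leaf l)"
  "graft_at l0 r (Vertex u ts) = Vertex u (map (graft_at l0 r) ts)"
  by (simp_all add: graft_at_def)

lemma graft_at_trivial: "l0 \<notin> set (leaves p) \<Longrightarrow> graft_at l0 r p = p"
  unfolding graft_at_def by (rule subst_leaves_Leaf) auto

lemma set_leaves_graft_at:
  "l0 \<in> set (leaves p) \<Longrightarrow> set (leaves (graft_at l0 r p)) = set (leaves p) - {l0} \<union> set (leaves r)"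
  unfolding graft_at_def by (auto split: if_splits)

text \<open>At most one entry equals \<open>x\<close>, so \<open>ys\<close> is inserted at most
  once, and the remaining entries do not occur in it.\<close>

lemma distinct_concat_replace:
  assumes "distinct xs" "distinct ys" "set xs \<inter> set ys \<subseteq> {x}"
  shows "distinct (concat (map (\<lambda>l. if l = x then ys else [l]) xs))"
  using assms
proof (induction xs)
  case (Cons a xs)
  then have IH: "distinct (concat (map (\<lambda>l. if l = x then ys else [l]) xs))" by auto
  show ?case
  proof (cases "a = x")
    case True
    then have "map (\<lambda>l. if l = x then ys else [l]) xs = map (\<lambda>l. [l]) xs"
      using Cons.prems by auto
    moreover have "concat (map (\<lambda>l. [l]) xs) = xs" by (induction xs) auto
    ultimately have "concat (map (\<lambda>l. if l = x then ys else [l]) xs) = xs" by (simp only:)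
    then show ?thesis using Cons.prems True by auto
  next
    case False
    then show ?thesis using IH Cons.prems by (auto split: if_splits)
  qed
qed simp

lemma distinct_graft_at:
  assumes "distinct (leaves p)" "distinct (leaves r)" "set (leaves p) \<inter> set (leaves r) \<subseteq> {l0}"
  shows "distinct (leaves (graft_at l0 r p))"
proof -
  have "(\<lambda>l. leaves (if l = l0 then r else Leaf l)) = (\<lambda>l. if l = l0 then leaves r else [l])"
    by auto
  then show ?thesis
    unfolding graft_at_def leaves_subst_leaves using distinct_concat_replace[OF assms] by simp
qed

lemma shuffle_tree_graft_at:
  assumes "shuffle_tree U p" "shuffle_tree U r" "min_leaf r = l0"
  shows "shuffle_tree U (graft_at l0 r p)" "min_leaf (graft_at l0 r p) = min_leaf p"
  unfolding graft_at_def using shuffle_tree_subst[OF assms(1)] assms(2,3) by simp_all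

lemma size_graft_at: "l0 \<in> set (leaves p) \<Longrightarrow> size r \<le> size (graft_at l0 r p)"
proof (induction p)
  case (Vertex u ts)
  then obtain t where t: "t \<in> set ts" "l0 \<in> set (leaves t)" by auto
  then have "size r \<le> size (graft_at l0 r t)" using Vertex.IH by simp
  also have "\<dots> \<le> size_list size (map (graft_at l0 r) ts)"
    using t by (intro size_list_estimation'[OF _ order_refl]) auto
  finally show ?case by simp
qed simp

text \<open>By size: a graft strictly above the root vertex gives a tree larger than
  \<open>r\<close>. If nothing is grafted, \<open>r\<close> would be the tree itself, whose nonempty
  leaf set would lie in \<open>{l0}\<close> without containing \<open>l0\<close>.\<close>

lemma graft_at_Vertex_neq:
  assumes "shuffle_tree U (Vertex u ts)" "set (leaves (Vertex u ts)) \<inter> set (leaves r) \<subseteq> {l0}"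
  shows "graft_at l0 r (Vertex u ts) \<noteq> r"
proof
  assume eq: "graft_at l0 r (Vertex u ts) = r"
  show False
  proof (cases "l0 \<in> set (leaves (Vertex u ts))")
    case True
    then obtain t where t: "t \<in> set ts" "l0 \<in> set (leaves t)" by auto
    have "size r \<le> size (graft_at l0 r t)" by (rule size_graft_at[OF t(2)])
    also have "\<dots> \<le> size_list size (map (graft_at l0 r) ts)"
      using t by (intro size_list_estimation'[OF _ order_refl]) auto
    also have "\<dots> < size (graft_at l0 r (Vertex u ts))" by simp
    finally have "size r < size (graft_at l0 r (Vertex u ts))" .
    then show False unfolding eq by simp
  next
    case False
    then have "r = Vertex u ts" using graft_at_trivial eq by metis
    then show False using assms(2) False shuffle_tree_leaves_nonempty[OF assms(1)]
      by (metis Int_absorb last_in_set singletonD subsetD)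
  qed
qed

text \<open>Both trees are descended in parallel. A leaf against a vertex is excluded by
  \<open>graft_at_Vertex_neq\<close>; of two leaves, both or neither equal \<open>l0\<close>,
  because \<open>l0\<close> occurs in \<open>r\<close>.\<close>

lemma graft_at_inj_left:
  assumes "graft_at l0 r p = graft_at l0 r p'"
    and "shuffle_tree U p" "shuffle_tree U p'"
    and "set (leaves p) \<inter> set (leaves r) \<subseteq> {l0}" "set (leaves p') \<inter> set (leaves r) \<subseteq> {l0}"
    and "l0 \<in> set (leaves r)"
  shows "p = p'"
  using assms
proof (induction p arbitrary: p')
  case (Leaf l)
  show ?case
  proof (cases p')
    case (Leaf l')
    then show ?thesis using Leaf.prems by (auto split: if_splits)
  next
    case (Vertex u ts)
    then have "graft_at l0 r (Vertex u ts) \<noteq> r"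
      using Leaf.prems by (intro graft_at_Vertex_neq) auto
    then show ?thesis using Leaf.prems(1) Vertex by (auto split: if_splits)
  qed
next
  case (Vertex u ts)
  show ?case
  proof (cases p')
    case (Leaf l')
    have "graft_at l0 r (Vertex u ts) \<noteq> r"
      using Vertex.prems by (intro graft_at_Vertex_neq) auto
    then show ?thesis using Vertex.prems(1) Leaf by (auto split: if_splits)
  next
    case (Vertex u' ts')
    have eq: "map (graft_at l0 r) ts = map (graft_at l0 r) ts'" and u: "u = u'"
      using Vertex.prems(1) Vertex by auto
    have len: "length ts = length ts'" using eq by (rule map_eq_imp_length_eq)
    have "ts ! i = ts' ! i" if i: "i < length ts" for i
    proof (rule Vertex.IH)
      have i': "ts' ! i \<in> set ts'" using i len by simp
      show "ts ! i \<in> set ts" using i by simp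
      show "graft_at l0 r (ts ! i) = graft_at l0 r (ts' ! i)"
        using eq i len by (metis nth_map)
      show "shuffle_tree U (ts ! i)" using Vertex.prems(2) i by simp
      show "shuffle_tree U (ts' ! i)" using Vertex.prems(3) Vertex i' by simp
      show "set (leaves (ts ! i)) \<inter> set (leaves r) \<subseteq> {l0}"
        using Vertex.prems(4) nth_mem[OF i] by auto
      show "set (leaves (ts' ! i)) \<inter> set (leaves r) \<subseteq> {l0}"
        using Vertex.prems(5) i' Vertex by auto
    qed (rule Vertex.prems)
    then show ?thesis using u len Vertex by (simp add: list_eq_iff_nth_eq)
  qed
qed

lemma graft_at_inj_right:
  "l0 \<in> set (leaves p) \<Longrightarrow> graft_at l0 r p = graft_at l0 r' p \<Longrightarrow> r = r'"
  by (induction p) auto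

section \<open>Shuffle composition of monomials as grafting\<close>

lemma shuffle_sets_nonempty:
  assumes "J \<in> shuffle_sets m n" "n \<ge> 1"
  shows "finite J" "Min J \<in> J" "card J = n" "J \<subseteq> {1..m + n - 1}"
proof -
  show J: "card J = n" "J \<subseteq> {1..m + n - 1}" using assms by (auto simp: shuffle_sets_def)
  then have "J \<noteq> {}" using assms(2) by auto
  moreover show "finite J" using J(2) finite_subset by blast
  ultimately show "Min J \<in> J" by simp
qed

text \<open>\<open>Min J\<close> belongs to both label sets: in the lower tree it marks the leaf
  that receives the other tree.\<close>

definition outer_labels :: "nat \<Rightarrow> nat \<Rightarrow> nat set \<Rightarrow> nat set" where
  "outer_labels m n J = insert (Min J) ({1..m + n - 1} - J)"

lemma card_outer_labels:
  assumes "J \<in> shuffle_sets m n" "m \<ge> 1" "n \<ge> 1"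
  shows "finite (outer_labels m n J)" "card (outer_labels m n J) = m"
    "outer_labels m n J \<inter> J = {Min J}" "outer_labels m n J \<union> J = {1..m + n - 1}"
proof -
  note J = shuffle_sets_nonempty[OF assms(1,3)]
  show "finite (outer_labels m n J)" by (simp add: outer_labels_def)
  have "card ({1..m + n - 1} - J) = m - 1" using J assms by (simp add: card_Diff_subset)
  then show "card (outer_labels m n J) = m"
    unfolding outer_labels_def using J assms by (simp add: card_insert_if)
  show "outer_labels m n J \<inter> J = {Min J}" "outer_labels m n J \<union> J = {1..m + n - 1}"
    unfolding outer_labels_def using J by auto
qed

lemma map_nth_smallest_monomial:
  assumes "t \<in> shuffle_monomials U n" "finite A" "card A = n"
  shows "shuffle_tree U (map_ltree id (nth_smallest A) t)"
    "set (leaves (map_ltree id (nth_smallest A) t)) = A"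
    "distinct (leaves (map_ltree id (nth_smallest A) t))"
    "standardize (map_ltree id (nth_smallest A) t) = t"
proof -
  have t: "shuffle_tree U t" "distinct (leaves t)" "set (leaves t) = {1..n}"
    using assms by (auto simp: shuffle_monomials_def)
  have m: "strict_mono_on (set (leaves t)) (nth_smallest A)"
    using nth_smallest_strict_mono[OF assms(2)] t(3) assms(3) by simp
  show "shuffle_tree U (map_ltree id (nth_smallest A) t)" by (rule shuffle_tree_map[OF t(1) m])
  show "set (leaves (map_ltree id (nth_smallest A) t)) = A"
    using nth_smallest_image[OF assms(2)] t(3) assms(3) by simp
  show "distinct (leaves (map_ltree id (nth_smallest A) t))"
    using t(2) strict_mono_on_imp_inj_on[OF m] by (simp add: distinct_map)
  show "standardize (map_ltree id (nth_smallest A) t) = t"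
    using standardize_map[OF m] standardize_id[OF assms(1)] by simp
qed

lemma shuffle_graft_eq:
  assumes "s \<in> shuffle_monomials U m" "t \<in> shuffle_monomials U n"
  shows "shuffle_graft J s t =
    graft_at (Min J) (map_ltree id (nth_smallest J) t)
      (map_ltree id (nth_smallest (outer_labels m n J)) s)"
  unfolding shuffle_graft_def graft_at_def outer_labels_def Let_def
  using length_leaves_shuffle_monomial[OF assms(1)] length_leaves_shuffle_monomial[OF assms(2)]
  by simp

context
  fixes U :: "nat \<Rightarrow> 'u set" and m n :: nat and J :: "nat set"
  assumes J: "J \<in> shuffle_sets m n" and mn: "m \<ge> 1" "n \<ge> 1"
begin

lemma shuffle_graft_monomial:
  assumes "s \<in> shuffle_monomials U m" "t \<in> shuffle_monomials U n"
  shows "shuffle_graft J s t \<in> shuffle_monomials U (m + n - 1)"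
proof -
  note J' = shuffle_sets_nonempty[OF J mn(2)] and A = card_outer_labels[OF J mn]
  note s = map_nth_smallest_monomial[OF assms(1) A(1,2)]
    and t = map_nth_smallest_monomial[OF assms(2) J'(1,3)]
  have min: "min_leaf (map_ltree id (nth_smallest J) t) = Min J" by (simp only: min_leaf_def t(2))
  let ?g = "graft_at (Min J) (map_ltree id (nth_smallest J) t)
      (map_ltree id (nth_smallest (outer_labels m n J)) s)"
  have "Min J \<in> outer_labels m n J" by (simp add: outer_labels_def)
  then have "set (leaves ?g) = outer_labels m n J - {Min J} \<union> J"
    by (simp only: set_leaves_graft_at s(2) t(2))
  also have "\<dots> = {1..m + n - 1}" using A(4) J'(2) by auto
  finally have "set (leaves ?g) = {1..m + n - 1}" .
  moreover have "distinct (leaves ?g)"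
    by (rule distinct_graft_at[OF s(3) t(3)]) (simp only: s(2) t(2) A(3) order_refl)
  ultimately show ?thesis
    unfolding shuffle_graft_eq[OF assms] shuffle_monomials_def
    using shuffle_tree_graft_at(1)[OF s(1) t(1) min] by blast
qed

text \<open>Together with its counterpart for the other argument, this rules out cancellation when
  an element of the free operad is composed with a monomial.\<close>

lemma shuffle_graft_inj_left:
  assumes "s \<in> shuffle_monomials U m" "s' \<in> shuffle_monomials U m" "t \<in> shuffle_monomials U n"
    and "shuffle_graft J s t = shuffle_graft J s' t"
  shows "s = s'"
proof -
  note J' = shuffle_sets_nonempty[OF J mn(2)] and A = card_outer_labels[OF J mn]
  note s = map_nth_smallest_monomial[OF assms(1) A(1,2)]
    and s' = map_nth_smallest_monomial[OF assms(2) A(1,2)]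
    and t = map_nth_smallest_monomial[OF assms(3) J'(1,3)]
  have "map_ltree id (nth_smallest (outer_labels m n J)) s =
      map_ltree id (nth_smallest (outer_labels m n J)) s'"
  proof (rule graft_at_inj_left)
    show "graft_at (Min J) (map_ltree id (nth_smallest J) t)
        (map_ltree id (nth_smallest (outer_labels m n J)) s) =
      graft_at (Min J) (map_ltree id (nth_smallest J) t)
        (map_ltree id (nth_smallest (outer_labels m n J)) s')"
      using assms(4) shuffle_graft_eq[OF assms(1,3)] shuffle_graft_eq[OF assms(2,3)] by simp
  qed (use s(1) s'(1) in \<open>simp_all only: s(2) s'(2) t(2) A(3) J'(2) order_refl\<close>)
  then show ?thesis using s(4) s'(4) by metis
qed

lemma shuffle_graft_inj_right:
  assumes "s \<in> shuffle_monomials U m" "t \<in> shuffle_monomials U n" "t' \<in> shuffle_monomials U n"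
    and "shuffle_graft J s t = shuffle_graft J s t'"
  shows "t = t'"
proof -
  note J' = shuffle_sets_nonempty[OF J mn(2)] and A = card_outer_labels[OF J mn]
  note s = map_nth_smallest_monomial[OF assms(1) A(1,2)]
    and t = map_nth_smallest_monomial[OF assms(2) J'(1,3)]
    and t' = map_nth_smallest_monomial[OF assms(3) J'(1,3)]
  have "map_ltree id (nth_smallest J) t = map_ltree id (nth_smallest J) t'"
  proof (rule graft_at_inj_right)
    show "graft_at (Min J) (map_ltree id (nth_smallest J) t)
        (map_ltree id (nth_smallest (outer_labels m n J)) s) =
      graft_at (Min J) (map_ltree id (nth_smallest J) t')
        (map_ltree id (nth_smallest (outer_labels m n J)) s)"
      using assms(4) shuffle_graft_eq[OF assms(1,2)] shuffle_graft_eq[OF assms(1,3)] by simp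
  qed (simp only: s(2), simp add: outer_labels_def)
  then show ?thesis using t(4) t'(4) by metis
qed

end

text \<open>Ranking all labels of the composite at once is order-preserving on both pieces. The
  ranks of the upper piece form \<open>J\<close>; since the pieces share only \<open>l0\<close>, the
  minimum of the upper one, the lower piece receives exactly the labels that a shuffle composition
  prescribes.\<close>

lemma standardize_graft_at:
  assumes "shuffle_tree U p" "shuffle_tree U r" "distinct (leaves p)" "distinct (leaves r)"
    and "min_leaf r = l0" "set (leaves p) \<inter> set (leaves r) = {l0}"
  obtains J where "J \<in> shuffle_sets (length (leaves p)) (length (leaves r))"
    and "standardize (graft_at l0 r p) = shuffle_graft J (standardize p) (standardize r)"
proof -
  define X where "X = set (leaves p) \<union> set (leaves r)"
  define f where "f = rank_in X"
  define J where "J = f ` set (leaves r)"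
  have l0: "l0 \<in> set (leaves p)" "l0 \<in> set (leaves r)" using assms(6) by auto
  have X: "set (leaves (graft_at l0 r p)) = X"
    unfolding X_def using set_leaves_graft_at[OF l0(1)] l0 by auto
  have fin: "finite X" by (simp add: X_def)
  have f: "bij_betw f X {1..card X}" unfolding f_def by (rule rank_in_bij[OF fin])
  have fm: "strict_mono_on X f" unfolding f_def by (rule rank_in_strict_mono[OF fin])
  have mr: "strict_mono_on (set (leaves r)) f" and mp: "strict_mono_on (set (leaves p)) f"
    using fm by (auto simp: X_def strict_mono_on_def)
  have cr: "card (set (leaves r)) = length (leaves r)"
    and cp: "card (set (leaves p)) = length (leaves p)"
    using assms by (auto simp: distinct_card)
  have cX: "card X = length (leaves p) + length (leaves r) - 1"
    using card_Un_Int[of "set (leaves p)" "set (leaves r)"] cr cp assms(6) by (simp add: X_def)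
  have Jne: "set (leaves r) \<noteq> {}" using l0 by auto
  have MinJ: "Min J = f l0"
    unfolding J_def using Min_strict_mono_image[OF _ Jne mr] assms(5) by (simp add: min_leaf_def)
  have J: "J \<in> shuffle_sets (length (leaves p)) (length (leaves r))"
    unfolding shuffle_sets_def J_def
    using f cX cr strict_mono_on_imp_inj_on[OF mr] by (auto simp: card_image bij_betw_def X_def)
  have A: "outer_labels (length (leaves p)) (length (leaves r)) J = f ` set (leaves p)"
  proof -
    have "{1..card X} - J = f ` (X - set (leaves r))"
      using f unfolding J_def bij_betw_def
      by (subst inj_on_image_set_diff[where C = X]) (auto simp: X_def)
    moreover have "insert l0 (X - set (leaves r)) = set (leaves p)"
      using assms(6) by (auto simp: X_def)
    ultimately show ?thesis unfolding outer_labels_def cX[symmetric] MinJ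
      by (metis image_insert)
  qed
  \<comment> \<open>On each piece, the ranking inside the whole tree equals its own standardization
    followed by the relabeling that the shuffle composition performs.\<close>
  have r: "nth_smallest J (rank_in (set (leaves r)) l) = f l" if "l \<in> set (leaves r)" for l
    unfolding J_def using nth_smallest_strict_mono_image[OF _ mr that] by simp
  have p: "nth_smallest (f ` set (leaves p)) (rank_in (set (leaves p)) l) = f l"
    if "l \<in> set (leaves p)" for l
    using nth_smallest_strict_mono_image[OF _ mp that] by simp
  have r': "map_ltree id (nth_smallest J) (standardize r) = map_ltree id f r"
    unfolding standardize_def map_ltree_eq_subst subst_leaves_subst
    using r by (intro subst_leaves_cong) simp
  have p': "map_ltree id (nth_smallest (f ` set (leaves p))) (standardize p) = map_ltree id f p"
    unfolding standardize_def map_ltree_eq_subst subst_leaves_subst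
    using p by (intro subst_leaves_cong) simp
  have "shuffle_graft J (standardize p) (standardize r) =
      graft_at (f l0) (map_ltree id f r) (map_ltree id f p)"
    using shuffle_graft_eq[OF standardize_shuffle_monomial[OF assms(1,3)]
        standardize_shuffle_monomial[OF assms(2,4)], of J]
    by (simp only: A MinJ p' r')
  also have "\<dots> = map_ltree id f (graft_at l0 r p)"
    unfolding graft_at_def map_ltree_eq_subst subst_leaves_subst
  proof (rule subst_leaves_cong)
    fix l assume "l \<in> set (leaves p)"
    \<comment> \<open>The relabeling is injective on the lower piece, so the place of the graft is
      still recognized by its label.\<close>
    then have "f l = f l0 \<longleftrightarrow> l = l0"
      using l0(1) strict_mono_on_imp_inj_on[OF mp] by (auto dest: inj_onD)
    then show "subst_leaves (\<lambda>l. if l = f l0 then subst_leaves (\<lambda>l. Leaf (f l)) r else Leaf l)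
        (Leaf (f l)) = subst_leaves (\<lambda>l. Leaf (f l)) (if l = l0 then r else Leaf l)"
      by simp
  qed
  also have "\<dots> = standardize (graft_at l0 r p)"
    unfolding standardize_def X f_def ..
  finally show ?thesis using that J by simp
qed

section \<open>Divisibility and leading monomials of an ideal\<close>

lemma list_all2_prune_list:
  "list_all2 (\<lambda>t u. set (leaves u) \<subseteq> set (leaves t) \<and> (distinct (leaves t) \<longrightarrow> distinct (leaves u))) ts us
    \<Longrightarrow> set (concat (map leaves us)) \<subseteq> set (concat (map leaves ts)) \<and>
      (distinct (concat (map leaves ts)) \<longrightarrow> distinct (concat (map leaves us)))"
  by (induction rule: list_all2_induct) auto

text \<open>A cut subtree is replaced by its own minimal leaf, so the minima seen from every
  remaining vertex are unchanged.\<close>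

lemma pruning_shuffle_tree:
  assumes "pruning t u" "shuffle_tree U t"
  shows "shuffle_tree U u \<and> min_leaf u = min_leaf t \<and> set (leaves u) \<subseteq> set (leaves t) \<and>
    (distinct (leaves t) \<longrightarrow> distinct (leaves u))"
  using assms
proof (induction rule: pruning.induct)
  case (1 t)
  then show ?case using min_leaf_in[OF shuffle_tree_leaves_nonempty] by auto
next
  case (2 ts us u)
  have t: "ts \<noteq> []" "\<And>t. t \<in> set ts \<Longrightarrow> shuffle_tree U t" "sorted_wrt (<) (map min_leaf ts)"
    "u \<in> U (length ts)"
    using 2(2) by auto
  have la: "list_all2 (\<lambda>t u. shuffle_tree U u \<and> min_leaf u = min_leaf t \<and>
      set (leaves u) \<subseteq> set (leaves t) \<and> (distinct (leaves t) \<longrightarrow> distinct (leaves u))) ts us"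
    using 2(1) t(2) by (auto elim!: list_all2_mono[rotated] simp: list_all2_conv_all_nth)
  have len: "length us = length ts" using list_all2_lengthD[OF la] by simp
  have m: "map min_leaf us = map min_leaf ts"
    using la by (auto simp: list_all2_conv_all_nth intro!: nth_equalityI)
  have us: "\<And>x. x \<in> set us \<Longrightarrow> shuffle_tree U x"
    using la by (auto simp: list_all2_conv_all_nth in_set_conv_nth)
  have ne: "us \<noteq> []" using t(1) len by auto
  have st: "shuffle_tree U (Vertex u us)" using ne us m t len by simp
  have "min_leaf (Vertex u us) = Min (min_leaf ` set us)"
    using ne us shuffle_tree_leaves_nonempty by (intro min_leaf_Vertex) auto
  also have "\<dots> = Min (min_leaf ` set ts)" using m by (metis list.set_map)
  also have "\<dots> = min_leaf (Vertex u ts)"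
    using t(1,2) shuffle_tree_leaves_nonempty by (intro min_leaf_Vertex[symmetric]) auto
  finally have "min_leaf (Vertex u us) = min_leaf (Vertex u ts)" .
  moreover have "list_all2 (\<lambda>t u. set (leaves u) \<subseteq> set (leaves t) \<and>
      (distinct (leaves t) \<longrightarrow> distinct (leaves u))) ts us"
    by (rule list_all2_mono[OF la]) auto
  note list_all2_prune_list[OF this]
  ultimately show ?case using st by simp
qed

lemma distinct_leaves_Vertex_nth:
  assumes "distinct (leaves (Vertex u ts))" "i < length ts" "j < length ts" "i \<noteq> j"
  shows "set (leaves (ts ! i)) \<inter> set (leaves (ts ! j)) = {}"
proof -
  have *: "set (leaves (ts ! i)) \<inter> set (leaves (ts ! j)) = {}"
    if "distinct (concat (map leaves ts))" "i < j" "j < length ts" for i j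
    using that
  proof (induction ts arbitrary: i j)
    case (Cons t ts)
    then obtain j' where j: "j = Suc j'" "j' < length ts" by (cases j) auto
    show ?case
    proof (cases i)
      case 0
      have "set (leaves (ts ! j')) \<subseteq> (\<Union>a\<in>set ts. set (leaves a))"
        using nth_mem[OF j(2)] by blast
      moreover have "set (leaves t) \<inter> (\<Union>a\<in>set ts. set (leaves a)) = {}"
        using Cons.prems(1) by simp
      ultimately show ?thesis using 0 j by auto
    next
      case (Suc i')
      then show ?thesis using Cons.IH[of i' j'] Cons.prems j by simp
    qed
  qed simp
  show ?thesis using *[of i j] *[of j i] assms by (cases i j rule: linorder_cases) auto
qed

text \<open>The cut subtrees are substituted back. Distinct leaves ensure that a label identifies
  its cut, so that one function of the labels serves all children at once.\<close>

lemma pruning_subst_leaves: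
  assumes "pruning t u" "shuffle_tree U t" "distinct (leaves t)"
  shows "\<exists>f. t = subst_leaves f u \<and>
    (\<forall>l\<in>set (leaves u). shuffle_tree U (f l) \<and> min_leaf (f l) = l)"
  using assms
proof (induction rule: pruning.induct)
  case (1 t)
  then show ?case by (intro exI[of _ "\<lambda>_. t"]) simp
next
  case (2 ts us u)
  have len: "length us = length ts" using list_all2_lengthD[OF 2(1)] by simp
  have "\<exists>f. ts ! i = subst_leaves f (us ! i) \<and>
      (\<forall>l\<in>set (leaves (us ! i)). shuffle_tree U (f l) \<and> min_leaf (f l) = l)"
    and sub: "set (leaves (us ! i)) \<subseteq> set (leaves (ts ! i))" if i: "i < length ts" for i
  proof -
    have st: "shuffle_tree U (ts ! i)" using 2(2) i by simp
    have "distinct (leaves (ts ! i))" using 2(3) i by (auto simp: distinct_concat_iff)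
    then show "\<exists>f. ts ! i = subst_leaves f (us ! i) \<and>
      (\<forall>l\<in>set (leaves (us ! i)). shuffle_tree U (f l) \<and> min_leaf (f l) = l)"
      using 2(1) i st by (auto simp: list_all2_conv_all_nth)
    show "set (leaves (us ! i)) \<subseteq> set (leaves (ts ! i))"
      using pruning_shuffle_tree[OF _ st] 2(1) i by (auto simp: list_all2_conv_all_nth)
  qed
  then have "\<exists>F. \<forall>i<length ts. ts ! i = subst_leaves (F i) (us ! i) \<and>
      (\<forall>l\<in>set (leaves (us ! i)). shuffle_tree U (F i l) \<and> min_leaf (F i l) = l)"
    by metis
  then obtain F where F: "\<And>i. i < length ts \<Longrightarrow> ts ! i = subst_leaves (F i) (us ! i)"
      "\<And>i l. i < length ts \<Longrightarrow> l \<in> set (leaves (us ! i)) \<Longrightarrow>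
        shuffle_tree U (F i l) \<and> min_leaf (F i l) = l"
    by blast
  \<comment> \<open>The index is unique: a pruned child keeps only leaves of its own child, and
    different children have disjoint leaves.\<close>
  define f where "f l = F (SOME i. i < length ts \<and> l \<in> set (leaves (us ! i))) l" for l
  have f: "f l = F i l" if "i < length ts" "l \<in> set (leaves (us ! i))" for l i
  proof -
    have "(SOME i. i < length ts \<and> l \<in> set (leaves (us ! i))) = i"
    proof (rule some_equality)
      show "i < length ts \<and> l \<in> set (leaves (us ! i))" using that by simp
      fix j assume j: "j < length ts \<and> l \<in> set (leaves (us ! j))"
      show "j = i"
        using distinct_leaves_Vertex_nth[OF 2(3), of i j] sub[of i] sub[of j] that j by auto
    qed
    then show ?thesis by (simp add: f_def)
  qed
  have "ts = map (subst_leaves f) us"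
  proof (rule nth_equalityI)
    show "length ts = length (map (subst_leaves f) us)" using len by simp
    fix i assume i: "i < length ts"
    have "subst_leaves (F i) (us ! i) = subst_leaves f (us ! i)"
      using f[OF i] by (intro subst_leaves_cong) simp
    then show "ts ! i = map (subst_leaves f) us ! i" using F(1)[OF i] i len by simp
  qed
  moreover have "shuffle_tree U (f l) \<and> min_leaf (f l) = l" if l: "l \<in> set (leaves (Vertex u us))" for l
  proof -
    obtain x where "x \<in> set us" "l \<in> set (leaves x)" using l by auto
    then obtain i where i: "i < length ts" "l \<in> set (leaves (us ! i))"
      using len by (metis in_set_conv_nth)
    then show ?thesis using F(2)[OF i] f[OF i] by simp
  qed
  ultimately show ?case by (intro exI[of _ f]) simp
qed

lemma distinct_concat_map_disjoint:
  assumes "distinct (concat (map g xs))" "\<forall>x\<in>set xs. g x \<noteq> []"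
  shows "distinct xs" "\<And>x y. x \<in> set xs \<Longrightarrow> y \<in> set xs \<Longrightarrow> x \<noteq> y \<Longrightarrow> set (g x) \<inter> set (g y) = {}"
    "\<And>x. x \<in> set xs \<Longrightarrow> distinct (g x)"
proof -
  have "distinct xs \<and> (\<forall>x\<in>set xs. \<forall>y\<in>set xs. x \<noteq> y \<longrightarrow> set (g x) \<inter> set (g y) = {}) \<and>
      (\<forall>x\<in>set xs. distinct (g x))"
    using assms
  proof (induction xs)
    case (Cons a xs)
    have dj: "\<forall>x\<in>set xs. set (g a) \<inter> set (g x) = {}" using Cons.prems(1) by auto
    have "distinct (g a)" using Cons.prems(1) by simp
    moreover have "a \<notin> set xs" using dj Cons.prems(2) by auto
    moreover have "distinct xs \<and> (\<forall>x\<in>set xs. \<forall>y\<in>set xs. x \<noteq> y \<longrightarrow> set (g x) \<inter> set (g y) = {}) \<and>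
      (\<forall>x\<in>set xs. distinct (g x))"
      using Cons by simp
    ultimately show ?case using dj by (simp add: Int_commute)
  qed simp
  then show "distinct xs" "\<And>x y. x \<in> set xs \<Longrightarrow> y \<in> set xs \<Longrightarrow> x \<noteq> y \<Longrightarrow> set (g x) \<inter> set (g y) = {}"
    "\<And>x. x \<in> set xs \<Longrightarrow> distinct (g x)"
    by auto
qed

lemma distinct_concat_mapI:
  assumes "distinct xs" "\<And>x. x \<in> set xs \<Longrightarrow> distinct (g x)"
    "\<And>x y. x \<in> set xs \<Longrightarrow> y \<in> set xs \<Longrightarrow> x \<noteq> y \<Longrightarrow> set (g x) \<inter> set (g y) = {}"
  shows "distinct (concat (map g xs))"
  using assms
proof (induction xs)
  case (Cons a xs)
  then have "\<And>x. x \<in> set xs \<Longrightarrow> set (g a) \<inter> set (g x) = {}" by (metis distinct.simps(2) list.set_intros)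
  then show ?case using Cons by auto
qed simp

lemma upper_subtree_shuffle_tree:
  assumes "upper_subtree v s" "shuffle_tree U v" "distinct (leaves v)"
  shows "shuffle_tree U s \<and> distinct (leaves s)"
  using assms by (induction rule: upper_subtree.induct) (auto simp: distinct_concat_iff)

section \<open>Terms of composites with a monomial\<close>

lemma keys_sum_single:
  assumes "finite A" "inj_on g A" "\<And>s. s \<in> A \<Longrightarrow> c s \<noteq> 0"
  shows "Poly_Mapping.keys (\<Sum>s\<in>A. Poly_Mapping.single (g s) (c s)) = g ` A"
proof
  show "Poly_Mapping.keys (\<Sum>s\<in>A. Poly_Mapping.single (g s) (c s)) \<subseteq> g ` A"
    by (rule subset_trans[OF Poly_Mapping.keys_sum]) (auto split: if_splits)
  show "g ` A \<subseteq> Poly_Mapping.keys (\<Sum>s\<in>A. Poly_Mapping.single (g s) (c s))"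
  proof safe
    fix s assume s: "s \<in> A"
    have "Poly_Mapping.lookup (\<Sum>s\<in>A. Poly_Mapping.single (g s) (c s)) (g s) =
        (\<Sum>t\<in>A. if t = s then c t else 0)"
      unfolding lookup_sum lookup_single
      using s assms(2) by (intro sum.cong) (auto simp: when_def dest: inj_onD)
    also have "\<dots> = c s" using s assms(1) by simp
    finally show "g s \<in> Poly_Mapping.keys (\<Sum>s\<in>A. Poly_Mapping.single (g s) (c s))"
      using assms(3)[OF s] by (simp add: in_keys_iff)
  qed
qed

lemma free_comp_closed:
  assumes "J \<in> shuffle_sets m n" "m \<ge> 1" "n \<ge> 1"
    and "f \<in> free_component U m" "g \<in> free_component U n"
  shows "free_comp J f g \<in> free_component U (m + n - 1)"
proof -
  have "Poly_Mapping.keys (free_comp J f g) \<subseteq>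
      (\<Union>s\<in>Poly_Mapping.keys f. \<Union>t\<in>Poly_Mapping.keys g. {shuffle_graft J s t})"
    unfolding free_comp_def
    by (rule subset_trans[OF Poly_Mapping.keys_sum] UN_mono order_refl)+ (auto split: if_splits)
  also have "\<dots> \<subseteq> shuffle_monomials U (m + n - 1)"
    using assms(4,5) shuffle_graft_monomial[OF assms(1-3)]
    unfolding free_component_def by blast
  finally show ?thesis by (simp add: free_component_def)
qed

lemma monomial_in_free_component:
  "t \<in> shuffle_monomials U n \<Longrightarrow> monomial t \<in> free_component U n"
  by (simp add: monomial_def free_component_def)

lemma keys_free_comp_monomial_right:
  assumes "J \<in> shuffle_sets m n" "m \<ge> 1" "n \<ge> 1"
    and "f \<in> free_component U m" "t \<in> shuffle_monomials U n"
  shows "Poly_Mapping.keys (free_comp J f (monomial t)) = (\<lambda>s. shuffle_graft J s t) ` Poly_Mapping.keys f"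
proof -
  have "free_comp J f (monomial t) = (\<Sum>s\<in>Poly_Mapping.keys f.
      Poly_Mapping.single (shuffle_graft J s t) (Poly_Mapping.lookup f s))"
    by (simp add: free_comp_def monomial_def)
  moreover have "inj_on (\<lambda>s. shuffle_graft J s t) (Poly_Mapping.keys f)"
    using assms(4) shuffle_graft_inj_left[OF assms(1-3) _ _ assms(5)]
    by (intro inj_onI) (auto simp: free_component_def)
  ultimately show ?thesis
    by (simp only:) (rule keys_sum_single, simp_all add: in_keys_iff)
qed

lemma keys_free_comp_monomial_left:
  assumes "J \<in> shuffle_sets m n" "m \<ge> 1" "n \<ge> 1"
    and "s \<in> shuffle_monomials U m" "g \<in> free_component U n"
  shows "Poly_Mapping.keys (free_comp J (monomial s) g) = shuffle_graft J s ` Poly_Mapping.keys g"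
proof -
  have "free_comp J (monomial s) g = (\<Sum>t\<in>Poly_Mapping.keys g.
      Poly_Mapping.single (shuffle_graft J s t) (Poly_Mapping.lookup g t))"
    by (simp add: free_comp_def monomial_def)
  moreover have "inj_on (shuffle_graft J s) (Poly_Mapping.keys g)"
    using assms(5) shuffle_graft_inj_right[OF assms(1-3) assms(4)]
    by (intro inj_onI) (auto simp: free_component_def)
  ultimately show ?thesis
    by (simp only:) (rule keys_sum_single, simp_all add: in_keys_iff)
qed

text \<open>Isolates what the divisibility argument takes from \<open>C\<close>: closure under
  composition with the free operad on either side, in the presence of an admissible order.\<close>

locale shuffle_ideal =
  fixes U :: "nat \<Rightarrow> 'u set"
    and C :: "nat \<Rightarrow> (('u, nat) ltree \<Rightarrow>\<^sub>0 'k::field_char_0) set"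
    and le :: "('u, nat) ltree \<Rightarrow> ('u, nat) ltree \<Rightarrow> bool"
  assumes order: "admissible_order U le"
    and subset_free: "n \<ge> 1 \<Longrightarrow> C n \<subseteq> free_component U n"
    and comp_left: "\<lbrakk>m \<ge> 1; n \<ge> 1; J \<in> shuffle_sets m n; f \<in> C m; g \<in> free_component U n\<rbrakk>
      \<Longrightarrow> free_comp J f g \<in> C (m + n - 1)"
    and comp_right: "\<lbrakk>m \<ge> 1; n \<ge> 1; J \<in> shuffle_sets m n; f \<in> free_component U m; g \<in> C n\<rbrakk>
      \<Longrightarrow> free_comp J f g \<in> C (m + n - 1)"
begin

text \<open>A relational form of being the leading monomial of an element of \<open>C n\<close>,
  free of the description operator in \<open>leading_monomial\<close>; a term of \<open>f\<close>
  exists only if \<open>f\<close> is nonzero.\<close>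

definition leading :: "nat \<Rightarrow> ('u, nat) ltree \<Rightarrow> bool" where
  "leading n t \<longleftrightarrow> n \<ge> 1 \<and> (\<exists>f\<in>C n. t \<in> Poly_Mapping.keys f \<and> (\<forall>s\<in>Poly_Mapping.keys f. le s t))"

lemma leading_shuffle_monomial: "leading n t \<Longrightarrow> t \<in> shuffle_monomials U n"
  using subset_free by (fastforce simp: leading_def free_component_def)

lemma le_refl: "t \<in> shuffle_monomials U n \<Longrightarrow> n \<ge> 1 \<Longrightarrow> le t t"
  using order
  by (auto simp: admissible_order_def well_order_on_def linear_order_on_def partial_order_on_def
      preorder_on_def refl_on_def)

lemma graft_mono:
  assumes "J \<in> shuffle_sets m n" "m \<ge> 1" "n \<ge> 1"
    and "s \<in> shuffle_monomials U m" "s' \<in> shuffle_monomials U m"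
    and "t \<in> shuffle_monomials U n" "t' \<in> shuffle_monomials U n"
    and "le s s'" "le t t'"
  shows "le (shuffle_graft J s t) (shuffle_graft J s' t')"
  using order assms unfolding admissible_order_def by blast

text \<open>Composition with a monomial is monotone, so the largest term goes to an upper bound of
  all terms; by injectivity nothing cancels and that bound is itself a term.\<close>

lemma leading_graft_left:
  assumes J: "J \<in> shuffle_sets m n" and n: "n \<ge> 1"
    and s: "leading m s" and t: "t \<in> shuffle_monomials U n"
  shows "leading (m + n - 1) (shuffle_graft J s t)"
proof -
  obtain f where f: "f \<in> C m" "s \<in> Poly_Mapping.keys f" "\<And>s'. s' \<in> Poly_Mapping.keys f \<Longrightarrow> le s' s"
    and m: "m \<ge> 1"
    using s by (auto simp: leading_def)
  have ff: "f \<in> free_component U m" using f(1) subset_free[OF m] by auto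
  then have fm: "s' \<in> shuffle_monomials U m" if "s' \<in> Poly_Mapping.keys f" for s'
    using that by (auto simp: free_component_def)
  have "free_comp J f (monomial t) \<in> C (m + n - 1)"
    by (rule comp_left[OF m n J f(1) monomial_in_free_component[OF t]])
  moreover have "\<forall>s'\<in>Poly_Mapping.keys (free_comp J f (monomial t)). le s' (shuffle_graft J s t)"
    using graft_mono[OF J m n fm fm[OF f(2)] t t f(3) le_refl[OF t n]]
    by (auto simp: keys_free_comp_monomial_right[OF J m n ff t])
  ultimately show ?thesis
    using f(2) m n unfolding leading_def
    by (intro conjI bexI[of _ "free_comp J f (monomial t)"])
      (auto simp: keys_free_comp_monomial_right[OF J m n ff t])
qed

lemma leading_graft_right:
  assumes J: "J \<in> shuffle_sets m n" and m: "m \<ge> 1"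
    and s: "s \<in> shuffle_monomials U m" and t: "leading n t"
  shows "leading (m + n - 1) (shuffle_graft J s t)"
proof -
  obtain f where f: "f \<in> C n" "t \<in> Poly_Mapping.keys f" "\<And>t'. t' \<in> Poly_Mapping.keys f \<Longrightarrow> le t' t"
    and n: "n \<ge> 1"
    using t by (auto simp: leading_def)
  have ff: "f \<in> free_component U n" using f(1) subset_free[OF n] by auto
  then have fm: "t' \<in> shuffle_monomials U n" if "t' \<in> Poly_Mapping.keys f" for t'
    using that by (auto simp: free_component_def)
  have "free_comp J (monomial s) f \<in> C (m + n - 1)"
    by (rule comp_right[OF m n J monomial_in_free_component[OF s] f(1)])
  moreover have "\<forall>s'\<in>Poly_Mapping.keys (free_comp J (monomial s) f). le s' (shuffle_graft J s t)"
    using graft_mono[OF J m n s s fm fm[OF f(2)] le_refl[OF s m] f(3)]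
    by (auto simp: keys_free_comp_monomial_left[OF J m n s ff])
  ultimately show ?thesis
    using f(2) m n unfolding leading_def
    by (intro conjI bexI[of _ "free_comp J (monomial s) f"])
      (auto simp: keys_free_comp_monomial_left[OF J m n s ff])
qed

text \<open>Extends the notion to trees with arbitrary labels, so that it can be followed from a
  subtree to the whole tree.\<close>

abbreviation std_leading :: "('u, nat) ltree \<Rightarrow> bool" where
  "std_leading t \<equiv> leading (length (leaves t)) (standardize t)"

lemma std_leading_graft_at:
  assumes "shuffle_tree U p" "shuffle_tree U r" "distinct (leaves p)" "distinct (leaves r)"
    and "min_leaf r = l0" "set (leaves p) \<inter> set (leaves r) = {l0}"
    and "std_leading p \<or> std_leading r"
  shows "std_leading (graft_at l0 r p)"
proof -
  obtain J where J: "J \<in> shuffle_sets (length (leaves p)) (length (leaves r))"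
    "standardize (graft_at l0 r p) = shuffle_graft J (standardize p) (standardize r)"
    using standardize_graft_at[OF assms(1-6)] by blast
  have "length (leaves p) \<ge> 1" "length (leaves r) \<ge> 1"
    using assms(1,2) shuffle_tree_leaves_nonempty by (auto simp: Suc_le_eq)
  then have l: "leading (length (leaves p) + length (leaves r) - 1) (standardize (graft_at l0 r p))"
    using assms(7) leading_graft_left[OF J(1)] leading_graft_right[OF J(1)]
      standardize_shuffle_monomial assms(1-4) unfolding J(2) by blast
  \<comment> \<open>The number of leaves of the graft is read off from the arity in which its
    standardization was found.\<close>
  have "length (leaves (standardize (graft_at l0 r p))) = length (leaves p) + length (leaves r) - 1"
    by (rule length_leaves_shuffle_monomial[OF leading_shuffle_monomial[OF l]])
  then show ?thesis using l by (simp add: standardize_def)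
qed

text \<open>Each induction step reattaches one child to the vertex below it, which is a single
  graft.\<close>

lemma std_leading_upper_subtree:
  assumes "upper_subtree v s" "shuffle_tree U v" "distinct (leaves v)" "std_leading s"
  shows "std_leading v"
  using assms
proof (induction rule: upper_subtree.induct)
  case (2 t ts s u)
  obtain xs ys where ts: "ts = xs @ t # ys" using 2(1) by (meson split_list)
  \<comment> \<open>The part below the cut: the removed child is represented by its minimal leaf, as
    in a shuffle composition.\<close>
  define p where "p = Vertex u (xs @ Leaf (min_leaf t) # ys)"
  have t: "shuffle_tree U t" "distinct (leaves t)" using 2(4,5) ts by auto
  then have lt: "std_leading t" using 2 by simp
  have mt: "min_leaf t \<in> set (leaves t)" using min_leaf_in[OF shuffle_tree_leaves_nonempty[OF t(1)]] .
  have notin: "min_leaf t \<notin> set (leaves x)" if "x \<in> set xs \<union> set ys" for x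
    using 2(5) ts mt that by auto
  have "map (graft_at (min_leaf t) t) xs = xs" "map (graft_at (min_leaf t) t) ys = ys"
    using notin by (auto intro!: map_idI graft_at_trivial)
  then have eq: "graft_at (min_leaf t) t p = Vertex u ts" by (simp add: p_def ts)
  have "std_leading (graft_at (min_leaf t) t p)"
  proof (rule std_leading_graft_at)
    show "shuffle_tree U p" using 2(4) by (auto simp: p_def ts)
    show "distinct (leaves p)" using 2(5) notin mt by (auto simp: p_def ts)
    show "set (leaves p) \<inter> set (leaves t) = {min_leaf t}" using 2(5) mt by (auto simp: p_def ts)
  qed (use t lt in simp_all)
  then show ?case unfolding eq .
qed simp

text \<open>The cut subtrees are restored one after another. Each restoration is a single graft, and
  every graft preserves the property.\<close>

lemma std_leading_pruning:
  assumes "pruning t u" "shuffle_tree U t" "distinct (leaves t)" "std_leading u"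
  shows "std_leading t"
proof -
  obtain f where t: "t = subst_leaves f u"
    and f: "\<And>l. l \<in> set (leaves u) \<Longrightarrow> shuffle_tree U (f l) \<and> min_leaf (f l) = l"
    using pruning_subst_leaves[OF assms(1-3)] by blast
  have u: "shuffle_tree U u" using pruning_shuffle_tree[OF assms(1,2)] by blast
  have lf: "l \<in> set (leaves (f l))" if "l \<in> set (leaves u)" for l
    using f[OF that] min_leaf_in[OF shuffle_tree_leaves_nonempty, of U "f l"] by simp
  have dc: "distinct (concat (map (\<lambda>l. leaves (f l)) (leaves u)))"
    using assms(3) unfolding t leaves_subst_leaves .
  have ne: "\<forall>l\<in>set (leaves u). leaves (f l) \<noteq> []" using lf by force
  note d = distinct_concat_map_disjoint[OF dc ne]
  \<comment> \<open>The intermediate stages: exactly the subtrees whose labels lie in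
    \<open>S\<close> have been restored.\<close>
  define g where "g S l = (if l \<in> S then f l else Leaf l)" for S l
  have g: "shuffle_tree U (g S l) \<and> min_leaf (g S l) = l" "l \<in> set (leaves (g S l))"
    "distinct (leaves (g S l))"
    if "l \<in> set (leaves u)" for S l
    using f[OF that] lf[OF that] d(3) that by (auto simp: g_def)
  have gf: "set (leaves (g S l)) \<subseteq> set (leaves (f l))" if "l \<in> set (leaves u)" for S l
    using lf[OF that] by (auto simp: g_def)
  have "std_leading (subst_leaves (g S) u)" if "finite S" "S \<subseteq> set (leaves u)" for S
    using that
  proof (induction S rule: finite_induct)
    case empty
    have "subst_leaves (g {}) u = u" by (rule subst_leaves_Leaf) (simp add: g_def)
    then show ?case using assms(4) by simp
  next
    case (insert l0 S)
    have l0: "l0 \<in> set (leaves u)" using insert by simp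
    have notin: "l0 \<notin> set (leaves (f l))" if "l \<in> set (leaves u)" "l \<noteq> l0" for l
      using d(2)[OF that(1) l0 that(2)] lf[OF l0] by auto
    have "subst_leaves (g (insert l0 S)) u = graft_at l0 (f l0) (subst_leaves (g S) u)"
      unfolding graft_at_def subst_leaves_subst
    proof (rule subst_leaves_cong)
      fix l assume l: "l \<in> set (leaves u)"
      show "g (insert l0 S) l = subst_leaves (\<lambda>l. if l = l0 then f l0 else Leaf l) (g S l)"
      proof (cases "l = l0")
        case True
        then show ?thesis using insert(2) by (simp add: g_def)
      next
        case False
        then have "l0 \<notin> set (leaves (g S l))" using notin[OF l] gf[OF l] by blast
        then have "graft_at l0 (f l0) (g S l) = g S l" by (rule graft_at_trivial)
        then show ?thesis using False by (simp add: g_def graft_at_def)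
      qed
    qed
    moreover have "std_leading (graft_at l0 (f l0) (subst_leaves (g S) u))"
    proof (rule std_leading_graft_at)
      show "shuffle_tree U (subst_leaves (g S) u)" using shuffle_tree_subst[OF u] g(1) by blast
      show "distinct (leaves (subst_leaves (g S) u))"
        unfolding leaves_subst_leaves
      proof (rule distinct_concat_mapI)
        show "distinct (leaves u)" by (rule d(1))
        show "set (leaves (g S x)) \<inter> set (leaves (g S y)) = {}"
          if "x \<in> set (leaves u)" "y \<in> set (leaves u)" "x \<noteq> y" for x y
          using d(2)[OF that] gf[OF that(1)] gf[OF that(2)] by blast
      qed (rule g(3))
      show "set (leaves (subst_leaves (g S) u)) \<inter> set (leaves (f l0)) = {l0}"
      proof
        have "g S l0 = Leaf l0" using insert(2) by (simp add: g_def)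
        then show "set (leaves (subst_leaves (g S) u)) \<inter> set (leaves (f l0)) \<subseteq> {l0}"
          using d(2)[OF _ l0] gf by (fastforce simp: set_leaves_subst_leaves)
        show "{l0} \<subseteq> set (leaves (subst_leaves (g S) u)) \<inter> set (leaves (f l0))"
          using l0 lf[OF l0] g(2)[OF l0] by auto
      qed
      show "std_leading (subst_leaves (g S) u) \<or> std_leading (f l0)" using insert by simp
    qed (use f[OF l0] d(3)[OF l0] in simp_all)
    ultimately show ?case by simp
  qed
  from this[of "set (leaves u)"] have "std_leading (subst_leaves (g (set (leaves u))) u)" by simp
  also have "subst_leaves (g (set (leaves u))) u = t"
    unfolding t by (rule subst_leaves_cong) (simp add: g_def)
  finally show ?thesis .
qed

text \<open>The order isomorphism onto \<open>w\<close> disappears under standardization; the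
  property then passes from the connected subtree to the upper subtree of which it is a pruning, and
  from there to \<open>v\<close>.\<close>

lemma divisible_leading:
  assumes "v \<in> shuffle_monomials U n" "divisible v w" "leading m w"
  shows "leading n v"
proof -
  obtain s u f where s: "upper_subtree v s" "pruning s u"
    and f: "strict_mono_on (set (leaves u)) f" "map_ltree id f u = w"
    using assms(2) by (auto simp: divisible_def connected_subtree_def)
  have v: "shuffle_tree U v" "distinct (leaves v)"
    using assms(1) by (auto simp: shuffle_monomials_def)
  have sv: "shuffle_tree U s \<and> distinct (leaves s)"
    using upper_subtree_shuffle_tree[OF s(1) v] .
  have w: "w \<in> shuffle_monomials U m" using leading_shuffle_monomial[OF assms(3)] .
  have "standardize u = w"
    using standardize_map[OF f(1)] f(2) standardize_id[OF w] by simp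
  moreover have "length (leaves u) = m"
    using length_leaves_shuffle_monomial[OF w] f(2) by auto
  ultimately have "std_leading u" using assms(3) by simp
  then have "std_leading s" using std_leading_pruning[OF s(2)] sv by blast
  then have "std_leading v" using std_leading_upper_subtree[OF s(1)] v by blast
  then show ?thesis
    using standardize_id[OF assms(1)] length_leaves_shuffle_monomial[OF assms(1)] by simp
qed

end

section \<open>Normal monomials form a basis\<close>

lemma poly_mapping_eq_sum_single:
  "f = (\<Sum>t\<in>Poly_Mapping.keys f. Poly_Mapping.single t (Poly_Mapping.lookup f t))"
  by (rule poly_mapping_eqI) (simp add: lookup_sum lookup_single when_def in_keys_iff)

lemma free_smult_monomial: "free_smult c (monomial t) = Poly_Mapping.single t c"
  by (rule poly_mapping_eqI)
    (simp add: free_smult_def monomial_def Poly_Mapping.map.rep_eq lookup_single when_def)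

context shuffle_ideal
begin

lemma well_order:
  assumes "n \<ge> 1"
  shows "well_order_on (shuffle_monomials U n)
    {(s, t). s \<in> shuffle_monomials U n \<and> t \<in> shuffle_monomials U n \<and> le s t}"
  using order assms by (simp add: admissible_order_def)

lemma le_trans:
  assumes "n \<ge> 1" "s \<in> shuffle_monomials U n" "t \<in> shuffle_monomials U n" "u \<in> shuffle_monomials U n"
    and "le s t" "le t u"
  shows "le s u"
proof -
  have "trans {(s, t). s \<in> shuffle_monomials U n \<and> t \<in> shuffle_monomials U n \<and> le s t}"
    using well_order[OF assms(1)]
    by (simp add: well_order_on_def linear_order_on_def partial_order_on_def preorder_on_def)
  then show ?thesis using assms by (auto dest: transD[where x = s and y = t and z = u])
qed

lemma le_antisym:
  assumes "n \<ge> 1" "s \<in> shuffle_monomials U n" "t \<in> shuffle_monomials U n" "le s t" "le t s"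
  shows "s = t"
proof -
  have "antisym {(s, t). s \<in> shuffle_monomials U n \<and> t \<in> shuffle_monomials U n \<and> le s t}"
    using well_order[OF assms(1)]
    by (simp add: well_order_on_def linear_order_on_def partial_order_on_def)
  then show ?thesis using assms by (auto dest: antisymD)
qed

lemma le_total:
  assumes "n \<ge> 1" "s \<in> shuffle_monomials U n" "t \<in> shuffle_monomials U n"
  shows "le s t \<or> le t s"
proof -
  have "total_on (shuffle_monomials U n)
      {(s, t). s \<in> shuffle_monomials U n \<and> t \<in> shuffle_monomials U n \<and> le s t}"
    using well_order[OF assms(1)] by (simp add: well_order_on_def linear_order_on_def)
  then show ?thesis using assms le_refl by (cases "s = t") (auto simp: total_on_def)
qed

lemma finite_has_greatest:
  assumes "n \<ge> 1" "finite S" "S \<noteq> {}" "S \<subseteq> shuffle_monomials U n"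
  shows "\<exists>t\<in>S. \<forall>s\<in>S. le s t"
  using assms(2-4)
proof (induction S rule: finite_ne_induct)
  case (singleton x)
  then show ?case using le_refl assms(1) by auto
next
  case (insert x S)
  then obtain t where t: "t \<in> S" "\<forall>s\<in>S. le s t" by auto
  have x: "x \<in> shuffle_monomials U n" and S: "S \<subseteq> shuffle_monomials U n" using insert by auto
  show ?case
  proof (cases "le x t")
    case True
    then show ?thesis using t by auto
  next
    case False
    then have "le t x" using le_total[OF assms(1) x] t S by auto
    then have "\<forall>s\<in>insert x S. le s x"
      using t S x le_trans[OF assms(1)] le_refl[OF x assms(1)] by blast
    then show ?thesis by blast
  qed
qed

lemma leading_monomial:
  assumes "n \<ge> 1" "f \<in> free_component U n" "f \<noteq> 0"
  shows "leading_monomial le f \<in> Poly_Mapping.keys f"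
    "\<And>s. s \<in> Poly_Mapping.keys f \<Longrightarrow> le s (leading_monomial le f)"
proof -
  have sub: "Poly_Mapping.keys f \<subseteq> shuffle_monomials U n" using assms(2) by (simp add: free_component_def)
  obtain t where t: "t \<in> Poly_Mapping.keys f" "\<forall>s\<in>Poly_Mapping.keys f. le s t"
    using finite_has_greatest[OF assms(1) finite_keys _ sub] assms(3) by auto
  have "leading_monomial le f = t"
    unfolding leading_monomial_def
  proof (rule the_equality)
    fix s assume s: "s \<in> Poly_Mapping.keys f \<and> (\<forall>s'\<in>Poly_Mapping.keys f. le s' s)"
    then show "s = t" using t sub le_antisym[OF assms(1), of s t] by blast
  qed (use t in blast)
  then show "leading_monomial le f \<in> Poly_Mapping.keys f"
    "\<And>s. s \<in> Poly_Mapping.keys f \<Longrightarrow> le s (leading_monomial le f)"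
    using t by auto
qed

text \<open>One direction is the Groebner property. For the other, elements of \<open>G\<close> lie
  in the ideal and are nonzero, so their leading monomials satisfy \<open>leading\<close>, which
  divisibility propagates.\<close>

lemma leading_iff_divisible:
  assumes G: "groebner_basis le C G" "0 \<notin> G" and t: "t \<in> shuffle_monomials U n" "n \<ge> 1"
  shows "leading n t \<longleftrightarrow> (\<exists>g\<in>G. divisible t (leading_monomial le g))"
proof
  assume "leading n t"
  then obtain f where f: "f \<in> C n" "t \<in> Poly_Mapping.keys f" "\<forall>s\<in>Poly_Mapping.keys f. le s t"
    by (auto simp: leading_def)
  have ff: "f \<in> free_component U n" and f0: "f \<noteq> 0" using f subset_free[OF t(2)] by auto
  note lm = leading_monomial[OF t(2) ff f0]
  have "leading_monomial le f = t"
    using lm f(2,3) le_antisym[OF t(2)] ff t(1) by (auto simp: free_component_def)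
  then show "\<exists>g\<in>G. divisible t (leading_monomial le g)"
    using G(1) f(1) f0 t(2) unfolding groebner_basis_def by metis
next
  assume "\<exists>g\<in>G. divisible t (leading_monomial le g)"
  then obtain g where g: "g \<in> G" "divisible t (leading_monomial le g)" by blast
  then obtain m where m: "m \<ge> 1" "g \<in> C m" using G(1) by (auto simp: groebner_basis_def)
  have "g \<noteq> 0" "g \<in> free_component U m" using g G(2) m subset_free by auto
  then have "leading m (leading_monomial le g)"
    using leading_monomial[OF m(1)] m by (auto simp: leading_def)
  then show "leading n t" using divisible_leading[OF t(1) g(2)] by simp
qed

end

locale shuffle_presentation = vs: vector_space "smult P"
  for P :: "('k::field_char_0, 'p::ab_group_add) operad" +
  fixes U :: "nat \<Rightarrow> 'u set"
    and C :: "nat \<Rightarrow> (('u, nat) ltree \<Rightarrow>\<^sub>0 'k) set"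
    and \<phi> :: "(('u, nat) ltree \<Rightarrow>\<^sub>0 'k) \<Rightarrow> 'p"
    and le :: "('u, nat) ltree \<Rightarrow> ('u, nat) ltree \<Rightarrow> bool"
  assumes epi: "shuffle_epimorphism P U \<phi>"
    and kernel: "n \<ge> 1 \<Longrightarrow> C n = {f \<in> free_component U n. \<phi> f = 0}"
    and adm: "admissible_order U le"
begin

lemma zero_free: "0 \<in> free_component U n"
  by (simp add: free_component_def)

lemma phi_add: "n \<ge> 1 \<Longrightarrow> f \<in> free_component U n \<Longrightarrow> g \<in> free_component U n \<Longrightarrow> \<phi> (f + g) = \<phi> f + \<phi> g"
  using epi by (auto simp: shuffle_epimorphism_def)

lemma phi_0: "\<phi> 0 = 0"
  using phi_add[of 1 0 0] zero_free[of 1] by simp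

lemma phi_sum:
  assumes "n \<ge> 1" "finite S" "S \<subseteq> shuffle_monomials U n"
  shows "\<phi> (\<Sum>t\<in>S. Poly_Mapping.single t (c t)) = (\<Sum>t\<in>S. smult P (c t) (\<phi> (monomial t)))"
  using assms(2,3)
proof (induction S rule: finite_induct)
  case (insert t S)
  have t: "monomial t \<in> free_component U n" using insert monomial_in_free_component by auto
  have 1: "Poly_Mapping.single t (c t) \<in> free_component U n"
    using insert by (auto simp: free_component_def)
  have 2: "(\<Sum>t\<in>S. Poly_Mapping.single t (c t)) \<in> free_component U n"
    using insert.prems unfolding free_component_def
    by (auto split: if_splits dest!: subsetD[OF Poly_Mapping.keys_sum])
  have 3: "\<phi> (Poly_Mapping.single t (c t)) = smult P (c t) (\<phi> (monomial t))"
    using epi t assms(1) free_smult_monomial[of "c t" t] unfolding shuffle_epimorphism_def by metis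
  show ?case using insert phi_add[OF assms(1) 1 2] 3 by simp
qed (simp add: phi_0)

lemma phi_eq_sum:
  assumes "n \<ge> 1" "f \<in> free_component U n"
  shows "\<phi> f = (\<Sum>s\<in>Poly_Mapping.keys f. smult P (Poly_Mapping.lookup f s) (\<phi> (monomial s)))"
proof -
  have "\<phi> f = \<phi> (\<Sum>s\<in>Poly_Mapping.keys f. Poly_Mapping.single s (Poly_Mapping.lookup f s))"
    by (rule arg_cong[OF poly_mapping_eq_sum_single])
  then show ?thesis
    using phi_sum[OF assms(1) finite_keys] assms(2) by (simp add: free_component_def)
qed

text \<open>The composition with \<open>0\<close> vanishes in \<open>P\<close> because it is the image of a composition in the
  free operad; so \<open>C\<close> is an ideal for any epimorphism, without reference to the operad axioms.\<close>

sublocale shuffle_ideal U C le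
proof
  show "admissible_order U le" by (rule adm)
  show "C n \<subseteq> free_component U n" if "n \<ge> 1" for n using kernel[OF that] by auto
next
  fix m n J and f g :: "('u, nat) ltree \<Rightarrow>\<^sub>0 'k"
  assume mn: "m \<ge> 1" "n \<ge> 1" and J: "J \<in> shuffle_sets m n"
  have comp: "\<phi> (free_comp J f g) = shuffle_pcomp P m n J (\<phi> f) (\<phi> g)"
    if "f \<in> free_component U m" "g \<in> free_component U n" for f g
    using epi mn J that by (auto simp: shuffle_epimorphism_def)
  have mn1: "m + n - 1 \<ge> 1" using mn by simp
  {
    assume f: "f \<in> C m" and g: "g \<in> free_component U n"
    then have ff: "f \<in> free_component U m" "\<phi> f = \<phi> 0" using kernel mn phi_0 by auto
    have "\<phi> (free_comp J f g) = \<phi> (free_comp J 0 g)"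
      using comp[OF ff(1) g] comp[OF zero_free g] ff(2) by simp
    then show "free_comp J f g \<in> C (m + n - 1)"
      using free_comp_closed[OF J mn ff(1) g] kernel[OF mn1] phi_0 by (simp add: free_comp_def)
  next
    assume f: "f \<in> free_component U m" and g: "g \<in> C n"
    then have gg: "g \<in> free_component U n" "\<phi> g = \<phi> 0" using kernel mn phi_0 by auto
    have "\<phi> (free_comp J f g) = \<phi> (free_comp J f 0)"
      using comp[OF f gg(1)] comp[OF f zero_free] gg(2) by simp
    then show "free_comp J f g \<in> C (m + n - 1)"
      using free_comp_closed[OF J mn f gg(1)] kernel[OF mn1] phi_0 by (simp add: free_comp_def)
  }
qed

text \<open>The standard monomials of Groebner theory; their images form a basis of the component of
  \<open>P\<close>.\<close>

definition normal_monomials :: "nat \<Rightarrow> ('u, nat) ltree set" where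
  "normal_monomials n = {t \<in> shuffle_monomials U n. \<not> leading n t}"

text \<open>A nontrivial relation would give a nonzero element of \<open>C n\<close> all of whose
  terms are normal, its leading monomial included.\<close>

lemma normal_coefficients_zero:
  assumes "n \<ge> 1" "finite S" "S \<subseteq> normal_monomials n"
    and "(\<Sum>t\<in>S. smult P (c t) (\<phi> (monomial t))) = 0" "t \<in> S"
  shows "c t = 0"
proof (rule ccontr)
  assume ct: "c t \<noteq> 0"
  \<comment> \<open>Dropping the zero coefficients makes the terms of \<open>f\<close> exactly this
    set.\<close>
  let ?S = "{t \<in> S. c t \<noteq> 0}"
  define f where "f = (\<Sum>t\<in>?S. Poly_Mapping.single t (c t))"
  have "Poly_Mapping.keys f = (\<lambda>t. t) ` ?S"
    unfolding f_def by (rule keys_sum_single) (use assms(2) in auto)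
  then have keys: "Poly_Mapping.keys f = ?S" by simp
  have SM: "?S \<subseteq> shuffle_monomials U n" using assms(3) by (auto simp: normal_monomials_def)
  then have ff: "f \<in> free_component U n" by (simp add: free_component_def keys)
  have "\<phi> f = (\<Sum>t\<in>?S. smult P (c t) (\<phi> (monomial t)))"
    unfolding f_def by (rule phi_sum[OF assms(1) _ SM]) (use assms(2) in simp)
  also have "\<dots> = (\<Sum>t\<in>S. smult P (c t) (\<phi> (monomial t)))"
    by (rule sum.mono_neutral_left) (use assms(2) in auto)
  also have "\<dots> = 0" by (rule assms(4))
  finally have fC: "f \<in> C n" using ff unfolding kernel[OF assms(1)] by blast
  have "t \<in> Poly_Mapping.keys f" unfolding keys using ct assms(5) by blast
  then have "f \<noteq> 0" by (metis empty_iff keys_zero)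
  note lm = leading_monomial[OF assms(1) ff this]
  have "leading n (leading_monomial le f)"
    unfolding leading_def using lm fC assms(1) by blast
  moreover have "leading_monomial le f \<in> normal_monomials n"
    using lm(1) assms(3) unfolding keys by blast
  ultimately show False by (simp add: normal_monomials_def)
qed

lemma normal_images_independent:
  assumes "n \<ge> 1" "finite S" "S \<subseteq> normal_monomials n"
  shows "inj_on (\<lambda>t. \<phi> (monomial t)) S" "vs.independent ((\<lambda>t. \<phi> (monomial t)) ` S)"
proof -
  show inj: "inj_on (\<lambda>t. \<phi> (monomial t)) S"
  proof (rule inj_onI, rule ccontr)
    fix s t assume st: "s \<in> S" "t \<in> S" "\<phi> (monomial s) = \<phi> (monomial t)" "s \<noteq> t"
    have "(if s = s then 1 else - 1 :: 'k) = 0"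
      by (rule normal_coefficients_zero[where S = "{s, t}" and c = "\<lambda>x. if x = s then 1 else -1"])
        (use assms st in auto)
    then show False by simp
  qed
  show "vs.independent ((\<lambda>t. \<phi> (monomial t)) ` S)"
  proof (rule vs.independent_if_scalars_zero)
    fix f x assume s: "(\<Sum>x\<in>(\<lambda>t. \<phi> (monomial t)) ` S. smult P (f x) x) = 0"
      and x: "x \<in> (\<lambda>t. \<phi> (monomial t)) ` S"
    have "(\<Sum>t\<in>S. smult P (f (\<phi> (monomial t))) (\<phi> (monomial t))) = 0"
      using s inj by (simp add: sum.reindex)
    then show "f x = 0"
      using x normal_coefficients_zero[OF assms, of "\<lambda>t. f (\<phi> (monomial t))"] by auto
  qed (use assms in simp)
qed

text \<open>Reduction along the well-order: an element of the kernel with leading monomial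
  \<open>t\<close> expresses the image of \<open>t\<close> by images of strictly smaller
  monomials.\<close>

lemma monomial_in_normal_span:
  assumes "n \<ge> 1" "t \<in> shuffle_monomials U n"
  shows "\<phi> (monomial t) \<in> vs.span ((\<lambda>t. \<phi> (monomial t)) ` normal_monomials n)"
proof -
  let ?r = "{(s, t). s \<in> shuffle_monomials U n \<and> t \<in> shuffle_monomials U n \<and> le s t}"
  let ?B = "(\<lambda>t. \<phi> (monomial t)) ` normal_monomials n"
  have "wf (?r - Id)" using well_order[OF assms(1)] by (simp add: well_order_on_def)
  then have "t \<in> shuffle_monomials U n \<longrightarrow> \<phi> (monomial t) \<in> vs.span ?B" for t
  proof (induction t rule: wf_induct_rule)
    case (less t)
    show ?case
    proof (intro impI, cases "leading n t")
      case False
      assume "t \<in> shuffle_monomials U n"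
      with False show "\<phi> (monomial t) \<in> vs.span ?B"
        by (intro vs.span_base) (auto simp: normal_monomials_def)
    next
      case True
      assume t: "t \<in> shuffle_monomials U n"
      obtain f where f: "f \<in> C n" "t \<in> Poly_Mapping.keys f" "\<forall>s\<in>Poly_Mapping.keys f. le s t"
        using True by (auto simp: leading_def)
      have ff: "Poly_Mapping.keys f \<subseteq> shuffle_monomials U n"
        using f subset_free[OF assms(1)] by (auto simp: free_component_def)
      let ?c = "Poly_Mapping.lookup f" and ?e = "\<lambda>s. \<phi> (monomial s)"
      have c: "?c t \<noteq> 0" using f(2) by (simp add: in_keys_iff)
      have "\<phi> f = (\<Sum>s\<in>Poly_Mapping.keys f. smult P (?c s) (?e s))"
        using phi_eq_sum[OF assms(1)] ff by (simp add: free_component_def)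
      then have "smult P (?c t) (?e t) + (\<Sum>s\<in>Poly_Mapping.keys f - {t}. smult P (?c s) (?e s)) = 0"
        using f kernel[OF assms(1)] by (simp add: sum.remove[OF finite_keys f(2)])
      then have "smult P (?c t) (?e t) = - (\<Sum>s\<in>Poly_Mapping.keys f - {t}. smult P (?c s) (?e s))"
        by (simp only: add_eq_0_iff2)
      also have "\<dots> \<in> vs.span ?B"
      proof (intro vs.span_neg vs.span_sum vs.span_scale)
        fix s assume "s \<in> Poly_Mapping.keys f - {t}"
        then show "?e s \<in> vs.span ?B" using less[of s] f(3) ff t by auto
      qed
      finally have "smult P (inverse (?c t)) (smult P (?c t) (?e t)) \<in> vs.span ?B"
        by (rule vs.span_scale)
      then show "?e t \<in> vs.span ?B" using c by simp
    qed
  qed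
  then show ?thesis using assms by blast
qed

lemma dim_component:
  assumes "n \<ge> 1" and "finite B" "component P n = vs.span B"
  shows "finite (normal_monomials n)" "vs.dim (component P n) = card (normal_monomials n)"
proof -
  let ?e = "\<lambda>t. \<phi> (monomial t)"
  have e: "?e ` shuffle_monomials U n \<subseteq> component P n"
    using epi assms(1) monomial_in_free_component unfolding shuffle_epimorphism_def by blast
  have sub: "normal_monomials n \<subseteq> shuffle_monomials U n" by (auto simp: normal_monomials_def)
  \<comment> \<open>Finiteness has to precede the dimension formula: independence of every finite
    set of normal monomials bounds its size by that of a finite spanning set.\<close>
  have bound: "card S \<le> card B" if "finite S" "S \<subseteq> normal_monomials n" for S
  proof -
    note i = normal_images_independent[OF assms(1) that]
    have "?e ` S \<subseteq> vs.span B" using that e sub assms(3) by blast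
    then have "card (?e ` S) \<le> card B" using vs.independent_span_bound[OF assms(2) i(2)] by simp
    then show ?thesis using i(1) by (simp add: card_image)
  qed
  show fin: "finite (normal_monomials n)"
    using bound infinite_arbitrarily_large[of "normal_monomials n" "Suc (card B)"]
    by (metis Suc_n_not_le_n)
  note i = normal_images_independent[OF assms(1) fin order_refl]
  have "component P n \<subseteq> vs.span (?e ` normal_monomials n)"
  proof
    fix x assume "x \<in> component P n"
    then obtain f where f: "f \<in> free_component U n" "x = \<phi> f"
      using epi assms(1) unfolding shuffle_epimorphism_def by blast
    then have ff: "Poly_Mapping.keys f \<subseteq> shuffle_monomials U n" by (simp add: free_component_def)
    have "x = (\<Sum>s\<in>Poly_Mapping.keys f. smult P (Poly_Mapping.lookup f s) (?e s))"
      using phi_eq_sum[OF assms(1) f(1)] f(2) by simp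
    also have "\<dots> \<in> vs.span (?e ` normal_monomials n)"
      using monomial_in_normal_span[OF assms(1)] ff by (intro vs.span_sum vs.span_scale) auto
    finally show "x \<in> vs.span (?e ` normal_monomials n)" .
  qed
  then have "card (?e ` normal_monomials n) = vs.dim (component P n)"
    using e sub i(2) by (intro vs.basis_card_eq_dim) auto
  then show "vs.dim (component P n) = card (normal_monomials n)" using i(1) by (simp add: card_image)
qed

end

section \<open>Differential algebraicity by counting\<close>

unbundle fps_syntax

text \<open>Stated for families rather than sets, because different exponent vectors may evaluate to
  the same power series; a repetition is then already a relation.\<close>

lemma (in vector_space) linear_relation_exists:
  assumes "finite B" "finite I" "card B < card I" "\<And>i. i \<in> I \<Longrightarrow> v i \<in> span B"
  shows "\<exists>c. (\<exists>i\<in>I. c i \<noteq> 0) \<and> (\<Sum>i\<in>I. scale (c i) (v i)) = 0"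
proof (cases "inj_on v I")
  case True
  have "dependent (v ` I)"
  proof (rule ccontr)
    assume "\<not> dependent (v ` I)"
    then have "card (v ` I) \<le> card B"
      using independent_span_bound[OF assms(1), of "v ` I"] assms(4) by auto
    then show False using True assms(3) by (simp add: card_image)
  qed
  then obtain u where u: "\<exists>x\<in>v ` I. u x \<noteq> 0" "(\<Sum>x\<in>v ` I. scale (u x) x) = 0"
    using dependent_finite[of "v ` I"] assms(2) by auto
  then show ?thesis using True
    by (intro exI[of _ "\<lambda>i. u (v i)"]) (auto simp: sum.reindex)
next
  case False
  then obtain i j where ij: "i \<in> I" "j \<in> I" "i \<noteq> j" "v i = v j" by (auto simp: inj_on_def)
  define c where "c k = (if k = i then 1 else if k = j then - 1 else 0 :: 'a)" for k
  have "(\<Sum>k\<in>I. scale (c k) (v k)) = (\<Sum>k\<in>{i, j}. scale (c k) (v k))"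
    using ij assms(2) by (intro sum.mono_neutral_right) (auto simp: c_def)
  also have "\<dots> = 0" using ij by (simp add: c_def)
  finally show ?thesis using ij by (intro exI[of _ c]) (auto simp: c_def)
qed

section \<open>Finitely generated algebras of power series\<close>

interpretation fps_rat: vector_space "\<lambda>c f. fps_const (c :: rat) * f"
  by unfold_locales (simp_all add: algebra_simps flip: fps_const_add fps_const_mult)

inductive_set fps_alg :: "rat fps set \<Rightarrow> rat fps set" for Y where
  const: "fps_const c \<in> fps_alg Y"
| generator: "y \<in> Y \<Longrightarrow> y \<in> fps_alg Y"
| add: "f \<in> fps_alg Y \<Longrightarrow> g \<in> fps_alg Y \<Longrightarrow> f + g \<in> fps_alg Y"
| mult: "f \<in> fps_alg Y \<Longrightarrow> g \<in> fps_alg Y \<Longrightarrow> f * g \<in> fps_alg Y"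

lemma fps_alg_0: "0 \<in> fps_alg Y" and fps_alg_1: "1 \<in> fps_alg Y"
  using fps_alg.const[of 0] fps_alg.const[of 1] by simp_all

lemma fps_alg_uminus: "f \<in> fps_alg Y \<Longrightarrow> - f \<in> fps_alg Y"
  using fps_alg.mult[OF fps_alg.const[of "-1"], of f] by (simp flip: fps_const_neg)

lemma fps_alg_sum: "(\<And>i. i \<in> I \<Longrightarrow> f i \<in> fps_alg Y) \<Longrightarrow> sum f I \<in> fps_alg Y"
  by (induction I rule: infinite_finite_induct) (auto intro: fps_alg_0 fps_alg.add)

lemma fps_alg_prod: "(\<And>i. i \<in> I \<Longrightarrow> f i \<in> fps_alg Y) \<Longrightarrow> prod f I \<in> fps_alg Y"
  by (induction I rule: infinite_finite_induct) (auto intro: fps_alg_1 fps_alg.mult)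

lemma fps_alg_subset:
  assumes "f \<in> fps_alg Y" "Y \<subseteq> fps_alg Z" shows "f \<in> fps_alg Z"
  using assms by (induction rule: fps_alg.induct) (auto intro: fps_alg.intros)

lemma fps_alg_mono: "f \<in> fps_alg Y \<Longrightarrow> Y \<subseteq> Z \<Longrightarrow> f \<in> fps_alg Z"
  by (rule fps_alg_subset) (auto intro: fps_alg.generator)

text \<open>By the Leibniz rule, derivatives need to be known on generators only. The target
  \<open>Z\<close> may be larger, since the derivatives of generators may involve new
  elements.\<close>

lemma fps_alg_deriv:
  assumes "f \<in> fps_alg Y" "Y \<subseteq> Z" "\<And>y. y \<in> Y \<Longrightarrow> fps_deriv y \<in> fps_alg Z"
  shows "fps_deriv f \<in> fps_alg Z"
  using assms(1)
proof (induction rule: fps_alg.induct)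
  case (const c)
  then show ?case by (simp add: fps_alg_0)
next
  case (mult f g)
  then show ?case using fps_alg_mono[OF _ assms(2)] by (auto intro!: fps_alg.add fps_alg.mult)
qed (auto intro: fps_alg.add assms(3))

text \<open>Each exponent is bounded separately, not the total degree: this gives the simple count
  \<open>(k + 1) ^ card Y\<close>, and bounds add under multiplication.\<close>

definition monomials_upto :: "rat fps set \<Rightarrow> nat \<Rightarrow> rat fps set" where
  "monomials_upto Y k = (\<lambda>e. \<Prod>y\<in>Y. y ^ e y) ` (Y \<rightarrow>\<^sub>E {..k})"

definition bounded_polys :: "rat fps set \<Rightarrow> nat \<Rightarrow> rat fps set" where
  "bounded_polys Y k = fps_rat.span (monomials_upto Y k)"

lemma card_monomials_upto:
  assumes "finite Y"
  shows "finite (monomials_upto Y k)" "card (monomials_upto Y k) \<le> (k + 1) ^ card Y"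
proof -
  have f: "finite (Y \<rightarrow>\<^sub>E {..k})" using assms by (intro finite_PiE) auto
  then show "finite (monomials_upto Y k)" by (simp add: monomials_upto_def)
  have "card (monomials_upto Y k) \<le> card (Y \<rightarrow>\<^sub>E {..k})"
    unfolding monomials_upto_def using f by (rule card_image_le)
  also have "\<dots> = (k + 1) ^ card Y" using assms by (simp add: card_PiE)
  finally show "card (monomials_upto Y k) \<le> (k + 1) ^ card Y" .
qed

lemma monomial_in_monomials_upto:
  assumes "\<And>y. y \<in> Y \<Longrightarrow> e y \<le> k"
  shows "(\<Prod>y\<in>Y. y ^ e y) \<in> monomials_upto Y k"
  unfolding monomials_upto_def
  by (rule image_eqI[of _ _ "restrict e Y"]) (use assms in \<open>auto intro!: prod.cong\<close>)

lemma bounded_polys_mono: "j \<le> k \<Longrightarrow> bounded_polys Y j \<subseteq> bounded_polys Y k"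
  unfolding bounded_polys_def monomials_upto_def
  by (intro fps_rat.span_mono image_mono PiE_mono) auto

lemma bounded_polys_mult:
  assumes "f \<in> bounded_polys Y j" "g \<in> bounded_polys Y k"
  shows "f * g \<in> bounded_polys Y (j + k)"
proof -
  let ?V = "fps_rat.span (monomials_upto Y (j + k))"
  have mono: "a * b \<in> ?V" if a: "a \<in> monomials_upto Y j" and b: "b \<in> monomials_upto Y k" for a b
  proof -
    obtain e e' where e: "a = (\<Prod>y\<in>Y. y ^ e y)" "e \<in> Y \<rightarrow>\<^sub>E {..j}"
      and e': "b = (\<Prod>y\<in>Y. y ^ e' y)" "e' \<in> Y \<rightarrow>\<^sub>E {..k}"
      using a b unfolding monomials_upto_def by blast
    have "(\<Prod>y\<in>Y. y ^ (e y + e' y)) \<in> monomials_upto Y (j + k)"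
      by (rule monomial_in_monomials_upto) (use e(2) e'(2) in \<open>force intro!: add_mono\<close>)
    then show ?thesis
      unfolding e(1) e'(1) prod.distrib[symmetric] power_add[symmetric] by (rule fps_rat.span_base)
  qed
  have right: "a * g \<in> ?V" if a: "a \<in> monomials_upto Y j" for a
    using assms(2) unfolding bounded_polys_def
  proof (induction rule: fps_rat.span_induct_alt)
    case (step c x y)
    have "a * (fps_const c * x + y) = fps_const c * (a * x) + a * y" by (simp add: algebra_simps)
    then show ?case
      using step mono[OF a] by (auto intro!: fps_rat.span_add fps_rat.span_scale)
  qed (simp add: fps_rat.span_zero)
  show ?thesis
    using assms(1) unfolding bounded_polys_def
  proof (induction rule: fps_rat.span_induct_alt)
    case (step c x y)
    have "(fps_const c * x + y) * g = fps_const c * (x * g) + y * g" by (simp add: algebra_simps)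
    then show ?case
      using step right by (auto intro!: fps_rat.span_add fps_rat.span_scale)
  qed (simp add: fps_rat.span_zero)
qed

lemma const_bounded_polys: "fps_const c \<in> bounded_polys Y k"
proof -
  have "1 \<in> monomials_upto Y k" using monomial_in_monomials_upto[of Y "\<lambda>_. 0" k] by simp
  then show ?thesis
    unfolding bounded_polys_def
    using fps_rat.span_scale[OF fps_rat.span_base, of 1 "monomials_upto Y k" c] by simp
qed

lemma bounded_polys_power: "f \<in> bounded_polys Y k \<Longrightarrow> f ^ n \<in> bounded_polys Y (n * k)"
proof (induction n)
  case 0
  then show ?case using const_bounded_polys[of 1 Y 0] by simp
next
  case (Suc n)
  then show ?case using bounded_polys_mult[of f Y k "f ^ n" "n * k"] by simp
qed

lemma bounded_polys_prod:
  assumes "finite I" "\<And>i. i \<in> I \<Longrightarrow> f i \<in> bounded_polys Y k"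
  shows "prod f I \<in> bounded_polys Y (card I * k)"
  using assms
proof (induction I rule: finite_induct)
  case empty
  then show ?case using const_bounded_polys[of 1 Y 0] by simp
next
  case (insert i I)
  then show ?case using bounded_polys_mult[of "f i" Y k "prod f I" "card I * k"] by simp
qed

lemma fps_alg_bounded:
  assumes "finite Y" "f \<in> fps_alg Y" shows "\<exists>k. f \<in> bounded_polys Y k"
  using assms(2)
proof (induction rule: fps_alg.induct)
  case (const c)
  then show ?case using const_bounded_polys by blast
next
  case (generator y)
  have "(\<Prod>z\<in>Y. z ^ (if z = y then 1 else 0)) \<in> monomials_upto Y 1"
    by (rule monomial_in_monomials_upto) simp
  also have "(\<Prod>z\<in>Y. z ^ (if z = y then 1 else 0)) = (\<Prod>z\<in>Y. if z = y then z else 1)"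
    by (rule prod.cong) auto
  also have "\<dots> = y" using generator assms(1) by simp
  finally show ?case unfolding bounded_polys_def by (blast intro: fps_rat.span_base)
next
  case (add f g)
  then obtain j k where "f \<in> bounded_polys Y j" "g \<in> bounded_polys Y k" by blast
  then have "f \<in> bounded_polys Y (max j k)" "g \<in> bounded_polys Y (max j k)"
    using bounded_polys_mono[of j "max j k" Y] bounded_polys_mono[of k "max j k" Y] by auto
  then show ?case unfolding bounded_polys_def by (blast intro: fps_rat.span_add)
next
  case (mult f g)
  then show ?case using bounded_polys_mult by blast
qed

lemma lookup_Abs_exponents:
  fixes a :: "nat \<Rightarrow> nat"
  shows "Poly_Mapping.lookup (Abs_poly_mapping (\<lambda>i. if i < V then a i else 0)) i =
    (if i < V then a i else 0)"
proof -
  have "finite {i. (if i < V then a i else 0) \<noteq> 0}"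
    by (rule finite_subset[of _ "{..<V}"]) auto
  then show ?thesis by (simp add: Abs_poly_mapping_inverse)
qed

text \<open>Transcendence degree by counting: there are more monomials with exponents below \<open>d\<close> in
  \<open>card Y + 2\<close> elements of the algebra than the dimension of the space of polynomials in \<open>Y\<close>
  that contains them, once \<open>d\<close> is large.\<close>

lemma differential_algebraic_if_fps_alg:
  assumes fin: "finite Y" and X: "fps_X \<in> fps_alg Y" and E: "E \<in> fps_alg Y"
    and deriv: "\<And>y. y \<in> Y \<Longrightarrow> fps_deriv y \<in> fps_alg Y"
  shows "differential_algebraic E"
proof -
  define N where "N = card Y"
  \<comment> \<open>Index 0 is z and the indices 1 to N + 1 are the derivatives of orders 0 to N, as
    the definition requires for \<open>n = N\<close>.\<close>
  define V where "V = N + 2"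
  define x where "x = (\<lambda>i::nat. if i = 0 then fps_X else (fps_deriv ^^ (i - 1)) E)"
  have "(fps_deriv ^^ i) E \<in> fps_alg Y" for i
    by (induction i) (auto intro: E fps_alg_deriv[OF _ order_refl deriv])
  then have x: "x i \<in> fps_alg Y" for i using X by (simp add: x_def)
  then have "\<forall>i. \<exists>k. x i \<in> bounded_polys Y k" using fps_alg_bounded[OF fin] by blast
  then obtain K where K: "\<And>i. x i \<in> bounded_polys Y (K i)" by metis
  define D where "D = Max (K ` {..<V})"
  have D: "x i \<in> bounded_polys Y D" if "i < V" for i
  proof (rule subsetD[OF bounded_polys_mono K])
    show "K i \<le> D" unfolding D_def using that by (intro Max_ge) auto
  qed
  \<comment> \<open>The \<open>d ^ V\<close> monomials lie in a space of dimension at most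
    \<open>(V * (d * D) + 1) ^ N\<close>, which is at most \<open>(V * D + 1) ^ N * d ^ N\<close>;
    so \<open>d\<close> only has to exceed the constant factor.\<close>
  define d where "d = (V * D + 1) ^ N + 1"
  have d: "(V * D + 1) ^ N < d" "0 < d" by (simp_all add: d_def)
  define pm where "pm a = Abs_poly_mapping (\<lambda>i. if i < V then a i else 0)" for a :: "nat \<Rightarrow> nat"
  have lookup_pm: "Poly_Mapping.lookup (pm a) i = (if i < V then a i else 0)" for a i
    unfolding pm_def by (rule lookup_Abs_exponents)
  define I where "I = pm ` ({..<V} \<rightarrow>\<^sub>E {..<d})"
  have inj: "inj_on pm ({..<V} \<rightarrow>\<^sub>E {..<d})"
  proof (rule inj_onI)
    fix a b assume ab: "a \<in> {..<V} \<rightarrow>\<^sub>E {..<d}" "b \<in> {..<V} \<rightarrow>\<^sub>E {..<d}" "pm a = pm b"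
    have "a i = b i" if "i < V" for i
      using lookup_pm[of a i] lookup_pm[of b i] ab(3) that by simp
    then show "a = b" using ab by (intro PiE_ext) auto
  qed
  have finI: "finite I" unfolding I_def by (intro finite_imageI finite_PiE) auto
  have cardI: "card I = d ^ V" unfolding I_def using inj by (simp add: card_image card_PiE)
  have lookupI: "Poly_Mapping.lookup a i < d" and keysI: "Poly_Mapping.keys a \<subseteq> {..<V}"
    if "a \<in> I" for a i
    using that lookup_pm d(2) by (auto simp: I_def in_keys_iff split: if_splits)
  define w where "w a = (\<Prod>i\<in>Poly_Mapping.keys a. x i ^ Poly_Mapping.lookup a i)"
    for a :: "nat \<Rightarrow>\<^sub>0 nat"
  have w: "w a \<in> fps_rat.span (monomials_upto Y (V * (d * D)))" if a: "a \<in> I" for a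
  proof -
    have "w a = (\<Prod>i<V. x i ^ Poly_Mapping.lookup a i)"
      unfolding w_def
      by (rule prod.mono_neutral_left) (use keysI[OF a] in \<open>auto simp: in_keys_iff\<close>)
    also have "\<dots> \<in> bounded_polys Y (card {..<V} * (d * D))"
    proof (rule bounded_polys_prod)
      fix i assume i: "i \<in> {..<V}"
      have "x i ^ Poly_Mapping.lookup a i \<in> bounded_polys Y (Poly_Mapping.lookup a i * D)"
        by (rule bounded_polys_power) (use D i in simp)
      moreover have "Poly_Mapping.lookup a i * D \<le> d * D" using lookupI[OF a, of i] by simp
      ultimately show "x i ^ Poly_Mapping.lookup a i \<in> bounded_polys Y (d * D)"
        by (rule subsetD[OF bounded_polys_mono, rotated])
    qed simp
    finally show ?thesis by (simp add: bounded_polys_def)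
  qed
  have "card (monomials_upto Y (V * (d * D))) \<le> (V * (d * D) + 1) ^ N"
    unfolding N_def by (rule card_monomials_upto(2)[OF fin])
  also have "\<dots> \<le> ((V * D + 1) * d) ^ N"
  proof (rule power_mono)
    have "(V * D + 1) * d = V * (d * D) + d" by (simp add: algebra_simps)
    then show "V * (d * D) + 1 \<le> (V * D + 1) * d" using d(2) by linarith
  qed simp
  also have "\<dots> = (V * D + 1) ^ N * d ^ N" by (rule power_mult_distrib)
  also have "\<dots> < d * d ^ N"
    by (rule mult_strict_right_mono[OF d(1)]) (use d(2) in simp)
  also have "\<dots> \<le> d ^ V"
    using power_increasing[of "N + 1" V d] d(2) by (simp add: V_def)
  finally have "card (monomials_upto Y (V * (d * D))) < card I" using cardI by simp
  from fps_rat.linear_relation_exists[where v = w, OF card_monomials_upto(1)[OF fin] finI this] w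
  obtain c where c: "\<exists>a\<in>I. c a \<noteq> 0" "(\<Sum>a\<in>I. fps_const (c a) * w a) = 0"
    by auto
  define \<theta> where "\<theta> = (\<Sum>a\<in>I. Poly_Mapping.single a (c a))"
  have lookup: "Poly_Mapping.lookup \<theta> a = (if a \<in> I then c a else 0)" for a
    unfolding \<theta>_def lookup_sum lookup_single when_def using finI by simp
  have keys: "Poly_Mapping.keys \<theta> = {a \<in> I. c a \<noteq> 0}"
    by (auto simp: in_keys_iff lookup split: if_splits)
  have eval: "mpoly_eval \<theta> x = (\<Sum>a\<in>Poly_Mapping.keys \<theta>. fps_const (Poly_Mapping.lookup \<theta> a) * w a)"
    by (simp add: mpoly_eval_def w_def)
  also have "\<dots> = (\<Sum>a\<in>I. fps_const (c a) * w a)"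
    by (rule sum.mono_neutral_cong_left) (use finI in \<open>auto simp: keys lookup\<close>)
  finally have zero: "mpoly_eval \<theta> x = 0" using c(2) by simp
  \<comment> \<open>Without variables the polynomial would be a nonzero constant, whose value is not
    0.\<close>
  have "mpoly_vars \<theta> \<noteq> {}"
  proof
    assume "mpoly_vars \<theta> = {}"
    then have "Poly_Mapping.keys \<theta> \<subseteq> {0}" by (auto simp: mpoly_vars_def)
    moreover have "Poly_Mapping.keys \<theta> \<noteq> {}" using c(1) keys by auto
    ultimately have k0: "Poly_Mapping.keys \<theta> = {0}" by blast
    then have "mpoly_eval \<theta> x = fps_const (Poly_Mapping.lookup \<theta> 0)"
      by (simp add: mpoly_eval_def)
    moreover have "Poly_Mapping.lookup \<theta> 0 \<noteq> 0" unfolding in_keys_iff[symmetric] k0 by simp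
    ultimately show False using zero by simp
  qed
  moreover have "mpoly_vars \<theta> \<subseteq> {..<N + 2}"
    using keysI keys by (auto simp: mpoly_vars_def V_def)
  ultimately show ?thesis
    unfolding differential_algebraic_def
    by (intro exI[of _ N] exI[of _ \<theta>]) (use zero in \<open>simp add: x_def\<close>)
qed

text \<open>Fractions over the algebra whose denominators have nonzero constant term and hence are
  units among the power series; written without division.\<close>

definition fps_local :: "rat fps set \<Rightarrow> rat fps set" where
  "fps_local Y = {f. \<exists>q\<in>fps_alg Y. q $ 0 \<noteq> 0 \<and> q * f \<in> fps_alg Y}"

lemma fps_alg_local: "f \<in> fps_alg Y \<Longrightarrow> f \<in> fps_local Y"
  unfolding fps_local_def using fps_alg_1 by force

lemma fps_local_add:
  assumes "f \<in> fps_local Y" "g \<in> fps_local Y" shows "f + g \<in> fps_local Y"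
proof -
  obtain p q where p: "p \<in> fps_alg Y" "p $ 0 \<noteq> 0" "p * f \<in> fps_alg Y"
    and q: "q \<in> fps_alg Y" "q $ 0 \<noteq> 0" "q * g \<in> fps_alg Y"
    using assms by (auto simp: fps_local_def)
  have "(p * q) * (f + g) = q * (p * f) + p * (q * g)" by (simp add: algebra_simps)
  then show ?thesis
    unfolding fps_local_def using p q
    by (intro CollectI bexI[of _ "p * q"]) (auto intro: fps_alg.intros)
qed

lemma fps_local_mult:
  assumes "f \<in> fps_local Y" "g \<in> fps_local Y" shows "f * g \<in> fps_local Y"
proof -
  obtain p q where p: "p \<in> fps_alg Y" "p $ 0 \<noteq> 0" "p * f \<in> fps_alg Y"
    and q: "q \<in> fps_alg Y" "q $ 0 \<noteq> 0" "q * g \<in> fps_alg Y"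
    using assms by (auto simp: fps_local_def)
  have "(p * q) * (f * g) = (p * f) * (q * g)" by (simp add: algebra_simps)
  also have "\<dots> \<in> fps_alg Y" by (rule fps_alg.mult[OF p(3) q(3)])
  finally show ?thesis
    unfolding fps_local_def using p q
    by (intro CollectI bexI[of _ "p * q"]) (auto intro: fps_alg.intros)
qed

lemma fps_local_sum: "(\<And>i. i \<in> I \<Longrightarrow> f i \<in> fps_local Y) \<Longrightarrow> sum f I \<in> fps_local Y"
  by (induction I rule: infinite_finite_induct)
    (auto intro: fps_alg_local[OF fps_alg_0] fps_local_add)

lemma fps_local_uminus: "f \<in> fps_local Y \<Longrightarrow> - f \<in> fps_local Y"
  using fps_local_mult[OF fps_alg_local[OF fps_alg_uminus[OF fps_alg_1]], of f Y] by simp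

text \<open>If \<open>p * f\<close> lies in the algebra, it serves as a denominator for the inverse
  of \<open>f\<close>, with numerator \<open>p\<close>.\<close>

lemma fps_local_inverse:
  assumes "f \<in> fps_local Y" "f $ 0 \<noteq> 0" shows "inverse f \<in> fps_local Y"
proof -
  obtain p where p: "p \<in> fps_alg Y" "p $ 0 \<noteq> 0" "p * f \<in> fps_alg Y"
    using assms by (auto simp: fps_local_def)
  have "(p * f) * inverse f = p * (f * inverse f)" by (rule mult.assoc)
  also have "\<dots> = p" using inverse_mult_eq_1'[OF assms(2)] by simp
  finally have "(p * f) * inverse f \<in> fps_alg Y" using p(1) by (simp only:)
  then show ?thesis
    unfolding fps_local_def using p assms(2) by (intro CollectI bexI[of _ "p * f"]) auto
qed

text \<open>Gaussian elimination; the rank function makes the constant part of the matrix strictly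
  triangular, so that every pivot \<open>1 - A p p\<close> has constant term \<open>1\<close>.\<close>

lemma fps_local_linear_system:
  fixes v d :: "'s \<Rightarrow> rat fps" and A :: "'s \<Rightarrow> 's \<Rightarrow> rat fps" and r :: "'s \<Rightarrow> nat"
  assumes "finite S"
    and "\<And>s. s \<in> S \<Longrightarrow> v s = d s + (\<Sum>t\<in>S. A s t * v t)"
    and "\<And>s. s \<in> S \<Longrightarrow> d s \<in> fps_local Y"
    and "\<And>s t. s \<in> S \<Longrightarrow> t \<in> S \<Longrightarrow> A s t \<in> fps_local Y"
    and "\<And>s t. s \<in> S \<Longrightarrow> t \<in> S \<Longrightarrow> A s t $ 0 \<noteq> 0 \<Longrightarrow> r t < r s"
  shows "\<forall>s\<in>S. v s \<in> fps_local Y"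
  using assms
proof (induction S arbitrary: d A rule: finite_induct)
  case (insert p S)
  define q where "q = inverse (1 - A p p)"
  have "A p p $ 0 = 0" using insert.prems(4)[of p p] by auto
  then have q0: "(1 - A p p) $ 0 \<noteq> 0" by simp
  have ql: "q \<in> fps_local Y"
    unfolding q_def
  proof (rule fps_local_inverse[OF _ q0])
    show "1 - A p p \<in> fps_local Y"
      using fps_local_add[OF fps_alg_local[OF fps_alg_1] fps_local_uminus] insert.prems(3) by force
  qed
  have "v p = d p + (A p p * v p + (\<Sum>t\<in>S. A p t * v t))"
    using insert.prems(1)[of p] insert.hyps by simp
  then have "(1 - A p p) * v p = d p + (\<Sum>t\<in>S. A p t * v t)" by (simp add: algebra_simps)
  then have "q * ((1 - A p p) * v p) = q * (d p + (\<Sum>t\<in>S. A p t * v t))" by simp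
  then have vp: "v p = q * (d p + (\<Sum>t\<in>S. A p t * v t))"
    using inverse_mult_eq_1[OF q0] by (simp add: q_def mult.assoc[symmetric])
  have "\<forall>s\<in>S. v s \<in> fps_local Y"
  proof (rule insert.IH)
    fix s assume s: "s \<in> S"
    have "v s = d s + (A s p * v p + (\<Sum>t\<in>S. A s t * v t))"
      using insert.prems(1)[of s] insert.hyps s by simp
    \<comment> \<open>Eliminating the unknown at \<open>p\<close> replaces the matrix by its Schur
      complement.\<close>
    also have "\<dots> = (d s + A s p * q * d p) + (\<Sum>t\<in>S. (A s t + A s p * q * A p t) * v t)"
      by (subst vp) (simp add: algebra_simps sum.distrib sum_distrib_left)
    finally show "v s = (d s + A s p * q * d p) + (\<Sum>t\<in>S. (A s t + A s p * q * A p t) * v t)" .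
    show "d s + A s p * q * d p \<in> fps_local Y"
      using insert.prems(2,3) s ql by (auto intro!: fps_local_add fps_local_mult)
    fix t assume t: "t \<in> S"
    show "A s t + A s p * q * A p t \<in> fps_local Y"
      using insert.prems(3) s t ql by (auto intro!: fps_local_add fps_local_mult)
    assume "(A s t + A s p * q * A p t) $ 0 \<noteq> 0"
    \<comment> \<open>A nonzero constant term in the new matrix comes from the old entry or from a
      detour through \<open>p\<close>, along which the rank drops twice.\<close>
    then have "A s t $ 0 \<noteq> 0 \<or> (A s p $ 0 \<noteq> 0 \<and> A p t $ 0 \<noteq> 0)" by (auto simp: fps_mult_nth)
    then show "r t < r s"
      using insert.prems(4)[of s t] insert.prems(4)[of s p] insert.prems(4)[of p t] s t by auto
  qed
  moreover have "v p \<in> fps_local Y"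
    unfolding vp using calculation insert.prems(2,3) ql
    by (auto intro!: fps_local_add fps_local_mult fps_local_sum)
  ultimately show ?case by simp
qed simp

text \<open>The finitely many elements of \<open>W\<close> have a common denominator
  \<open>q\<close>. Adjoining its inverse brings \<open>W\<close> into the algebra, and the quotient
  rule for 1/q keeps the enlarged algebra closed under differentiation.\<close>

lemma differential_algebraic_if_fps_local:
  assumes fin: "finite Y" "finite W" and W: "W \<subseteq> fps_local Y"
    and X: "fps_X \<in> fps_alg Y" and E: "E \<in> fps_alg Y"
    and deriv: "\<And>y. y \<in> Y \<Longrightarrow> fps_deriv y \<in> fps_alg (Y \<union> W)"
  shows "differential_algebraic E"
proof -
  have "\<forall>w\<in>W. \<exists>q\<in>fps_alg Y. q $ 0 \<noteq> 0 \<and> q * w \<in> fps_alg Y" using W by (auto simp: fps_local_def)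
  then obtain Q where Q: "\<And>w. w \<in> W \<Longrightarrow> Q w \<in> fps_alg Y \<and> Q w $ 0 \<noteq> 0 \<and> Q w * w \<in> fps_alg Y"
    by metis
  define q where "q = prod Q W"
  have qa: "q \<in> fps_alg Y" unfolding q_def using Q by (intro fps_alg_prod) auto
  have "\<forall>w\<in>W. Q w $ 0 \<noteq> 0" using Q by blast
  then have q0: "q $ 0 \<noteq> 0" unfolding q_def by (induction rule: finite_induct[OF fin(2)]) auto
  have qw: "q * w \<in> fps_alg Y" if w: "w \<in> W" for w
  proof -
    have "q * w = prod Q (W - {w}) * (Q w * w)"
      unfolding q_def using prod.remove[OF fin(2) w, of Q] by (simp add: algebra_simps)
    also have "\<dots> \<in> fps_alg Y"
      by (rule fps_alg.mult) (use Q w in \<open>auto intro: fps_alg_prod\<close>)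
    finally show ?thesis .
  qed
  let ?Z = "insert (inverse q) Y"
  have YZ: "f \<in> fps_alg ?Z" if "f \<in> fps_alg Y" for f using fps_alg_mono[OF that] by blast
  have iq: "inverse q \<in> fps_alg ?Z" by (rule fps_alg.generator) simp
  have w: "w \<in> fps_alg ?Z" if "w \<in> W" for w
  proof -
    have "inverse q * (q * w) = (inverse q * q) * w" by (rule mult.assoc[symmetric])
    also have "\<dots> = w" using inverse_mult_eq_1[OF q0] by simp
    finally show ?thesis using fps_alg.mult[OF iq YZ[OF qw[OF that]]] by (simp only:)
  qed
  have dY: "fps_deriv y \<in> fps_alg ?Z" if "y \<in> Y" for y
    using fps_alg_subset[OF deriv[OF that], of ?Z] w by (auto intro: fps_alg.generator)
  have "fps_deriv q \<in> fps_alg ?Z" by (rule fps_alg_deriv[OF qa _ dY]) auto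
  moreover have "fps_deriv (inverse q) = - (fps_deriv q * (inverse q * inverse q))"
    using fps_inverse_deriv[OF q0] by (simp add: power2_eq_square)
  ultimately have dq: "fps_deriv (inverse q) \<in> fps_alg ?Z"
    using iq by (auto intro!: fps_alg_uminus fps_alg.mult)
  show ?thesis
    by (rule differential_algebraic_if_fps_alg[of ?Z]) (use fin X E YZ dY dq in auto)
qed

section \<open>Generating series of tree automata\<close>

text \<open>Turns a sum over sets of labels into the binomial convolution that corresponds to
  multiplying exponential series.\<close>

lemma sum_Pow_card:
  fixes g :: "nat \<Rightarrow> nat"
  assumes "finite A"
  shows "(\<Sum>Z\<in>Pow A. g (card Z)) = (\<Sum>k\<le>card A. (card A choose k) * g k)"
proof -
  have "(\<Sum>Z\<in>Pow A. g (card Z)) = (\<Sum>k\<in>{..card A}. \<Sum>Z\<in>{Z \<in> Pow A. card Z = k}. g (card Z))"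
    by (rule sum.group[symmetric]) (use assms in \<open>auto intro: card_mono\<close>)
  also have "\<dots> = (\<Sum>k\<le>card A. (card A choose k) * g k)"
  proof (rule sum.cong[OF refl])
    fix k
    have "(\<Sum>Z\<in>{Z \<in> Pow A. card Z = k}. g (card Z)) = card {Z. Z \<subseteq> A \<and> card Z = k} * g k"
      by simp
    then show "(\<Sum>Z\<in>{Z \<in> Pow A. card Z = k}. g (card Z)) = (card A choose k) * g k"
      using n_subsets[OF assms] by simp
  qed
  finally show ?thesis .
qed

lemma map_nth_smallest_standardize:
  "map_ltree id (nth_smallest (set (leaves t))) (standardize t) = t"
  unfolding standardize_def map_ltree_eq_subst subst_leaves_subst
  by (rule subst_leaves_Leaf) (simp add: nth_smallest_rank_in)

text \<open>\<open>Q\<close> holds the permitted states, not all states of the automaton. Unary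
  transitions inside \<open>Q\<close> raise the rank, so none of them form a cycle.\<close>

locale tree_automaton =
  fixes U :: "nat \<Rightarrow> 'u set" and \<delta> :: "'u \<Rightarrow> 'q list \<Rightarrow> 'q" and q0 :: 'q and Q :: "'q set"
    and r :: "'q \<Rightarrow> nat"
  assumes finite_ops: "finite {(n, u). n \<ge> 1 \<and> u \<in> U n}"
    and finite_states: "finite Q"
    and unary_rank: "\<lbrakk>u \<in> U 1; q \<in> Q; \<delta> u [q] \<in> Q\<rbrakk> \<Longrightarrow> r q < r (\<delta> u [q])"
begin

fun state :: "('u, 'l) ltree \<Rightarrow> 'q" where
  "state (Leaf l) = q0"
| "state (Vertex u ts) = \<delta> u (map state ts)"

text \<open>The state is tested at every vertex and leaf, not only at the root: a forbidden pattern
  may occur anywhere.\<close>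

fun accepted :: "('u, 'l) ltree \<Rightarrow> bool" where
  "accepted (Leaf l) \<longleftrightarrow> q0 \<in> Q"
| "accepted (Vertex u ts) \<longleftrightarrow> \<delta> u (map state ts) \<in> Q \<and> (\<forall>t\<in>set ts. accepted t)"

lemma accepted_state: "accepted t \<Longrightarrow> state t \<in> Q"
  by (cases t) auto

lemma state_map [simp]: "state (map_ltree id f t) = state t"
  by (induction t) (auto simp: comp_def id_def cong: map_cong)

lemma accepted_map [simp]: "accepted (map_ltree id f t) = accepted t"
  using state_map[of f] by (induction t) (auto simp: comp_def id_def cong: map_cong)

definition trees :: "'q \<Rightarrow> nat set \<Rightarrow> ('u, nat) ltree set" where
  "trees q X = {t. shuffle_tree U t \<and> distinct (leaves t) \<and> set (leaves t) = X \<and>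
     accepted t \<and> state t = q}"

text \<open>The sequences that may stand above a vertex of a shuffle tree, increasing minima being
  the shuffle condition there.\<close>

definition forests :: "'q list \<Rightarrow> nat set \<Rightarrow> ('u, nat) ltree list set" where
  "forests qs X = {ts. (\<forall>t\<in>set ts. shuffle_tree U t \<and> accepted t) \<and> map state ts = qs \<and>
     sorted_wrt (<) (map min_leaf ts) \<and> distinct (concat (map leaves ts)) \<and>
     set (concat (map leaves ts)) = X}"

text \<open>States and acceptance ignore leaf labels, so trees over any label set correspond to
  trees over an initial segment.\<close>

lemma trees_standardize:
  assumes "finite X"
  shows "bij_betw standardize (trees q X) (trees q {1..card X})"
proof (rule bij_betw_byWitness[where f' = "map_ltree id (nth_smallest X)"])
  have std: "standardize t \<in> shuffle_monomials U (card X)" if "t \<in> trees q X" for t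
    using that standardize_shuffle_monomial[of U t] by (auto simp: trees_def distinct_card)
  show "\<forall>t\<in>trees q X. map_ltree id (nth_smallest X) (standardize t) = t"
    using map_nth_smallest_standardize by (auto simp: trees_def)
  have mon: "t \<in> shuffle_monomials U (card X)" if "t \<in> trees q {1..card X}" for t
    using that by (auto simp: trees_def shuffle_monomials_def)
  show "\<forall>t\<in>trees q {1..card X}. standardize (map_ltree id (nth_smallest X) t) = t"
    using map_nth_smallest_monomial(4)[OF mon assms refl] by blast
  show "standardize ` trees q X \<subseteq> trees q {1..card X}"
    using std by (auto simp: trees_def shuffle_monomials_def standardize_def)
  show "map_ltree id (nth_smallest X) ` trees q {1..card X} \<subseteq> trees q X"
  proof safe
    fix t assume t: "t \<in> trees q {1..card X}"
    show "map_ltree id (nth_smallest X) t \<in> trees q X"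
      using map_nth_smallest_monomial(1-3)[OF mon[OF t] assms refl] t
      by (simp add: trees_def del: leaves_map_ltree)
  qed
qed

lemma trees_empty: "trees q {} = {}"
  using shuffle_tree_leaves_nonempty by (auto simp: trees_def)

lemma forests_Nil: "forests [] X = (if X = {} then {[]} else {})"
  by (auto simp: forests_def)

lemma forests_Cons_empty: "forests (q # qs) {} = {}"
  using shuffle_tree_leaves_nonempty[of U] by (fastforce simp: forests_def)

text \<open>Increasing minima force the smallest label into the first tree. Conversely, a first tree
  containing it precedes all others automatically, so the rest of its label set is
  arbitrary.\<close>

lemma forests_Cons:
  assumes "finite X" "X \<noteq> {}"
  shows "forests (q # qs) X =
    (\<Union>Y\<in>{Y. Y \<subseteq> X \<and> Min X \<in> Y}. (\<lambda>(t, ts). t # ts) ` (trees q Y \<times> forests qs (X - Y)))"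
proof (intro equalityI subsetI)
  fix us assume us: "us \<in> forests (q # qs) X"
  then obtain t ts where ts: "us = t # ts" "state t = q" "map state ts = qs" by (auto simp: forests_def)
  have d: "distinct (leaves t)" "distinct (concat (map leaves ts))"
    "set (leaves t) \<inter> set (concat (map leaves ts)) = {}"
    and X: "set (leaves t) \<union> set (concat (map leaves ts)) = X"
    and sh: "shuffle_tree U t" "accepted t" "\<forall>t\<in>set ts. shuffle_tree U t \<and> accepted t"
    and so: "sorted_wrt (<) (map min_leaf ts)" "\<forall>t'\<in>set ts. min_leaf t < min_leaf t'"
    using us by (auto simp: forests_def ts(1))
  have "Min X \<in> set (leaves t)"
  proof (rule ccontr)
    assume "Min X \<notin> set (leaves t)"
    then obtain t' where t': "t' \<in> set ts" "Min X \<in> set (leaves t')"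
      using X Min_in[OF assms] by auto
    have "min_leaf t' \<le> Min X" using t'(2) by (simp add: min_leaf_def)
    moreover have "Min X \<le> min_leaf t"
      using min_leaf_in[OF shuffle_tree_leaves_nonempty[OF sh(1)]] X assms(1) by (intro Min_le) auto
    ultimately show False using so(2) t'(1) by fastforce
  qed
  moreover have "t \<in> trees q (set (leaves t))" using d sh ts by (simp add: trees_def)
  moreover have "ts \<in> forests qs (X - set (leaves t))"
    using d sh so ts X by (auto simp: forests_def)
  ultimately show "us \<in> (\<Union>Y\<in>{Y. Y \<subseteq> X \<and> Min X \<in> Y}.
      (\<lambda>(t, ts). t # ts) ` (trees q Y \<times> forests qs (X - Y)))"
    using X ts(1) by (intro UN_I[of "set (leaves t)"]) auto
next
  fix us assume "us \<in> (\<Union>Y\<in>{Y. Y \<subseteq> X \<and> Min X \<in> Y}.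
      (\<lambda>(t, ts). t # ts) ` (trees q Y \<times> forests qs (X - Y)))"
  then obtain Y t ts where Y: "Y \<subseteq> X" "Min X \<in> Y" and us: "us = t # ts"
    and t: "t \<in> trees q Y" and ts: "ts \<in> forests qs (X - Y)" by auto
  have min: "min_leaf t = Min X"
    unfolding min_leaf_def
  proof (rule Min_eqI)
    show "Min X \<in> set (leaves t)" using t Y(2) by (simp add: trees_def)
    show "Min X \<le> y" if "y \<in> set (leaves t)" for y
      using that t Y(1) assms(1) by (auto simp: trees_def)
  qed simp
  have "min_leaf t < min_leaf t'" if t': "t' \<in> set ts" for t'
  proof -
    have "min_leaf t' \<in> set (leaves t')"
      using t' ts by (intro min_leaf_in shuffle_tree_leaves_nonempty) (auto simp: forests_def)
    then have "min_leaf t' \<in> X - Y" using t' ts by (auto simp: forests_def)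
    then have "Min X \<le> min_leaf t'" "Min X \<noteq> min_leaf t'" using assms(1) Y(2) by auto
    then show ?thesis using min by simp
  qed
  then show "us \<in> forests (q # qs) X"
    using t ts Y(1) by (auto simp: forests_def trees_def us)
qed

section \<open>Numbers of trees and forests\<close>

definition num_trees :: "'q \<Rightarrow> nat \<Rightarrow> nat" where
  "num_trees q n = card (trees q {1..n})"

text \<open>In the recursion, \<open>k\<close> counts the labels of the first tree besides the
  smallest one, which is not chosen; hence \<open>m choose k\<close> for \<open>Suc m\<close>
  labels.\<close>

fun num_forests :: "'q list \<Rightarrow> nat \<Rightarrow> nat" where
  "num_forests [] n = (if n = 0 then 1 else 0)"
| "num_forests (q # qs) 0 = 0"
| "num_forests (q # qs) (Suc m) =
     (\<Sum>k\<le>m. (m choose k) * (num_trees q (Suc k) * num_forests qs (m - k)))"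

context
  assumes finite_accepted: "\<And>n. n \<ge> 1 \<Longrightarrow> finite {t \<in> shuffle_monomials U n. accepted t}"
begin

text \<open>Needed because \<open>card\<close> is 0 on infinite sets, where the counting identities
  would lose their meaning.\<close>

lemma finite_trees: assumes "finite X" shows "finite (trees q X)"
proof (cases "X = {}")
  case False
  then have "finite {t \<in> shuffle_monomials U (card X). accepted t}"
    using assms finite_accepted by (simp add: Suc_le_eq card_gt_0_iff)
  then have "finite (trees q {1..card X})"
    by (rule finite_subset[rotated]) (auto simp: trees_def shuffle_monomials_def)
  then show ?thesis using bij_betw_finite[OF trees_standardize[OF assms]] by blast
qed (simp add: trees_empty)

lemma card_trees: "finite X \<Longrightarrow> card (trees q X) = num_trees q (card X)"
  unfolding num_trees_def using bij_betw_same_card[OF trees_standardize] .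

lemma card_forests:
  "finite X \<Longrightarrow> finite (forests qs X) \<and> card (forests qs X) = num_forests qs (card X)"
proof (induction qs arbitrary: X)
  case Nil
  then show ?case by (simp add: forests_Nil)
next
  case (Cons q qs)
  show ?case
  proof (cases "X = {}")
    case False
    define m where "m = card X - 1"
    have m: "card X = Suc m" using False Cons.prems by (simp add: m_def card_gt_0_iff)
    let ?Ys = "{Y. Y \<subseteq> X \<and> Min X \<in> Y}"
    let ?A = "\<lambda>Y. (\<lambda>(t, ts). t # ts) ` (trees q Y \<times> forests qs (X - Y))"
    have finY: "finite Y" if "Y \<subseteq> X" for Y using that Cons.prems finite_subset by blast
    have finYs: "finite ?Ys" using Cons.prems by simp
    have finA: "\<forall>Y\<in>?Ys. finite (?A Y)" using finY finite_trees Cons.IH Cons.prems by auto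
    \<comment> \<open>The set \<open>Y\<close> is recovered as the leaf set of the first
      tree.\<close>
    have "disjoint_family_on ?A ?Ys"
      by (auto simp: disjoint_family_on_def trees_def)
    then have disj: "\<forall>Y\<in>?Ys. \<forall>Y'\<in>?Ys. Y \<noteq> Y' \<longrightarrow> ?A Y \<inter> ?A Y' = {}"
      by (auto simp: disjoint_family_on_def)
    have X': "finite (X - {Min X})" "card (X - {Min X}) = m"
      using Cons.prems False m by (simp_all add: card_Diff_singleton)
    have "card (forests (q # qs) X) = (\<Sum>Y\<in>?Ys. card (?A Y))"
      unfolding forests_Cons[OF Cons.prems False]
      by (rule card_UN_disjoint[OF finYs finA disj])
    also have "\<dots> = (\<Sum>Y\<in>?Ys. num_trees q (card Y) * num_forests qs (card X - card Y))"
    proof (rule sum.cong[OF refl])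
      fix Y assume Y: "Y \<in> ?Ys"
      have "inj_on (\<lambda>(t, ts). t # ts) (trees q Y \<times> forests qs (X - Y))" by (auto simp: inj_on_def)
      then have "card (?A Y) = card (trees q Y) * card (forests qs (X - Y))"
        by (simp add: card_image card_cartesian_product)
      also have "card (forests qs (X - Y)) = num_forests qs (card (X - Y))"
        using Cons.IH[of "X - Y"] Cons.prems by simp
      also have "card (X - Y) = card X - card Y" using Y finY by (intro card_Diff_subset) auto
      also have "card (trees q Y) = num_trees q (card Y)" using Y finY by (intro card_trees) auto
      finally show "card (?A Y) = num_trees q (card Y) * num_forests qs (card X - card Y)" .
    qed
    \<comment> \<open>Removing the obligatory smallest label leaves an arbitrary subset of the other
      \<open>m\<close> labels.\<close>
    also have "\<dots> = (\<Sum>Z\<in>Pow (X - {Min X}). num_trees q (Suc (card Z)) * num_forests qs (m - card Z))"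
    proof (rule sum.reindex_bij_witness[of _ "insert (Min X)" "\<lambda>Y. Y - {Min X}"])
      fix Y assume Y: "Y \<in> ?Ys"
      then have "card Y = Suc (card (Y - {Min X}))" using finY by (intro card.remove) auto
      then show "num_trees q (Suc (card (Y - {Min X}))) * num_forests qs (m - card (Y - {Min X})) =
          num_trees q (card Y) * num_forests qs (card X - card Y)"
        using m by simp
    qed (use Min_in[OF Cons.prems False] in auto)
    also have "\<dots> = num_forests (q # qs) (Suc m)"
      using sum_Pow_card[OF X'(1), of "\<lambda>k. num_trees q (Suc k) * num_forests qs (m - k)"] X'(2)
      by simp
    finally have "card (forests (q # qs) X) = num_forests (q # qs) (card X)" using m by simp
    moreover have "finite (forests (q # qs) X)"
      unfolding forests_Cons[OF Cons.prems False] using finYs finA by blast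
    ultimately show ?thesis by simp
  qed (simp add: forests_Cons_empty)
qed

definition transitions :: "'q \<Rightarrow> ('u \<times> 'q list) set" where
  "transitions q = {(u, qs). qs \<noteq> [] \<and> set qs \<subseteq> Q \<and> u \<in> U (length qs) \<and> \<delta> u qs = q}"

text \<open>The outer \<open>Suc\<close> keeps the bound positive even without operations, so that
  words of length one are always within it; the series of all accepted trees is built from
  these.\<close>

definition max_arity :: nat where
  "max_arity = Suc (Max (insert 0 (fst ` {(n, u). n \<ge> 1 \<and> u \<in> U n})))"

lemma arity_le_max: "n \<ge> 1 \<Longrightarrow> u \<in> U n \<Longrightarrow> n \<le> max_arity"
  unfolding max_arity_def using finite_ops by (intro le_SucI Max_ge) force+

lemma finite_transitions: "finite (transitions q)"
proof (rule finite_subset)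
  show "transitions q \<subseteq> snd ` {(n, u). n \<ge> 1 \<and> u \<in> U n} \<times> {qs. set qs \<subseteq> Q \<and> length qs \<le> max_arity}"
  proof
    fix p assume "p \<in> transitions q"
    then obtain u qs where p: "p = (u, qs)" "qs \<noteq> []" "set qs \<subseteq> Q" "u \<in> U (length qs)"
      by (auto simp: transitions_def)
    then have "length qs \<ge> 1" by (simp add: Suc_le_eq)
    then have "length qs \<le> max_arity" "(length qs, u) \<in> {(n, u). n \<ge> 1 \<and> u \<in> U n}"
      using arity_le_max p(4) by auto
    then show "p \<in> snd ` {(n, u). n \<ge> 1 \<and> u \<in> U n} \<times> {qs. set qs \<subseteq> Q \<and> length qs \<le> max_arity}"
      using p by force
  qed
  show "finite (snd ` {(n, u). n \<ge> 1 \<and> u \<in> U n} \<times> {qs. set qs \<subseteq> Q \<and> length qs \<le> max_arity})"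
    using finite_ops finite_lists_length_le[OF finite_states] by blast
qed

text \<open>A tree is a single leaf or its root with a forest. Acceptance puts the states of the
  children into \<open>Q\<close>, so they form a transition.\<close>

lemma trees_decomposition:
  assumes "q \<in> Q"
  shows "trees q X = (if q = q0 then {Leaf l |l. X = {l}} else {}) \<union>
    (\<Union>(u, qs)\<in>transitions q. Vertex u ` forests qs X)"
proof (intro equalityI subsetI)
  fix t assume t: "t \<in> trees q X"
  show "t \<in> (if q = q0 then {Leaf l |l. X = {l}} else {}) \<union>
    (\<Union>(u, qs)\<in>transitions q. Vertex u ` forests qs X)"
  proof (cases t)
    case (Leaf l)
    then show ?thesis using t by (auto simp: trees_def)
  next
    case (Vertex u ts)
    then have "(u, map state ts) \<in> transitions q" "ts \<in> forests (map state ts) X"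
      using t accepted_state by (auto simp: trees_def transitions_def forests_def)
    then show ?thesis using Vertex by blast
  qed
next
  fix t assume "t \<in> (if q = q0 then {Leaf l |l. X = {l}} else {}) \<union>
    (\<Union>(u, qs)\<in>transitions q. Vertex u ` forests qs X)"
  then consider l where "q = q0" "X = {l}" "t = Leaf l"
    | u qs ts where "(u, qs) \<in> transitions q" "ts \<in> forests qs X" "t = Vertex u ts"
    by (auto split: if_splits)
  then show "t \<in> trees q X"
  proof cases
    case 1
    then show ?thesis using assms by (simp add: trees_def)
  next
    case (2 u qs ts)
    have "map state ts = qs" using 2(2) by (simp add: forests_def)
    moreover from this have "length ts = length qs" by (metis length_map)
    ultimately show ?thesis
      using 2 assms by (auto simp: trees_def transitions_def forests_def)
  qed
qed

lemma num_trees_eq: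
  assumes "q \<in> Q"
  shows "num_trees q n = (if q = q0 \<and> n = 1 then 1 else 0) + (\<Sum>(u, qs)\<in>transitions q. num_forests qs n)"
proof -
  let ?L = "if q = q0 then {Leaf l |l. {1..n} = {l}} else {} :: ('u, nat) ltree set"
  let ?A = "\<lambda>(u, qs). Vertex u ` forests qs {1..n}"
  have "{1..n} = {l} \<longleftrightarrow> n = 1 \<and> l = 1" for l by auto
  then have L: "?L = (if q = q0 \<and> n = 1 then {Leaf 1} else {})" by auto
  have finA: "\<forall>p\<in>transitions q. finite (?A p)" using card_forests[of "{1..n}"] by auto
  have disj: "\<forall>p\<in>transitions q. \<forall>p'\<in>transitions q. p \<noteq> p' \<longrightarrow> ?A p \<inter> ?A p' = {}"
    by (auto simp: forests_def)
  have "card (\<Union>p\<in>transitions q. ?A p) = (\<Sum>p\<in>transitions q. card (?A p))"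
    by (rule card_UN_disjoint[OF finite_transitions finA disj])
  also have "\<dots> = (\<Sum>(u, qs)\<in>transitions q. num_forests qs n)"
    using card_forests[of "{1..n}"] by (intro sum.cong) (auto simp: card_image inj_on_def)
  finally have card_A: "card (\<Union>p\<in>transitions q. ?A p) = (\<Sum>(u, qs)\<in>transitions q. num_forests qs n)" .
  have "num_trees q n = card (?L \<union> (\<Union>p\<in>transitions q. ?A p))"
    unfolding num_trees_def trees_decomposition[OF assms] ..
  also have "\<dots> = card ?L + card (\<Union>p\<in>transitions q. ?A p)"
    unfolding L using finite_transitions finA by (intro card_Un_disjoint) auto
  finally show ?thesis unfolding L card_A by simp
qed

section \<open>Exponential series and their differential equations\<close>

definition tree_series :: "'q \<Rightarrow> rat fps" where
  "tree_series q = Abs_fps (\<lambda>n. of_nat (num_trees q n) / fact n)"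

definition forest_series :: "'q list \<Rightarrow> rat fps" where
  "forest_series qs = Abs_fps (\<lambda>n. of_nat (num_forests qs n) / fact n)"

lemma forest_series_Nil: "forest_series [] = 1"
  by (rule fps_ext) (simp add: forest_series_def)

lemma forest_series_nth_0: "forest_series qs $ 0 = (if qs = [] then 1 else 0)"
  by (cases qs) (simp_all add: forest_series_def)

text \<open>The smallest label lies in the first tree; removing it is differentiation.\<close>

lemma deriv_forest_series_Cons:
  "fps_deriv (forest_series (q # qs)) = fps_deriv (tree_series q) * forest_series qs"
proof (rule fps_ext)
  fix n
  have "fps_deriv (forest_series (q # qs)) $ n = of_nat (num_forests (q # qs) (Suc n)) / fact n"
    by (simp add: forest_series_def field_simps del: num_forests.simps of_nat_Suc)
  also have "\<dots> = (\<Sum>k\<le>n. (of_nat (n choose k) / fact n) *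
      (of_nat (num_trees q (Suc k)) * of_nat (num_forests qs (n - k))))"
    by (simp add: sum_divide_distrib)
  also have "\<dots> = (\<Sum>k\<le>n. (of_nat (num_trees q (Suc k)) / fact k) *
      (of_nat (num_forests qs (n - k)) / fact (n - k)))"
    by (intro sum.cong) (simp_all add: binomial_fact field_simps)
  also have "\<dots> = (fps_deriv (tree_series q) * forest_series qs) $ n"
    unfolding fps_mult_nth atLeast0AtMost
    by (intro sum.cong) (simp_all add: tree_series_def forest_series_def field_simps del: of_nat_Suc)
  finally show "fps_deriv (forest_series (q # qs)) $ n =
    (fps_deriv (tree_series q) * forest_series qs) $ n" .
qed

lemma num_trees_0: "num_trees q 0 = 0"
  by (simp add: num_trees_def trees_empty)

text \<open>Places the series of trees among the forest series, which serve as generators of the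
  algebra.\<close>

lemma forest_series_singleton: "forest_series [q] = tree_series q"
proof (rule fps_ext)
  fix n
  have "num_forests [q] n = num_trees q n"
  proof (cases n)
    case (Suc m)
    have "num_forests [q] (Suc m) = (\<Sum>k\<le>m. if k = m then num_trees q (Suc k) else 0)"
      unfolding num_forests.simps by (rule sum.cong) auto
    then show ?thesis using Suc by simp
  qed (simp add: num_trees_0)
  then show "forest_series [q] $ n = tree_series q $ n"
    by (simp add: forest_series_def tree_series_def)
qed

lemma tree_series_eq:
  assumes "q \<in> Q"
  shows "tree_series q = (if q = q0 then fps_X else 0) + (\<Sum>(u, qs)\<in>transitions q. forest_series qs)"
proof (rule fps_ext)
  fix n
  have "(\<Sum>(u, qs)\<in>transitions q. forest_series qs) $ n =
      (\<Sum>(u, qs)\<in>transitions q. of_nat (num_forests qs n) / fact n)"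
    by (simp add: fps_sum_nth forest_series_def case_prod_unfold)
  then show "tree_series q $ n =
      ((if q = q0 then fps_X else 0) + (\<Sum>(u, qs)\<in>transitions q. forest_series qs)) $ n"
    by (simp add: tree_series_def num_trees_eq[OF assms] add_divide_distrib sum_divide_distrib
        case_prod_unfold)
qed

text \<open>Differentiating a forest series produces the derivative for its first state only, so the
  transitions are grouped by that state; the remaining forests are the coefficients.\<close>

lemma deriv_tree_series_system:
  assumes "q \<in> Q"
  shows "fps_deriv (tree_series q) = (if q = q0 then 1 else 0) +
    (\<Sum>p\<in>Q. (\<Sum>(u, qs)\<in>{(u, qs) \<in> transitions q. hd qs = p}. forest_series (tl qs)) *
      fps_deriv (tree_series p))"
proof -
  have sub: "(\<lambda>(u, qs). hd qs) ` transitions q \<subseteq> Q" by (auto simp: transitions_def)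
  have "fps_deriv (\<Sum>(u, qs)\<in>transitions q. forest_series qs) =
      (\<Sum>(u, qs)\<in>transitions q. fps_deriv (forest_series qs))"
    by (simp add: fps_deriv_sum case_prod_unfold)
  also have "\<dots> = (\<Sum>(u, qs)\<in>transitions q. forest_series (tl qs) * fps_deriv (tree_series (hd qs)))"
  proof (rule sum.cong[OF refl], clarify)
    fix u qs assume "(u, qs) \<in> transitions q"
    then have "qs = hd qs # tl qs" by (simp add: transitions_def)
    then show "fps_deriv (forest_series qs) = forest_series (tl qs) * fps_deriv (tree_series (hd qs))"
      by (metis deriv_forest_series_Cons mult.commute)
  qed
  also have "\<dots> = (\<Sum>p\<in>Q. \<Sum>(u, qs)\<in>{x \<in> transitions q. (\<lambda>(u, qs). hd qs) x = p}.
      forest_series (tl qs) * fps_deriv (tree_series (hd qs)))"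
    by (rule sum.group[OF finite_transitions finite_states sub, symmetric])
  also have "\<dots> = (\<Sum>p\<in>Q. (\<Sum>(u, qs)\<in>{(u, qs) \<in> transitions q. hd qs = p}. forest_series (tl qs)) *
      fps_deriv (tree_series p))"
    unfolding sum_distrib_right by (intro sum.cong refl) auto
  finally show ?thesis
    by (subst tree_series_eq[OF assms]) simp
qed

theorem differential_algebraic_accepted:
  "differential_algebraic
    (Abs_fps (\<lambda>n. if n = 0 then 0 else of_nat (card {t \<in> shuffle_monomials U n. accepted t}) / fact n))"
    (is "differential_algebraic ?E")
proof -
  \<comment> \<open>Finitely many words, containing the children states of every transition and
    closed under passing to tails, as differentiation requires.\<close>
  define L where "L = {qs. set qs \<subseteq> Q \<and> length qs \<le> max_arity}"
  define Y where "Y = insert fps_X (forest_series ` L)"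
  define W where "W = (\<lambda>q. fps_deriv (tree_series q)) ` Q"
  define A where "A q p = (\<Sum>(u, qs)\<in>{(u, qs) \<in> transitions q. hd qs = p}. forest_series (tl qs))"
    for q p
  have fs: "forest_series qs \<in> fps_alg Y" if "qs \<in> L" for qs
    using that by (auto simp: Y_def intro: fps_alg.generator)
  have "finite L" unfolding L_def by (rule finite_lists_length_le[OF finite_states])
  then have finY: "finite Y" by (simp add: Y_def)
  have finW: "finite W" using finite_states by (simp add: W_def)
  have A_alg: "A q p \<in> fps_alg Y" for q p
    unfolding A_def
  proof (rule fps_alg_sum, clarify)
    fix u qs assume "(u, qs) \<in> transitions q"
    then have "qs \<noteq> []" "set qs \<subseteq> Q" "length qs \<le> max_arity"
      using arity_le_max[of "length qs" u] by (auto simp: transitions_def Suc_le_eq)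
    then show "forest_series (tl qs) \<in> fps_alg Y"
      by (intro fs) (auto simp: L_def dest: list.set_sel(2))
  qed
  have "\<forall>q\<in>Q. fps_deriv (tree_series q) \<in> fps_local Y"
  proof (rule fps_local_linear_system[where A = A and r = r and d = "\<lambda>q. if q = q0 then 1 else 0"])
    show "fps_deriv (tree_series q) =
        (if q = q0 then 1 else 0) + (\<Sum>p\<in>Q. A q p * fps_deriv (tree_series p))" if "q \<in> Q" for q
      using deriv_tree_series_system[OF that] by (simp add: A_def)
    show "(if q = q0 then 1 else 0) \<in> fps_local Y" for q
      using fps_alg_0 fps_alg_1 by (auto intro: fps_alg_local)
    show "A q p \<in> fps_local Y" for q p using A_alg fps_alg_local by blast
    fix q p assume q: "q \<in> Q" and p: "p \<in> Q" and "A q p $ 0 \<noteq> 0"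
    then have "(\<Sum>x\<in>{(u, qs) \<in> transitions q. hd qs = p}. forest_series (tl (snd x)) $ 0) \<noteq> 0"
      by (simp add: A_def fps_sum_nth case_prod_unfold)
    then obtain x where "x \<in> {(u, qs) \<in> transitions q. hd qs = p}" "forest_series (tl (snd x)) $ 0 \<noteq> 0"
      by (rule sum.not_neutral_contains_not_neutral)
    \<comment> \<open>Only the empty forest has a nonzero constant term, so the transition is unary
      and raises the rank.\<close>
    then obtain u qs where u: "(u, qs) \<in> transitions q" "hd qs = p" "tl qs = []"
      by (auto simp: forest_series_nth_0 split: if_splits)
    then have "qs = [p]" by (cases qs) (auto simp: transitions_def)
    then show "r p < r q" using u(1) unary_rank[of u p] q p by (auto simp: transitions_def)
  qed (rule finite_states)
  then have W: "W \<subseteq> fps_local Y" by (auto simp: W_def)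
  \<comment> \<open>Every accepted tree has exactly one state, and it lies in \<open>Q\<close>; in
    arity 0 both sides vanish.\<close>
  have E: "?E = (\<Sum>q\<in>Q. forest_series [q])"
  proof (rule fps_ext)
    fix n
    have "n \<noteq> 0 \<Longrightarrow> card {t \<in> shuffle_monomials U n. accepted t} = (\<Sum>q\<in>Q. num_trees q n)"
    proof -
      have "{t \<in> shuffle_monomials U n. accepted t} = (\<Union>q\<in>Q. trees q {1..n})"
        using accepted_state by (auto simp: trees_def shuffle_monomials_def)
      moreover have "card (\<Union>q\<in>Q. trees q {1..n}) = (\<Sum>q\<in>Q. card (trees q {1..n}))"
        by (rule card_UN_disjoint) (use finite_states finite_trees in \<open>auto simp: trees_def\<close>)
      ultimately show ?thesis by (simp add: num_trees_def)
    qed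
    then show "?E $ n = (\<Sum>q\<in>Q. forest_series [q]) $ n"
      by (simp add: forest_series_singleton fps_sum_nth tree_series_def sum_divide_distrib num_trees_0)
  qed
  show ?thesis
  proof (rule differential_algebraic_if_fps_local[OF finY finW W])
    show "fps_X \<in> fps_alg Y" by (auto simp: Y_def intro: fps_alg.generator)
    show "?E \<in> fps_alg Y"
      unfolding E by (rule fps_alg_sum, rule fs) (simp add: L_def max_arity_def)
    fix y assume "y \<in> Y"
    then consider "y = fps_X" | qs where "qs \<in> L" "y = forest_series qs" by (auto simp: Y_def)
    then show "fps_deriv y \<in> fps_alg (Y \<union> W)"
    proof cases
      case 1
      then show ?thesis by (simp add: fps_alg_1)
    next
      case (2 qs)
      show ?thesis
      proof (cases qs)
        case Nil
        then show ?thesis using 2 by (simp add: forest_series_Nil fps_alg_0)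
      next
        case (Cons p ps)
        then have "ps \<in> L" "p \<in> Q" using 2(1) by (auto simp: L_def)
        then have "forest_series ps \<in> fps_alg (Y \<union> W)"
          "fps_deriv (tree_series p) \<in> fps_alg (Y \<union> W)"
          using fps_alg_mono[OF fs] by (auto simp: W_def intro: fps_alg.generator)
        then show ?thesis using 2(2) Cons by (simp add: deriv_forest_series_Cons fps_alg.mult)
      qed
    qed
  qed
qed

end

end

section \<open>Shuffle regular patterns\<close>

text \<open>An occurrence of the pattern at the root of the tree. Only skeletons are compared, so
  the leaf order is forgotten and a bottom-up computation can decide it.\<close>

definition matches :: "('u, nat) ltree \<Rightarrow> ('u, nat) ltree \<Rightarrow> bool" where
  "matches p t \<longleftrightarrow> (\<exists>u. pruning t u \<and> planar_skeleton u = planar_skeleton p)"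

lemma planar_skeleton_simps [simp]:
  "planar_skeleton (Leaf l) = Leaf ()"
  "planar_skeleton (Vertex u ts) = Vertex u (map planar_skeleton ts)"
  by (simp_all add: planar_skeleton_def)

lemma planar_skeleton_map [simp]: "planar_skeleton (map_ltree id f t) = planar_skeleton t"
  by (induction t) auto

lemma planar_skeleton_eq_Leaf [simp]: "planar_skeleton t = Leaf () \<longleftrightarrow> (\<exists>l. t = Leaf l)"
  by (cases t) auto

lemma matches_Leaf [simp]: "matches (Leaf l) t"
  unfolding matches_def using pruning.intros(1)[of t] by (intro exI) auto

lemma matches_Vertex_Leaf [simp]: "\<not> matches (Vertex u ps) (Leaf l)"
  unfolding matches_def by (auto elim: pruning.cases)

text \<open>Prunings of the children are chosen independently of each other, which gives the
  recursion for matching at a vertex.\<close>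

lemma matches_list:
  "list_all2 matches ps ts \<longleftrightarrow>
    (\<exists>us. list_all2 pruning ts us \<and> map planar_skeleton us = map planar_skeleton ps)"
proof (induction ps arbitrary: ts)
  case Nil
  then show ?case by auto
next
  case (Cons p ps)
  show ?case
  proof (cases ts)
    case Nil
    then show ?thesis by simp
  next
    case (Cons t ts')
    have "list_all2 matches (p # ps) (t # ts') \<longleftrightarrow>
      (\<exists>u. pruning t u \<and> planar_skeleton u = planar_skeleton p) \<and>
      (\<exists>us. list_all2 pruning ts' us \<and> map planar_skeleton us = map planar_skeleton ps)"
      using Cons.IH[of ts'] by (simp add: matches_def[of p t])
    also have "\<dots> \<longleftrightarrow> (\<exists>us. list_all2 pruning (t # ts') us \<and>
        map planar_skeleton us = map planar_skeleton (p # ps))"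
      by (auto simp: list_all2_Cons1 Cons_eq_map_conv map_eq_Cons_conv)
    finally show ?thesis using Cons by simp
  qed
qed

lemma matches_Vertex [simp]:
  "matches (Vertex u ps) (Vertex v ts) \<longleftrightarrow> u = v \<and> list_all2 matches ps ts"
proof
  assume "matches (Vertex u ps) (Vertex v ts)"
  then obtain s where s: "pruning (Vertex v ts) s" "planar_skeleton s = Vertex u (map planar_skeleton ps)"
    by (auto simp: matches_def)
  from s(1) show "u = v \<and> list_all2 matches ps ts"
    by cases (use s(2) in \<open>auto simp: matches_list\<close>)
next
  assume "u = v \<and> list_all2 matches ps ts"
  then obtain us where "list_all2 pruning ts us" "map planar_skeleton us = map planar_skeleton ps"
    by (auto simp: matches_list)
  then show "matches (Vertex u ps) (Vertex v ts)"
    unfolding matches_def using \<open>u = v \<and> _\<close> pruning.intros(2)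
    by (intro exI[of _ "Vertex v us"]) auto
qed

fun unary_height :: "('u, 'l) ltree \<Rightarrow> nat" where
  "unary_height (Vertex u [t]) = Suc (unary_height t)"
| "unary_height _ = 0"

lemma finite_upper_subtrees: "finite {s. upper_subtree t s}"
proof (induction t)
  case (Leaf l)
  have "{s. upper_subtree (Leaf l) s} \<subseteq> {Leaf l}" by (auto elim: upper_subtree.cases)
  then show ?case using finite_subset by blast
next
  case (Vertex u ts)
  have "{s. upper_subtree (Vertex u ts) s} \<subseteq>
      insert (Vertex u ts) (\<Union>t\<in>set ts. {s. upper_subtree t s})"
    by (auto elim: upper_subtree.cases)
  moreover have "finite (insert (Vertex u ts) (\<Union>t\<in>set ts. {s. upper_subtree t s}))"
    using Vertex by auto
  ultimately show ?case using finite_subset by blast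
qed

lemma upper_subtree_child:
  assumes "upper_subtree t (Vertex u ts)" "s \<in> set ts" shows "upper_subtree t s"
  using assms
  by (induction t "Vertex u ts" rule: upper_subtree.induct) (auto intro: upper_subtree.intros)

lemma upper_subtree_Leaf_iff: "upper_subtree (Leaf l) s \<longleftrightarrow> s = Leaf l"
  by (auto elim: upper_subtree.cases intro: upper_subtree.intros)

lemma upper_subtree_Vertex_iff:
  "upper_subtree (Vertex u ts) s \<longleftrightarrow> s = Vertex u ts \<or> (\<exists>t\<in>set ts. upper_subtree t s)"
  by (auto elim: upper_subtree.cases intro: upper_subtree.intros)

text \<open>Here regularity enters: a pruning with the skeleton of a pattern may order its leaves
  differently, but its standardization is then another member of \<open>M\<close> and divides
  \<open>v\<close>.\<close>

lemma divisible_iff_matches: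
  assumes M: "shuffle_regular U M" and v: "v \<in> shuffle_monomials U n"
  shows "(\<exists>w\<in>M. divisible v w) \<longleftrightarrow> (\<exists>w\<in>M. \<exists>s. upper_subtree v s \<and> matches w s)"
proof
  assume "\<exists>w\<in>M. divisible v w"
  then obtain s u f where "map_ltree id f u \<in> M" "upper_subtree v s" "pruning s u"
    by (auto simp: divisible_def connected_subtree_def)
  then show "\<exists>w\<in>M. \<exists>s. upper_subtree v s \<and> matches w s"
    unfolding matches_def using planar_skeleton_map by metis
next
  assume "\<exists>w\<in>M. \<exists>s. upper_subtree v s \<and> matches w s"
  then obtain w s u where w: "w \<in> M" and s: "upper_subtree v s" "pruning s u"
    and sk: "planar_skeleton u = planar_skeleton w"
    by (auto simp: matches_def)
  have "shuffle_tree U s \<and> distinct (leaves s)"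
    using upper_subtree_shuffle_tree[OF s(1)] v by (auto simp: shuffle_monomials_def)
  then have u: "shuffle_tree U u" "distinct (leaves u)" using pruning_shuffle_tree[OF s(2)] by auto
  have "length (leaves u) \<ge> 1" using shuffle_tree_leaves_nonempty[OF u(1)] by (simp add: Suc_le_eq)
  moreover have "planar_skeleton (standardize u) = planar_skeleton w" by (simp add: standardize_def sk)
  ultimately have "standardize u \<in> M"
    using M w standardize_shuffle_monomial[OF u] unfolding shuffle_regular_def by blast
  moreover have "divisible v (standardize u)"
    unfolding divisible_def connected_subtree_def standardize_def
    using s rank_in_strict_mono[of "set (leaves u)"] by blast
  ultimately show "\<exists>w\<in>M. divisible v w" by blast
qed

text \<open>The state of a tree records which subpatterns of \<open>M\<close> match at its root and the length of
  the chain of unary vertices at its root. The latter serves as the rank that makes the linear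
  system for the derivatives of the generating series solvable.\<close>

locale pattern_avoidance =
  fixes U :: "nat \<Rightarrow> 'u set" and M :: "('u, nat) ltree set" and L :: nat
  assumes finite_patterns: "finite M"
    and finite_operations: "finite {(n, u). n \<ge> 1 \<and> u \<in> U n}"
begin

text \<open>The partial matches to remember: whether a pattern matches at a vertex depends on
  whether its children match at the children of that vertex.\<close>

definition subpatterns :: "('u, nat) ltree set" where
  "subpatterns = {p. \<exists>w\<in>M. upper_subtree w p}"

definition leaf_state :: "('u, nat) ltree set \<times> nat" where
  "leaf_state = ({p \<in> subpatterns. \<exists>l. p = Leaf l}, 0)"

text \<open>A leaf pattern matches every tree; other patterns are decided by the first components at
  the children. A vertex that is not unary resets the chain length to 0.\<close>

definition vertex_state ::
  "'u \<Rightarrow> (('u, nat) ltree set \<times> nat) list \<Rightarrow> ('u, nat) ltree set \<times> nat" where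
  "vertex_state u qs =
    ({p \<in> subpatterns. (\<exists>l. p = Leaf l) \<or>
        (\<exists>ps. p = Vertex u ps \<and> list_all2 (\<lambda>p q. p \<in> fst q) ps qs)},
     case qs of [q] \<Rightarrow> Suc (snd q) | _ \<Rightarrow> 0)"

text \<open>Excludes states in which a complete pattern matches. The cutoff \<open>L\<close> keeps
  the set finite in spite of the counter.\<close>

definition avoiding_states :: "(('u, nat) ltree set \<times> nat) set" where
  "avoiding_states = {A. A \<subseteq> subpatterns \<and> A \<inter> M = {}} \<times> {..L}"

lemma finite_subpatterns: "finite subpatterns"
  using finite_patterns finite_upper_subtrees by (auto simp: subpatterns_def)

lemma M_subpatterns: "M \<subseteq> subpatterns"
  by (auto simp: subpatterns_def intro: upper_subtree.intros)

sublocale tree_automaton U vertex_state leaf_state avoiding_states snd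
proof
  show "finite {(n, u). n \<ge> 1 \<and> u \<in> U n}" by (rule finite_operations)
  show "finite avoiding_states"
    unfolding avoiding_states_def using finite_subpatterns by simp
qed (simp add: vertex_state_def)

lemma fst_leaf_state: "fst leaf_state = {p \<in> subpatterns. \<exists>l. p = Leaf l}"
  and snd_leaf_state: "snd leaf_state = 0"
  by (simp_all add: leaf_state_def)

lemma fst_vertex_state: "fst (vertex_state u qs) = {p \<in> subpatterns. (\<exists>l. p = Leaf l) \<or>
    (\<exists>ps. p = Vertex u ps \<and> list_all2 (\<lambda>p q. p \<in> fst q) ps qs)}"
  and snd_vertex_state: "snd (vertex_state u qs) = (case qs of [q] \<Rightarrow> Suc (snd q) | _ \<Rightarrow> 0)"
  by (simp_all add: vertex_state_def)

text \<open>Induction is possible because the children of a subpattern are again subpatterns, so the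
  states of the children know whether they match.\<close>

lemma fst_state: "fst (state t) = {p \<in> subpatterns. matches p t}"
proof (induction t)
  case (Leaf l)
  have "matches p (Leaf l) \<longleftrightarrow> (\<exists>l. p = Leaf l)" for p :: "('u, nat) ltree" by (cases p) auto
  then show ?case unfolding state.simps fst_leaf_state by blast
next
  case (Vertex u ts)
  have "(\<exists>l. p = Leaf l) \<or> (\<exists>ps. p = Vertex u ps \<and> list_all2 (\<lambda>p q. p \<in> fst q) ps (map state ts))
      \<longleftrightarrow> matches p (Vertex u ts)" if p: "p \<in> subpatterns" for p
  proof (cases p)
    case (Vertex v ps)
    have "ps ! i \<in> subpatterns" if "i < length ps" for i
    proof -
      obtain w where "w \<in> M" "upper_subtree w (Vertex v ps)"
        using p by (auto simp: Vertex subpatterns_def)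
      then show ?thesis
        using upper_subtree_child[OF _ nth_mem[OF that]] unfolding subpatterns_def by blast
    qed
    moreover have "fst (state (ts ! i)) = {p \<in> subpatterns. matches p (ts ! i)}"
      if "i < length ts" for i
      using Vertex.IH that by simp
    ultimately have "list_all2 (\<lambda>p q. p \<in> fst q) ps (map state ts) \<longleftrightarrow> list_all2 matches ps ts"
      by (auto simp: list_all2_conv_all_nth)
    then show ?thesis by (auto simp: Vertex)
  qed simp
  then show ?case unfolding state.simps fst_vertex_state by blast
qed

lemma snd_state: "snd (state t) = unary_height t"
proof (induction t rule: unary_height.induct)
  case (1 u t)
  then show ?case by (simp add: snd_vertex_state)
qed (simp_all add: snd_vertex_state snd_leaf_state)

lemma accepted_iff_upper_subtree:
  "accepted t \<longleftrightarrow> (\<forall>s. upper_subtree t s \<longrightarrow> state s \<in> avoiding_states)"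
proof (induction t)
  case (Leaf l)
  then show ?case by (simp add: upper_subtree_Leaf_iff)
next
  case (Vertex u ts)
  then have "accepted (Vertex u ts) \<longleftrightarrow> state (Vertex u ts) \<in> avoiding_states \<and>
      (\<forall>t\<in>set ts. \<forall>s. upper_subtree t s \<longrightarrow> state s \<in> avoiding_states)"
    by simp
  then show ?case unfolding upper_subtree_Vertex_iff by blast
qed

lemma accepted_iff_matches:
  "accepted t \<longleftrightarrow> (\<forall>s. upper_subtree t s \<longrightarrow> (\<forall>w\<in>M. \<not> matches w s) \<and> unary_height s \<le> L)"
proof -
  have "state s \<in> avoiding_states \<longleftrightarrow> (\<forall>w\<in>M. \<not> matches w s) \<and> unary_height s \<le> L" for s
  proof -
    have "state s \<in> avoiding_states \<longleftrightarrow>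
        fst (state s) \<subseteq> subpatterns \<and> fst (state s) \<inter> M = {} \<and> snd (state s) \<le> L"
      by (cases "state s") (simp add: avoiding_states_def)
    then show ?thesis unfolding fst_state snd_state using M_subpatterns by blast
  qed
  then show ?thesis by (simp add: accepted_iff_upper_subtree)
qed

end

text \<open>Cutting above the last vertex of the unary chain at the root leaves a tree with one
  leaf.\<close>

lemma unary_chain_pruning:
  "\<exists>u. pruning t u \<and> length (leaves u) = 1 \<and> unary_height u = unary_height t"
proof (induction t rule: unary_height.induct)
  case (1 v t)
  then obtain u where u: "pruning t u" "length (leaves u) = 1" "unary_height u = unary_height t"
    by blast
  have "pruning (Vertex v [t]) (Vertex v [u])" by (rule pruning.intros(2)) (simp add: u(1))
  then show ?case using u(2,3) by (intro exI[of _ "Vertex v [u]"]) simp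
qed (rule exI, rule conjI, rule pruning.intros(1), simp)+

lemma unary_height_map [simp]: "unary_height (map_ltree id f t) = unary_height t"
  by (induction t rule: unary_height.induct) auto

lemma (in shuffle_presentation) differential_algebraic_normal_monomials:
  assumes G: "groebner_basis le C G" "0 \<notin> G" "finite G"
    and regular: "shuffle_regular U (leading_monomial le ` G)"
    and ops: "finite {(n, u). n \<ge> 1 \<and> u \<in> U n}"
    and fin: "\<And>n. n \<ge> 1 \<Longrightarrow> finite (normal_monomials n)"
  shows "differential_algebraic
    (Abs_fps (\<lambda>n. if n = 0 then 0 else of_nat (card (normal_monomials n)) / fact n))"
proof -
  let ?M = "leading_monomial le ` G"
  \<comment> \<open>The bound comes from the finitely many normal monomials of arity 1;
    \<open>insert 0\<close> covers the case that there are none.\<close>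
  define L where "L = Max (insert 0 (unary_height ` normal_monomials 1))"
  interpret A: pattern_avoidance U ?M L
    using G(3) ops by unfold_locales simp_all
  have normal_iff: "t \<in> normal_monomials n \<longleftrightarrow>
      (\<forall>s. upper_subtree t s \<longrightarrow> (\<forall>w\<in>?M. \<not> matches w s))"
    if "t \<in> shuffle_monomials U n" "n \<ge> 1" for t n
    using leading_iff_divisible[OF G(1,2) that] divisible_iff_matches[OF regular that(1)] that(1)
    by (auto simp: normal_monomials_def)
  \<comment> \<open>The unary chain at any vertex of a normal monomial is, after pruning, a monomial
    of arity 1. It is normal as well, since otherwise the whole tree would be a leading monomial of
    the ideal.\<close>
  have height: "unary_height s \<le> L"
    if t: "t \<in> normal_monomials n" "n \<ge> 1" and s: "upper_subtree t s" for t n s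
  proof -
    obtain u where u: "pruning s u" "length (leaves u) = 1" "unary_height u = unary_height s"
      using unary_chain_pruning by blast
    have tm: "t \<in> shuffle_monomials U n" using t(1) by (simp add: normal_monomials_def)
    then have ts: "shuffle_tree U t" "distinct (leaves t)" by (auto simp: shuffle_monomials_def)
    have ss: "shuffle_tree U s" "distinct (leaves s)" using upper_subtree_shuffle_tree[OF s ts] by auto
    have us: "shuffle_tree U u" "distinct (leaves u)" using pruning_shuffle_tree[OF u(1) ss(1)] ss(2) by auto
    have "\<not> std_leading t"
      using t(1) standardize_id[OF tm] length_leaves_shuffle_monomial[OF tm]
      by (simp add: normal_monomials_def)
    then have "\<not> leading 1 (standardize u)"
      using std_leading_upper_subtree[OF s ts] std_leading_pruning[OF u(1) ss] u(2) by auto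
    then have "standardize u \<in> normal_monomials 1"
      using standardize_shuffle_monomial[OF us] u(2) by (simp add: normal_monomials_def)
    then have "unary_height (standardize u) \<le> L"
      unfolding L_def using fin[of 1] by (intro Max_ge) auto
    then show ?thesis using u(3) by (simp add: standardize_def)
  qed
  \<comment> \<open>The cutoff on unary chains removes no normal monomial, so acceptance is exactly
    normality.\<close>
  have eq: "{t \<in> shuffle_monomials U n. A.accepted t} = normal_monomials n" if n: "n \<ge> 1" for n
  proof (intro set_eqI)
    fix t
    show "t \<in> {t \<in> shuffle_monomials U n. A.accepted t} \<longleftrightarrow> t \<in> normal_monomials n"
    proof (cases "t \<in> shuffle_monomials U n")
      case True
      then show ?thesis
        unfolding A.accepted_iff_matches mem_Collect_eq
        using normal_iff[OF True n] height[OF _ n, of t] by blast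
    qed (simp add: normal_monomials_def)
  qed
  have "differential_algebraic (Abs_fps (\<lambda>n. if n = 0 then 0 else
      of_nat (card {t \<in> shuffle_monomials U n. A.accepted t}) / fact n))"
    by (rule A.differential_algebraic_accepted) (simp add: eq fin)
  also have "(\<lambda>n. if n = 0 then 0 else
        of_nat (card {t \<in> shuffle_monomials U n. A.accepted t}) / fact n :: rat) =
      (\<lambda>n. if n = 0 then 0 else of_nat (card (normal_monomials n)) / fact n)"
    using eq by (auto simp: Suc_le_eq)
  finally show ?thesis .
qed

theorem theorem0p1p4:
  fixes P :: "('k::field_char_0, 'p::ab_group_add) operad"
    and V :: "('k, 'v::ab_group_add) collection"
    and U :: "nat \<Rightarrow> 'v set"
    and C :: "nat \<Rightarrow> (('v, nat) ltree \<Rightarrow>\<^sub>0 'k) set"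
  assumes "symmetric_operad P"
    and "finitely_generated P"
    and "finite_dimensional_components P"
    and "presentation P V U C"
    and "shuffle_regular_finite_groebner_basis U C"
  shows "differential_algebraic (exponential_generating_series P)"
proof -
  obtain \<phi> where \<phi>: "shuffle_epimorphism P U \<phi>"
    "\<And>n. n \<ge> 1 \<Longrightarrow> C n = {f \<in> free_component U n. \<phi> f = 0}"
    using assms(4) unfolding presentation_def by blast
  obtain le G where ops: "finite {(n, u). n \<ge> 1 \<and> u \<in> U n}"
    and le: "admissible_order U le" and G: "reduced_groebner_basis le C G" "finite G"
    "shuffle_regular U (leading_monomial le ` G)"
    using assms(5) unfolding shuffle_regular_finite_groebner_basis_def by blast
  have "vector_space (smult P)"
    using assms(1) by (simp add: symmetric_operad_def symmetric_collection.vector_space)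
  then interpret vector_space "smult P" .
  interpret shuffle_presentation P U C \<phi> le
    by unfold_locales (use \<phi> le in auto)
  have G': "groebner_basis le C G" "0 \<notin> G"
    using G(1) by (auto simp: reduced_groebner_basis_def)
  have dim: "finite (normal_monomials n)" "dim (component P n) = card (normal_monomials n)"
    if "n \<ge> 1" for n
    using assms(3) dim_component[OF that] that unfolding finite_dimensional_components_def by blast+
  have "exponential_generating_series P =
      Abs_fps (\<lambda>n. if n = 0 then 0 else of_nat (card (normal_monomials n)) / fact n)"
    unfolding exponential_generating_series_def using dim(2)
    by (intro arg_cong[of _ _ Abs_fps]) (auto simp: Suc_le_eq)
  then show ?thesis
    using differential_algebraic_normal_monomials[OF G' G(2,3) ops dim(1)] by simp
qed

end
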